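(* Let $I,J$ be monomial ideals of $\mathcal O_n$ of finite colength such that $I\subseteq\overline J$. Then $$\mathcal L_J^{(i)}(I)\le\frac{a_{i,J}(I)}{M_J}$$ for all $i\in\{1,\dots,n-1\}$.
   Context: $\mathcal O_n$ is the ring of analytic function germs $(\mathbb C^n,0)\to\mathbb C$, with fixed coordinates $x_1,\dots,x_n$. The bar denotes integral closure of ideals. A monomial ideal is a proper ideal generated by monomials. Newton data. For a nonzero ideal $I$, $\operatorname{supp}(I)$ is the union of the supports (sets of exponents of nonzero Taylor terms) of its elements, and $\Gamma_+(I)$ is the convex hull of $\{k+v:k\in\operatorname{supp}(I),\,v\in\mathbb R^n_{\ge0}\}$. For $v\in\mathbb R^n_{\ge 0}$ put $\ell(v,\Gamma_+)=\min\{\langle v,k\rangle:k\in\Gamma_+\}$ and $\Delta(v,\Gamma_+)=\{k\in\Gamma_+:\langle v,k\rangle=\ell(v,\Gamma_+)\}$; the sets $\Delta(v,\Gamma_+)$ are the faces of $\Gamma_+$, and facets are faces of dimension $n-1$. Let $J$ be a monomial ideal of finite colength and let $v^1,\dots,v^s\in\mathbb Z^n_{\ge0}$ be the primitive (gcd of components equal to $1$) vectors $v$ supporting some facet of $\Gamma_+(J)$ with $\ell(v,\Gamma_+(J))>0$. Set $M_J=\operatorname{lcm}\{\ell(v^j,\Gamma_+(J)):j=1,\dots,s\}$ and $\phi_J(k)=\min_{j}\frac{M_J}{\ell(v^j,\Gamma_+(J))}\langle k,v^j\rangle$ for $k\in\mathbb R^n_{\ge0}$. For a closed set $A\subseteq\mathbb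 R^n_{\ge0}$, $\nu_J(A)=\min\{\phi_J(k):k\in A\}$. For a subset $\Delta$, $C(\Delta)$ is the union of all half-lines from the origin through a point of $\Delta$. For monomial ideals $I,J$ of finite colength and $i\in\{1,\dots,n\}$, $$a_{i,J}(I)=\max\{\nu_J(\Gamma_+(I)\cap C(\Delta)):\Delta\text{ is a compact face of }\Gamma_+(J)\text{ of dimension } n-i\}.$$ Łojasiewicz exponents. Let $e(I_1,\dots,I_n)$ denote the mixed multiplicity (Teissier–Risler) of ideals of finite colength. For ideals $I_1,\dots,I_n,J$ of finite colength, $\mathcal L_J(I_1,\dots,I_n)=\inf\{\frac rs:r,s\in\mathbb Z_{\ge1},\ e(I_1^s,\dots,I_n^s)=e(I_1^s+J^r,\dots,I_n^s+J^r)\}$, and $\mathcal L_J^{(i)}(I)=\mathcal L_J(I,\dots,I,J,\dots,J)$ with $I$ repeated $i$ times and $J$ repeated $n-i$ times. *)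

theory Defs
  imports
    "HOL-Analysis.Analysis"
    "HOL-Algebra.Ideal_Product"
    "HOL-Algebra.QuotRing"
    "HOL-Algebra.Embedded_Algebras"
    "HOL-Algebra.Algebraic_Closure_Type"
begin

section \<open>The ring of analytic function germs at the origin\<close>

text \<open>The number of variables is the cardinality of the index type \<open>'n\<close>; exponents of monomials
  are vectors of type \<open>nat ^ 'n\<close>.\<close>

definition monom_fun :: "nat ^ 'n \<Rightarrow> complex ^ 'n \<Rightarrow> complex" where
  "monom_fun k x = (\<Prod>j\<in>UNIV. x $ j ^ (k $ j))"

definition has_expansion :: "(complex ^ 'n \<Rightarrow> complex) \<Rightarrow> (nat ^ 'n \<Rightarrow> complex) \<Rightarrow> bool" where
  "has_expansion f c \<longleftrightarrow> (\<forall>\<^sub>F x in nhds 0. ((\<lambda>k. c k * monom_fun k x) has_sum f x) UNIV)"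

definition analytic_at_0 :: "(complex ^ 'n \<Rightarrow> complex) \<Rightarrow> bool" where
  "analytic_at_0 f \<longleftrightarrow> (\<exists>c. has_expansion f c)"

lemma monom_fun_0 [simp]: "monom_fun 0 x = 1"
  by (simp add: monom_fun_def)

lemma monom_fun_add: "monom_fun (k + l) x = monom_fun k x * monom_fun l x"
  by (simp add: monom_fun_def power_add prod.distrib)

lemma has_expansion_monomial:
  "has_expansion (\<lambda>x. a * monom_fun k x) (\<lambda>l. if l = k then a else 0)"
proof -
  have "((\<lambda>l. (if l = k then a else 0) * monom_fun l x) has_sum (a * monom_fun k x)) UNIV" for x
    by (rule has_sum_finite_neutralI[where B = "{k}"]) auto
  then show ?thesis
    by (simp add: has_expansion_def)
qed

lemma has_expansion_add:
  assumes "has_expansion f c" and "has_expansion g d"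
  shows "has_expansion (\<lambda>x. f x + g x) (\<lambda>k. c k + d k)"
  using assms unfolding has_expansion_def
  by eventually_elim (simp add: distrib_right has_sum_add)

lemma has_expansion_uminus:
  assumes "has_expansion f c"
  shows "has_expansion (\<lambda>x. - f x) (\<lambda>k. - c k)"
  using assms unfolding has_expansion_def
  by eventually_elim (simp add: has_sum_uminus)

lemma finite_add_fibre: "finite {p :: (nat ^ 'n::finite) \<times> (nat ^ 'n). fst p + snd p = m}"
proof -
  have fin: "finite {k :: nat ^ 'n. \<forall>j. k $ j \<le> m $ j}"
  proof -
    have "finite (vec_nth ` {k :: nat ^ 'n. \<forall>j. k $ j \<le> m $ j})"
    proof (rule finite_subset)
      show "vec_nth ` {k :: nat ^ 'n. \<forall>j. k $ j \<le> m $ j} \<subseteq> PiE UNIV (\<lambda>j. {..m $ j})"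
        by auto
    qed (auto intro: finite_PiE)
    moreover have "inj_on vec_nth {k :: nat ^ 'n. \<forall>j. k $ j \<le> m $ j}"
      by (auto simp: inj_on_def vec_eq_iff)
    ultimately show ?thesis
      using finite_imageD by blast
  qed
  show ?thesis
    by (rule finite_subset[OF _ finite_cartesian_product[OF fin fin]]) (auto simp: vec_eq_iff, metis le_add1, metis le_add2)
qed

lemma has_sum_mult_complex:
  fixes a b :: "_ \<Rightarrow> complex"
  assumes a: "(a has_sum A) UNIV" and b: "(b has_sum B) UNIV"
  shows "((\<lambda>(k, l). a k * b l) has_sum (A * B)) (UNIV \<times> UNIV)"
proof (rule has_sum_SigmaI)
  show "((\<lambda>l. case (k, l) of (k, l) \<Rightarrow> a k * b l) has_sum a k * B) UNIV" for k
    using has_sum_cmult_right[OF b, of "a k"] by simp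
  show "((\<lambda>k. a k * B) has_sum A * B) UNIV"
    by (rule has_sum_cmult_left[OF a])
  have na: "(\<lambda>k. norm (a k)) summable_on UNIV" and nb: "(\<lambda>l. norm (b l)) summable_on UNIV"
    using a b summable_on_iff_abs_summable_on_complex summable_on_def by blast+
  have "(\<lambda>p. norm (case p of (k, l) \<Rightarrow> a k * b l)) summable_on (UNIV \<times> UNIV)"
    using na nb
    by (subst Infinite_Sum.abs_summable_on_Sigma_iff)
      (auto simp: norm_mult infsum_cmult_right' infsum_nonneg
        intro!: summable_on_cmult_left summable_on_cmult_right)
  then show "(\<lambda>(k, l). a k * b l) summable_on (UNIV \<times> UNIV)"
    by (rule Infinite_Sum.abs_summable_summable)
qed

lemma has_expansion_mult:
  assumes "has_expansion f c" and "has_expansion g d"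
  shows "has_expansion (\<lambda>x. f x * g x) (\<lambda>m. \<Sum>p | fst p + snd p = m. c (fst p) * d (snd p))"
  using assms unfolding has_expansion_def
proof eventually_elim
  case (elim x)
  let ?h = "\<lambda>p. (c (fst p) * monom_fun (fst p) x) * (d (snd p) * monom_fun (snd p) x)"
  have "(?h has_sum (f x * g x)) UNIV"
    using has_sum_mult_complex[OF elim] by (simp add: case_prod_unfold)
  also have "(?h has_sum (f x * g x)) UNIV \<longleftrightarrow>
      ((\<lambda>q. ?h (snd q)) has_sum (f x * g x)) (Sigma UNIV (\<lambda>m. {p. fst p + snd p = m}))"
    by (rule has_sum_reindex_bij_witness[of _ snd "\<lambda>p. (fst p + snd p, p)"]) auto
  finally have "((\<lambda>q. ?h (snd q)) has_sum (f x * g x)) (Sigma UNIV (\<lambda>m. {p. fst p + snd p = m}))" .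
  then have "((\<lambda>m. \<Sum>p | fst p + snd p = m. ?h p) has_sum (f x * g x)) UNIV"
    by (rule has_sum_SigmaD) (simp add: finite_add_fibre has_sum_finite)
  moreover have "(\<Sum>p | fst p + snd p = m. ?h p) =
      (\<Sum>p | fst p + snd p = m. c (fst p) * d (snd p)) * monom_fun m x" for m
    unfolding sum_distrib_right by (rule sum.cong) (auto simp: monom_fun_add)
  ultimately show ?case
    by simp
qed

lemma analytic_at_0_monomial: "analytic_at_0 (\<lambda>x. a * monom_fun k x)"
  unfolding analytic_at_0_def using has_expansion_monomial by blast

lemma analytic_at_0_const: "analytic_at_0 (\<lambda>x. a)"
  using analytic_at_0_monomial[of a 0] by simp

quotient_type 'n germ = "complex ^ 'n \<Rightarrow> complex" / partial:
  "\<lambda>f g. analytic_at_0 f \<and> analytic_at_0 g \<and> (\<forall>\<^sub>F x in nhds 0. f x = g x)"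
proof (rule part_equivpI)
  show "\<exists>f :: complex ^ 'n \<Rightarrow> complex.
      analytic_at_0 f \<and> analytic_at_0 f \<and> (\<forall>\<^sub>F x in nhds 0. f x = f x)"
    using analytic_at_0_const by auto
  show "symp (\<lambda>f g :: complex ^ 'n \<Rightarrow> complex.
      analytic_at_0 f \<and> analytic_at_0 g \<and> (\<forall>\<^sub>F x in nhds 0. f x = g x))"
    by (auto simp: symp_def eq_commute)
  show "transp (\<lambda>f g :: complex ^ 'n \<Rightarrow> complex.
      analytic_at_0 f \<and> analytic_at_0 g \<and> (\<forall>\<^sub>F x in nhds 0. f x = g x))"
    by (auto simp: transp_def elim: eventually_elim2)
qed

instantiation germ :: (finite) comm_ring_1
begin

lift_definition zero_germ :: "'a germ" is "\<lambda>x. 0"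
  by (simp add: analytic_at_0_const)

lift_definition one_germ :: "'a germ" is "\<lambda>x. 1"
  by (simp add: analytic_at_0_const)

lift_definition plus_germ :: "'a germ \<Rightarrow> 'a germ \<Rightarrow> 'a germ" is "\<lambda>f g x. f x + g x"
  unfolding analytic_at_0_def by (auto intro: has_expansion_add elim: eventually_elim2)

lift_definition uminus_germ :: "'a germ \<Rightarrow> 'a germ" is "\<lambda>f x. - f x"
  unfolding analytic_at_0_def by (auto intro: has_expansion_uminus elim: eventually_mono)

lift_definition times_germ :: "'a germ \<Rightarrow> 'a germ \<Rightarrow> 'a germ" is "\<lambda>f g x. f x * g x"
  unfolding analytic_at_0_def by (auto intro: has_expansion_mult elim: eventually_elim2)

definition minus_germ :: "'a germ \<Rightarrow> 'a germ \<Rightarrow> 'a germ" where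
  "minus_germ f g = f + - g"

instance
proof
  fix a b c :: "'a germ"
  have closed: "analytic_at_0 (\<lambda>x. f x + g x)" "analytic_at_0 (\<lambda>x. f x * g x)"
      "analytic_at_0 (\<lambda>x. - f x)"
    if "analytic_at_0 f" "analytic_at_0 g" for f g :: "complex ^ 'a \<Rightarrow> complex"
    using that has_expansion_add has_expansion_mult has_expansion_uminus
    unfolding analytic_at_0_def by blast+
  note simps = closed analytic_at_0_const algebra_simps
  show "a + b + c = a + (b + c)" by transfer (auto simp: simps)
  show "a + b = b + a" by transfer (auto simp: simps)
  show "0 + a = a" by transfer (auto simp: simps)
  show "- a + a = 0" by transfer (auto simp: simps)
  show "a - b = a + - b" by (simp add: minus_germ_def)
  show "a * b * c = a * (b * c)" by transfer (auto simp: simps)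
  show "a * b = b * a" by transfer (auto simp: simps)
  show "1 * a = a" by transfer (auto simp: simps)
  show "(a + b) * c = a * c + b * c" by transfer (auto simp: simps)
  show "(0 :: 'a germ) \<noteq> 1"
    by transfer (auto simp: analytic_at_0_const dest: eventually_nhds_x_imp_x)
qed

end

lift_definition const_germ :: "complex \<Rightarrow> 'n::finite germ" is "\<lambda>a x. a"
  by (simp add: analytic_at_0_const)

lift_definition monom_germ :: "nat ^ 'n \<Rightarrow> 'n::finite germ" is "monom_fun"
  using analytic_at_0_monomial[of 1] by simp

text \<open>Taylor coefficients: the expansion of an analytic germ is unique.\<close>

lift_definition taylor_coeff :: "'n::finite germ \<Rightarrow> nat ^ 'n \<Rightarrow> complex" is
  "\<lambda>f. THE c. has_expansion f c"
proof -
  fix f g :: "complex ^ 'n \<Rightarrow> complex"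
  assume "analytic_at_0 f \<and> analytic_at_0 g \<and> (\<forall>\<^sub>F x in nhds 0. f x = g x)"
  then have eq: "\<forall>\<^sub>F x in nhds 0. f x = g x" by blast
  have "has_expansion f c \<longleftrightarrow> has_expansion g c" for c
    unfolding has_expansion_def by (rule eventually_subst) (use eq in eventually_elim, simp)
  then show "(THE c. has_expansion f c) = (THE c. has_expansion g c)" by simp
qed

abbreviation germ_ring :: "'n::finite germ ring" (\<open>\<O>\<close>) where
  "\<O> \<equiv> ring_of_type_algebra"

section \<open>Ideals\<close>

abbreviation ideal_pow :: "'n::finite germ set \<Rightarrow> nat \<Rightarrow> 'n germ set" where
  "ideal_pow I k \<equiv> I [^]\<^bsub>ideals_set \<O>\<^esub> k"

definition monomial_ideal :: "'n::finite germ set \<Rightarrow> bool" where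
  "monomial_ideal I \<longleftrightarrow> I \<noteq> UNIV \<and> (\<exists>S. I = Idl\<^bsub>\<O>\<^esub> (monom_germ ` S))"

definition integral_closure :: "('a, 'b) ring_scheme \<Rightarrow> 'a set \<Rightarrow> 'a set" where
  "integral_closure R I = {x \<in> carrier R. \<exists>(m::nat) a. 1 \<le> m \<and>
     (\<forall>j\<in>{1..m}. a j \<in> I [^]\<^bsub>ideals_set R\<^esub> j) \<and>
     x [^]\<^bsub>R\<^esub> m \<oplus>\<^bsub>R\<^esub> (\<Oplus>\<^bsub>R\<^esub>j\<in>{1..m}. a j \<otimes>\<^bsub>R\<^esub> x [^]\<^bsub>R\<^esub> (m - j)) = \<zero>\<^bsub>R\<^esub>}"

text \<open>The colength of \<open>I\<close> is the complex dimension of \<open>\<O> / I\<close>, whose scalars are the residue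
  classes of the constant germs.\<close>

definition quot_scalars :: "'n::finite germ set \<Rightarrow> 'n germ set set" where
  "quot_scalars I = range (\<lambda>z. I +>\<^bsub>\<O>\<^esub> const_germ z)"

definition finite_colength :: "'n::finite germ set \<Rightarrow> bool" where
  "finite_colength I \<longleftrightarrow> ideal I \<O> \<and>
     ring.finite_dimension (\<O> Quot I) (quot_scalars I) (carrier (\<O> Quot I))"

definition colength :: "'n::finite germ set \<Rightarrow> nat" where
  "colength I = ring.dim (\<O> Quot I) (quot_scalars I) (carrier (\<O> Quot I))"

section \<open>Mixed multiplicities and Lojasiewicz exponents\<close>

text \<open>Sequences of \<open>n = CARD('n)\<close> ideals are functions on \<open>nat\<close> of which only the values at
  \<open>0, \<dots>, n - 1\<close> matter. For ideals of finite colength, the colength of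
  \<open>I\<^sub>0\<^bsup>r 0\<^esup> \<cdots> I\<^sub>n\<^sub>-\<^sub>1\<^bsup>r (n-1)\<^esup>\<close> is, for all large \<open>r\<close>, a polynomial in \<open>r\<close> of total
  degree \<open>n\<close>, with leading form the sum over \<open>\<bar>k\<bar> = n\<close> of
  \<open>e(I\<^sub>0, \<dots>, I\<^sub>n\<^sub>-\<^sub>1; k) r\<^bsup>k\<^esup> / k!\<close>, where each \<open>I\<^sub>j\<close> is repeated \<open>k j\<close> times. So the mixed
  multiplicity of the sequence itself is the coefficient of \<open>r 0 \<cdots> r (n-1)\<close>.\<close>

definition poly_exponents :: "nat \<Rightarrow> (nat \<Rightarrow> nat) set" where
  "poly_exponents n = {k. (\<forall>j\<ge>n. k j = 0) \<and> (\<Sum>j<n. k j) \<le> n}"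

definition hilbert_polynomial :: "(nat \<Rightarrow> 'n::finite germ set) \<Rightarrow> ((nat \<Rightarrow> nat) \<Rightarrow> real) \<Rightarrow> bool" where
  "hilbert_polynomial I c \<longleftrightarrow> (\<exists>N. \<forall>r. (\<forall>j<CARD('n). N \<le> r j) \<longrightarrow>
     real (colength (\<Otimes>\<^bsub>ideals_set \<O>\<^esub>j\<in>{..<CARD('n)}. ideal_pow (I j) (r j))) =
     (\<Sum>k\<in>poly_exponents CARD('n). c k * (\<Prod>j<CARD('n). real (r j) ^ k j)))"

definition mixed_multiplicity :: "(nat \<Rightarrow> 'n::finite germ set) \<Rightarrow> real" where
  "mixed_multiplicity I =
     (THE e. \<exists>c. hilbert_polynomial I c \<and> e = c (\<lambda>j. if j < CARD('n) then 1 else 0))"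

text \<open>The infimum is taken in \<open>ereal\<close>, so that it would be infinite on an empty set.\<close>

definition lojasiewicz :: "'n::finite germ set \<Rightarrow> (nat \<Rightarrow> 'n germ set) \<Rightarrow> ereal" where
  "lojasiewicz J I = Inf {ereal (real r / real s) | r s. 1 \<le> r \<and> 1 \<le> s \<and>
     mixed_multiplicity (\<lambda>j. ideal_pow (I j) s) =
     mixed_multiplicity (\<lambda>j. ideal_pow (I j) s <+>\<^bsub>\<O>\<^esub> ideal_pow J r)}"

definition lojasiewicz_rel :: "nat \<Rightarrow> 'n::finite germ set \<Rightarrow> 'n germ set \<Rightarrow> ereal" where
  "lojasiewicz_rel i J I = lojasiewicz J (\<lambda>j. if j < i then I else J)"

section \<open>Newton data\<close>

definition real_vec :: "nat ^ 'n \<Rightarrow> real ^ 'n" where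
  "real_vec k = (\<chi> j. real (k $ j))"

definition nonneg_vecs :: "(real ^ 'n) set" where
  "nonneg_vecs = {v. \<forall>j. 0 \<le> v $ j}"

definition germ_supp :: "'n::finite germ set \<Rightarrow> (nat ^ 'n) set" where
  "germ_supp I = {k. \<exists>f\<in>I. taylor_coeff f k \<noteq> 0}"

definition newton_poly :: "'n::finite germ set \<Rightarrow> (real ^ 'n) set" where
  "newton_poly I = convex hull {real_vec k + v | k v. k \<in> germ_supp I \<and> v \<in> nonneg_vecs}"

text \<open>The minima in \<open>supp_min\<close> and \<open>filtration_min\<close> are written as infima; they are attained in
  the cases used here (Newton polyhedra are closed, and for \<open>J\<close> proper of finite colength the
  filtration tends to infinity on the nonnegative orthant).\<close>

definition supp_min :: "real ^ 'n \<Rightarrow> (real ^ 'n) set \<Rightarrow> real" where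
  "supp_min v G = (INF k\<in>G. v \<bullet> k)"

definition newton_face :: "real ^ 'n \<Rightarrow> (real ^ 'n) set \<Rightarrow> (real ^ 'n) set" where
  "newton_face v G = {k \<in> G. v \<bullet> k = supp_min v G}"

definition facet_normals :: "'n::finite germ set \<Rightarrow> (nat ^ 'n) set" where
  "facet_normals J = {v. Gcd (range (vec_nth v)) = 1 \<and>
     aff_dim (newton_face (real_vec v) (newton_poly J)) = int CARD('n) - 1 \<and>
     supp_min (real_vec v) (newton_poly J) > 0}"

text \<open>For \<open>v \<in> facet_normals J\<close> the minimum is attained at a lattice point, so the floor
  only converts a natural number from type \<open>real\<close> to type \<open>nat\<close>.\<close>

definition newton_lcm :: "'n::finite germ set \<Rightarrow> nat" where
  "newton_lcm J = Lcm ((\<lambda>v. nat \<lfloor>supp_min (real_vec v) (newton_poly J)\<rfloor>) ` facet_normals J)"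

definition newton_filtration :: "'n::finite germ set \<Rightarrow> real ^ 'n \<Rightarrow> real" where
  "newton_filtration J k = Min ((\<lambda>v. real (newton_lcm J) / supp_min (real_vec v) (newton_poly J)
     * (k \<bullet> real_vec v)) ` facet_normals J)"

definition filtration_min :: "'n::finite germ set \<Rightarrow> (real ^ 'n) set \<Rightarrow> real" where
  "filtration_min J A = (INF k\<in>A. newton_filtration J k)"

definition half_lines :: "(real ^ 'n) set \<Rightarrow> (real ^ 'n) set" where
  "half_lines D = {t *\<^sub>R x | t x. 0 \<le> t \<and> x \<in> D}"

definition compact_faces :: "'n::finite germ set \<Rightarrow> int \<Rightarrow> (real ^ 'n) set set" where
  "compact_faces J d = {D. (\<exists>v\<in>nonneg_vecs. D = newton_face v (newton_poly J)) \<and>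
     compact D \<and> aff_dim D = d}"

definition face_order :: "nat \<Rightarrow> 'n::finite germ set \<Rightarrow> 'n germ set \<Rightarrow> real" where
  "face_order i J I = Max ((\<lambda>D. filtration_min J (newton_poly I \<inter> half_lines D)) `
     compact_faces J (int CARD('n) - int i))"

end

theory Submission
  imports Defs
    "HOL-Computational_Algebra.Polynomial"
    "HOL-Library.Set_Algebras"
begin

text \<open>Write \<open>h\<^sub>I(v)\<close> for the minimum of \<open>\<langle>v, k\<rangle>\<close> on the Newton polyhedron of \<open>I\<close>. If \<open>r / s\<close> exceeds
  \<open>a\<^bsub>i,J\<^esub>(I) / M\<^sub>J\<close>, then every compact face \<open>D\<close> of the polyhedron of \<open>J\<close> of dimension \<open>n - i\<close> has a
  point \<open>x\<close> such that \<open>t x\<close> lies in the polyhedron of \<open>I\<close> for some \<open>t < r / s\<close>; hence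
  \<open>s h\<^sub>I \<le> r h\<^sub>J\<close> on the normal cone of every compact face of dimension at least \<open>n - i\<close>. By Farkas'
  lemma, a lattice point in a product of \<open>a\<close> copies of \<open>I\<^sup>s + J\<^sup>r\<close> and \<open>b\<close> copies of \<open>J\<^sup>s\<close> that lies
  far from \<open>b\<close> times the compact faces of dimension less than \<open>n - i\<close> can be rewritten as a point
  of the polyhedron of the product in which \<open>I\<^sup>s\<close> replaces \<open>I\<^sup>s + J\<^sup>r\<close>. So the colengths of the two
  products differ by at most a constant times \<open>a\<^sup>i\<^sup>+\<^sup>1 b\<^sup>n\<^sup>-\<^sup>i\<^sup>-\<^sup>1 + (a + b)\<^sup>n\<^sup>-\<^sup>1\<close>, which is too little to
  affect the coefficient of \<open>a\<^sup>i b\<^sup>n\<^sup>-\<^sup>i\<close>, and with it the mixed multiplicity. Since \<open>I\<close> lies in the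
  integral closure of \<open>J\<close>, the bound forces \<open>r \<ge> s\<close>, so adding \<open>J\<^sup>r\<close> does not change \<open>J\<^sup>s\<close>.\<close>

text \<open>The comparison of support functions holds only over the large faces of the polyhedron of
  J, so I^s and I^s + J^r may well have different integral closures, and equality of the
  multiplicities cannot be inferred from the closures. It comes from the n - i factors J: they
  supply generators along a face, and an exchange borrows a bounded amount from them for each of the
  a factors. It can fail only where the generators with large coefficients span dimension at most n
  - i - 1. Such points have about b^(n-i-1) positions along the face and lie within a multiple of a
  in the other directions; this is the origin of the error term. Mixed multiplicities are given by
  \<open>THE\<close> through Hilbert polynomials, so the existence of these polynomials is part of
  the proof. Colengths are counted as lattice points outside Minkowski sums of up-sets, and the
  multiplicity is read off as a coefficient, so volumes never appear. The strict inequality between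
  r / s and the bound allows the infima defining the filtration minima to be used without showing
  that they are attained; density of the rationals then removes the strictness.\<close>

no_notation fps_nth (infixl \<open>$\<close> 75)

section \<open>Polynomial functions of several natural numbers\<close>

text \<open>Induction on the variables: with all but one frozen, a polynomial with infinitely many
  roots has zero coefficients. Exponents are functions on the whole index type, and injectivity of
  the restriction to \<open>A\<close> makes distinct elements of \<open>K\<close> distinct
  monomials.\<close>

lemma multivariate_poly_vanish:
  fixes c :: "('i \<Rightarrow> nat) \<Rightarrow> 'a::field"
  assumes "finite A" "infinite Z" "finite K" "inj_on (\<lambda>k. restrict k A) K"
    and "\<And>\<rho>. (\<forall>j\<in>A. \<rho> j \<in> Z) \<Longrightarrow> (\<Sum>k\<in>K. c k * (\<Prod>j\<in>A. \<rho> j ^ k j)) = 0"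
    and "k \<in> K"
  shows "c k = 0"
  using assms(1,3-)
proof (induction A arbitrary: K c k rule: finite_induct)
  case empty
  have "K = {k}"
    using empty.prems(2,4) by (auto simp: inj_on_def restrict_def)
  then show ?case
    using empty.prems(3)[of undefined] by simp
next
  case (insert a A)
  let ?K = "{l \<in> K. l a = k a}"
  show ?case
  proof (rule insert.IH[of ?K])
    show "finite ?K" "k \<in> ?K"
      using insert.prems by auto
    show "inj_on (\<lambda>k. restrict k A) ?K"
    proof (rule inj_onI)
      fix x y assume xy: "x \<in> ?K" "y \<in> ?K" "restrict x A = restrict y A"
      then have "x j = y j" if "j \<in> A" for j
        using that by (metis restrict_apply')
      then have "restrict x (insert a A) = restrict y (insert a A)"
        using xy by (intro restrict_ext) auto
      then show "x = y"
        using inj_onD[OF insert.prems(2), of x y] xy(1,2) by simp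
    qed
    fix \<rho> :: "'i \<Rightarrow> 'a" assume \<rho>: "\<forall>j\<in>A. \<rho> j \<in> Z"
    \<comment> \<open>The sum as a polynomial in the variable \<open>a\<close>, the others frozen at
      \<open>\<rho>\<close>. Its coefficient at \<open>k a\<close> is the sum over \<open>?K\<close>
      to which the induction hypothesis applies.\<close>
    define p where "p = (\<Sum>k\<in>K. Polynomial.monom (c k * (\<Prod>j\<in>A. \<rho> j ^ k j)) (k a))"
    have "poly p x = 0" if "x \<in> Z" for x
    proof -
      have eq: "(\<Prod>j\<in>A. (\<rho>(a := x)) j ^ k j) = (\<Prod>j\<in>A. \<rho> j ^ k j)" for k
        using insert.hyps by (intro prod.cong) auto
      have "(\<Sum>k\<in>K. c k * (\<Prod>j\<in>insert a A. (\<rho>(a := x)) j ^ k j)) = 0"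
        using \<rho> that by (intro insert.prems(3)) auto
      moreover have "(\<Prod>j\<in>insert a A. (\<rho>(a := x)) j ^ k j) = x ^ k a * (\<Prod>j\<in>A. \<rho> j ^ k j)" for k
        unfolding prod.insert[OF insert.hyps] eq by simp
      moreover have "poly p x = (\<Sum>k\<in>K. c k * (x ^ k a * (\<Prod>j\<in>A. \<rho> j ^ k j)))"
        unfolding p_def poly_sum poly_monom by (intro sum.cong refl) (simp only: mult_ac)
      ultimately show ?thesis
        by (simp only:)
    qed
    then have "Z \<subseteq> {x. poly p x = 0}"
      by auto
    then have "p = 0"
      using poly_roots_finite assms(2) finite_subset by blast
    then have "0 = Polynomial.coeff p (k a)"
      by simp
    also have "\<dots> = (\<Sum>l\<in>K. if l a = k a then c l * (\<Prod>j\<in>A. \<rho> j ^ l j) else 0)"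
      unfolding p_def coeff_sum coeff_monom ..
    also have "\<dots> = (\<Sum>l\<in>?K. c l * (\<Prod>j\<in>A. \<rho> j ^ l j))"
      using insert.prems(1) by (simp add: sum.inter_filter)
    finally show "(\<Sum>l\<in>?K. c l * (\<Prod>j\<in>A. \<rho> j ^ l j)) = 0"
      by simp
  qed
qed

text \<open>Since \<open>n\<close> only bounds the degree, the limit also detects that the
  coefficient at \<open>n\<close> is zero.\<close>

lemma poly_over_power_tendsto:
  fixes p :: "real poly"
  assumes "Polynomial.degree p \<le> n"
  shows "(\<lambda>x::nat. poly p (real x) / real x ^ n) \<longlonglongrightarrow> Polynomial.coeff p n"
proof -
  have "(\<lambda>x. (\<Sum>i\<le>n. Polynomial.coeff p i * (real x ^ i / real x ^ n))) \<longlonglongrightarrow>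
      (\<Sum>i\<le>n. Polynomial.coeff p i * (if i = n then 1 else 0))"
  proof (intro tendsto_sum tendsto_mult tendsto_const)
    fix i assume "i \<in> {..n}"
    show "(\<lambda>x. real x ^ i / real x ^ n) \<longlonglongrightarrow> (if i = n then 1 else 0)"
    proof (cases "i = n")
      case True
      have "\<forall>\<^sub>F x in sequentially. real x ^ i / real x ^ n = 1"
        using eventually_gt_at_top[of 0] by eventually_elim (simp add: True)
      then show ?thesis
        using True by (simp add: tendsto_eventually)
    next
      case False
      then have "i < n"
        using \<open>i \<in> {..n}\<close> by simp
      have "\<forall>\<^sub>F x in sequentially. inverse (real x ^ (n - i)) = real x ^ i / real x ^ n"
        using eventually_gt_at_top[of 0]
        by eventually_elim (use \<open>i < n\<close> in \<open>simp add: power_diff field_simps\<close>)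
      moreover have "(\<lambda>x. inverse (real x) ^ (n - i)) \<longlonglongrightarrow> 0"
        using \<open>i < n\<close> lim_inverse_n tendsto_power[of _ 0 _ "n - i"] by (fastforce simp: zero_power)
      ultimately show ?thesis
        using False by (simp add: power_inverse filterlim_cong)
    qed
  qed
  moreover have "(\<Sum>i\<le>n. Polynomial.coeff p i * (real x ^ i / real x ^ n)) = poly p (real x) / real x ^ n" for x
  proof -
    have "poly p (real x) = (\<Sum>i\<le>n. Polynomial.coeff p i * real x ^ i)"
      unfolding poly_altdef using assms
      by (intro sum.mono_neutral_left) (auto simp: coeff_eq_0)
    then show ?thesis
      by (simp add: sum_divide_distrib)
  qed
  ultimately show ?thesis
    by (simp add: if_distrib cong: if_cong)
qed

text \<open>If the degree exceeded \<open>d\<close>, dividing by that power of \<open>x\<close>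
  would send the bound to 0, whereas the quotient tends to the leading coefficient.\<close>

lemma poly_bounded_degree:
  fixes p :: "real poly"
  assumes "\<And>x::nat. N \<le> x \<Longrightarrow> \<bar>poly p (real x)\<bar> \<le> C * real x ^ d"
  shows "Polynomial.degree p \<le> d"
proof (rule ccontr)
  assume "\<not> Polynomial.degree p \<le> d"
  then have less: "d < Polynomial.degree p" by simp
  have "(\<lambda>x::nat. poly p (real x) / real x ^ Polynomial.degree p) \<longlonglongrightarrow> 0"
  proof (rule tendsto_rabs_zero_cancel, rule tendsto_sandwich[OF _ _ tendsto_const])
    show "\<forall>\<^sub>F x::nat in sequentially. \<bar>poly p (real x) / real x ^ Polynomial.degree p\<bar> \<le> \<bar>C\<bar> * inverse (real x)"
      using eventually_ge_at_top[of "Suc N"]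
    proof eventually_elim
      case (elim x)
      have "\<bar>poly p (real x)\<bar> \<le> C * real x ^ d"
        using assms elim by simp
      also have "\<dots> \<le> \<bar>C\<bar> * real x ^ (Polynomial.degree p - 1)"
        using less elim by (intro mult_mono) (auto intro: power_increasing)
      finally have "\<bar>poly p (real x)\<bar> / real x ^ Polynomial.degree p \<le> \<bar>C\<bar> * real x ^ (Polynomial.degree p - 1) / real x ^ Polynomial.degree p"
        by (intro divide_right_mono) auto
      also have "\<dots> = \<bar>C\<bar> * inverse (real x)"
        using less elim by (cases "Polynomial.degree p") (auto simp: field_simps)
      finally show ?case
        by (simp add: abs_divide)
    qed
    show "(\<lambda>x. \<bar>C\<bar> * inverse (real x)) \<longlonglongrightarrow> 0"
      using tendsto_mult_right_zero[OF lim_inverse_n] by auto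
  qed auto
  then have "Polynomial.lead_coeff p = 0"
    using poly_over_power_tendsto[of p "Polynomial.degree p"] LIMSEQ_unique by blast
  then show False
    using less by auto
qed

text \<open>No degree bound is built in; it is recovered from growth in
  \<open>eventually_poly_bounded_degree\<close>. Exponents are 0 from \<open>p\<close> on, so that
  every monomial has exactly one representative.\<close>

definition eventually_poly :: "nat \<Rightarrow> ((nat \<Rightarrow> nat) \<Rightarrow> real) \<Rightarrow> bool" where
  "eventually_poly p h \<longleftrightarrow> (\<exists>K c N. finite K \<and> K \<subseteq> {k. \<forall>j\<ge>p. k j = 0} \<and>
     (\<forall>r. (\<forall>j<p. N \<le> r j) \<longrightarrow> h r = (\<Sum>k\<in>K. c k * (\<Prod>j<p. real (r j) ^ k j))))"

lemma eventually_poly_zero: "eventually_poly p (\<lambda>r. 0)"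
  unfolding eventually_poly_def by (rule exI[of _ "{}"]) auto

lemma eventually_poly_add:
  assumes "eventually_poly p f" "eventually_poly p g"
  shows "eventually_poly p (\<lambda>r. f r + g r)"
proof -
  obtain K c N where f: "finite K" "K \<subseteq> {k. \<forall>j\<ge>p. k j = 0}"
      "\<And>r. (\<forall>j<p. N \<le> r j) \<Longrightarrow> f r = (\<Sum>k\<in>K. c k * (\<Prod>j<p. real (r j) ^ k j))"
    using assms(1) unfolding eventually_poly_def by blast
  obtain L d M where g: "finite L" "L \<subseteq> {k. \<forall>j\<ge>p. k j = 0}"
      "\<And>r. (\<forall>j<p. M \<le> r j) \<Longrightarrow> g r = (\<Sum>k\<in>L. d k * (\<Prod>j<p. real (r j) ^ k j))"
    using assms(2) unfolding eventually_poly_def by blast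
  let ?e = "\<lambda>k. (if k \<in> K then c k else 0) + (if k \<in> L then d k else 0)"
  have "f r + g r = (\<Sum>k\<in>K \<union> L. ?e k * (\<Prod>j<p. real (r j) ^ k j))"
    if "\<forall>j<p. max N M \<le> r j" for r
  proof -
    have "f r = (\<Sum>k\<in>K \<union> L. (if k \<in> K then c k else 0) * (\<Prod>j<p. real (r j) ^ k j))"
      using that f g(1) by (subst f(3)) (auto intro!: sum.mono_neutral_cong_left)
    moreover have "g r = (\<Sum>k\<in>K \<union> L. (if k \<in> L then d k else 0) * (\<Prod>j<p. real (r j) ^ k j))"
      using that g f(1) by (subst g(3)) (auto intro!: sum.mono_neutral_cong_left)
    ultimately show ?thesis
      by (simp add: distrib_right sum.distrib)
  qed
  then show ?thesis
    unfolding eventually_poly_def using f(1,2) g(1,2)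
    by (intro exI[of _ "K \<union> L"] exI[of _ ?e] exI[of _ "max N M"]) auto
qed

lemma eventually_poly_uminus:
  assumes "eventually_poly p f"
  shows "eventually_poly p (\<lambda>r. - f r)"
proof -
  obtain K c N where f: "finite K" "K \<subseteq> {k. \<forall>j\<ge>p. k j = 0}"
      "\<And>r. (\<forall>j<p. N \<le> r j) \<Longrightarrow> f r = (\<Sum>k\<in>K. c k * (\<Prod>j<p. real (r j) ^ k j))"
    using assms(1) unfolding eventually_poly_def by blast
  then show ?thesis
    unfolding eventually_poly_def
    by (intro exI[of _ K] exI[of _ "\<lambda>k. - c k"] exI[of _ N]) (auto simp: sum_negf)
qed

lemma eventually_poly_diff:
  assumes "eventually_poly p f" "eventually_poly p g"
  shows "eventually_poly p (\<lambda>r. f r - g r)"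
  using eventually_poly_add[OF assms(1) eventually_poly_uminus[OF assms(2)]] by simp

lemma eventually_poly_cong:
  assumes "eventually_poly p f" "\<And>r. (\<forall>j<p. N \<le> r j) \<Longrightarrow> f r = g r"
  shows "eventually_poly p g"
proof -
  obtain K c M where f: "finite K" "K \<subseteq> {k. \<forall>j\<ge>p. k j = 0}"
      "\<And>r. (\<forall>j<p. M \<le> r j) \<Longrightarrow> f r = (\<Sum>k\<in>K. c k * (\<Prod>j<p. real (r j) ^ k j))"
    using assms(1) unfolding eventually_poly_def by blast
  show ?thesis
    unfolding eventually_poly_def
    by (rule exI[of _ K], rule exI[of _ c], rule exI[of _ "max M N"])
      (use f assms(2) in \<open>auto simp: assms(2)[symmetric]\<close>)
qed

lemma eventually_poly_prod_univariate:
  fixes g :: "nat \<Rightarrow> nat \<Rightarrow> real"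
  assumes "\<And>j. j < p \<Longrightarrow> \<exists>q N. \<forall>x\<ge>N. g j x = poly q (real x)"
  shows "eventually_poly p (\<lambda>r. \<Prod>j<p. g j (r j))"
proof -
  have "\<exists>q N. \<forall>j<p. \<forall>x\<ge>N j. g j x = poly (q j) (real x)"
    using assms by metis
  then obtain q N where qN: "\<And>j x. j < p \<Longrightarrow> N j \<le> x \<Longrightarrow> g j x = poly (q j) (real x)"
    by blast
  define M where "M = Max (insert 0 (N ` {..<p}))"
  have M: "N j \<le> M" if "j < p" for j
    unfolding M_def using that by (intro Max_ge) auto
  define E where "E = PiE {..<p} (\<lambda>j. {..Polynomial.degree (q j)})"
  \<comment> \<open>Elements of \<open>PiE\<close> are \<open>undefined\<close> from
    \<open>p\<close> on, whereas \<open>eventually_poly\<close> asks for exponents that are 0 there;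
    \<open>z\<close> translates.\<close>
  define z where "z = (\<lambda>k j. if j < p then k j else (0::nat))"
  have finE: "finite E"
    unfolding E_def by (intro finite_PiE) auto
  have inj: "inj_on z E"
  proof (rule inj_onI)
    fix x y assume xy: "x \<in> E" "y \<in> E" "z x = z y"
    then have "x j = y j" if "j < p" for j
      using that unfolding z_def by metis
    then show "x = y"
      using xy(1,2) unfolding E_def by (intro PiE_ext[of x _ _ y]) auto
  qed
  define c where "c = (\<lambda>k. \<Prod>j<p. Polynomial.coeff (q j) (k j))"
  have "(\<Prod>j<p. g j (r j)) = (\<Sum>k\<in>z ` E. c k * (\<Prod>j<p. real (r j) ^ k j))"
    if "\<forall>j<p. M \<le> r j" for r
  proof -
    have "(\<Prod>j<p. g j (r j)) = (\<Prod>j<p. \<Sum>i\<le>Polynomial.degree (q j). Polynomial.coeff (q j) i * real (r j) ^ i)"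
    proof (intro prod.cong refl)
      fix j assume "j \<in> {..<p}"
      then have "N j \<le> r j"
        using that M[of j] by (meson lessThan_iff order_trans)
      then show "g j (r j) = (\<Sum>i\<le>Polynomial.degree (q j). Polynomial.coeff (q j) i * real (r j) ^ i)"
        using qN[of j] \<open>j \<in> {..<p}\<close> by (simp add: poly_altdef)
    qed
    also have "\<dots> = (\<Sum>k\<in>E. \<Prod>j<p. Polynomial.coeff (q j) (k j) * real (r j) ^ k j)"
      unfolding E_def by (rule prod_sum_PiE) auto
    also have "\<dots> = (\<Sum>k\<in>E. c (z k) * (\<Prod>j<p. real (r j) ^ z k j))"
      unfolding c_def by (intro sum.cong refl) (simp add: z_def prod.distrib)
    also have "\<dots> = (\<Sum>k\<in>z ` E. c k * (\<Prod>j<p. real (r j) ^ k j))"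
      using inj by (simp add: sum.reindex)
    finally show ?thesis .
  qed
  then show ?thesis
    unfolding eventually_poly_def using finE
    by (intro exI[of _ "z ` E"] exI[of _ c] exI[of _ M]) (auto simp: z_def)
qed

lemma finite_bounded_exponents:
"finite {k :: nat \<Rightarrow> nat. (\<forall>j\<ge>p. k j = 0) \<and> (\<Sum>j<p. k j) \<le> n}"
proof (rule finite_subset)
  show "{k :: nat \<Rightarrow> nat. (\<forall>j\<ge>p. k j = 0) \<and> (\<Sum>j<p. k j) \<le> n} \<subseteq> {k. \<forall>j. (j \<in> {..<p} \<longrightarrow> k j \<in> {..n}) \<and> (j \<notin> {..<p} \<longrightarrow> k j = 0)}"
  proof clarify
    fix k :: "nat \<Rightarrow> nat" and j assume k: "\<forall>j\<ge>p. k j = 0" "(\<Sum>j<p. k j) \<le> n"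
    have "j < p \<Longrightarrow> k j \<le> (\<Sum>j<p. k j)"
      by (rule member_le_sum) auto
    then show "(j \<in> {..<p} \<longrightarrow> k j \<in> {..n}) \<and> (j \<notin> {..<p} \<longrightarrow> k j = 0)"
      using k by auto
  qed
  show "finite {k::nat \<Rightarrow> nat. \<forall>j. (j \<in> {..<p} \<longrightarrow> k j \<in> {..n}) \<and> (j \<notin> {..<p} \<longrightarrow> k j = 0)}"
    by (rule finite_set_of_finite_funs) auto
qed

lemma inj_on_restrict_zero_outside:
  "inj_on (\<lambda>k. restrict k {..<p}) {k :: nat \<Rightarrow> nat. \<forall>j\<ge>p. k j = 0}"
proof (rule inj_onI)
  fix x y :: "nat \<Rightarrow> nat"
  assume xy: "x \<in> {k. \<forall>j\<ge>p. k j = 0}" "y \<in> {k. \<forall>j\<ge>p. k j = 0}"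
    "restrict x {..<p} = restrict y {..<p}"
  show "x = y"
  proof
    fix j show "x j = y j"
    proof (cases "j < p")
      case True
      then show ?thesis using xy(3) by (metis lessThan_iff restrict_apply')
    qed (use xy in simp)
  qed
qed

text \<open>Along a ray \<open>r j = x * s j\<close> the homogeneous components become the
  coefficients of a polynomial in \<open>x\<close> of degree at most \<open>n\<close>. So each
  component of higher degree vanishes at all positive integral \<open>s\<close>, and therefore
  coefficientwise.\<close>

lemma eventually_poly_bounded_degree:
  assumes h: "eventually_poly p h"
    and bd: "\<And>r. (\<forall>j<p. N \<le> r j) \<Longrightarrow> \<bar>h r\<bar> \<le> C * real ((\<Sum>j<p. r j) + 1) ^ n"
  shows "\<exists>c N. \<forall>r. (\<forall>j<p. N \<le> r j) \<longrightarrow>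
     h r = (\<Sum>k | (\<forall>j\<ge>p. k j = 0) \<and> (\<Sum>j<p. k j) \<le> n. c k * (\<Prod>j<p. real (r j) ^ k j))"
proof -
  obtain K c M where f: "finite K" "K \<subseteq> {k. \<forall>j\<ge>p. k j = 0}"
      "\<And>r. (\<forall>j<p. M \<le> r j) \<Longrightarrow> h r = (\<Sum>k\<in>K. c k * (\<Prod>j<p. real (r j) ^ k j))"
    using h unfolding eventually_poly_def by blast
  let ?deg = "\<lambda>k. \<Sum>j<p. k j :: nat"
  have zero: "c l = 0" if l: "l \<in> K" "n < ?deg l" for l
  proof (rule multivariate_poly_vanish[of "{..<p}" "real ` {1..}" "{k\<in>K. ?deg k = ?deg l}" c l])
    show "infinite (real ` {1..})"
      by (simp add: finite_image_iff infinite_Ici)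
    show "inj_on (\<lambda>k. restrict k {..<p}) {k \<in> K. ?deg k = ?deg l}"
      using f(2) by (intro inj_on_subset[OF inj_on_restrict_zero_outside]) auto
    fix \<rho> :: "nat \<Rightarrow> real" assume "\<forall>j\<in>{..<p}. \<rho> j \<in> real ` {1..}"
    then have "\<exists>s. \<forall>j\<in>{..<p}. \<rho> j = real (s j) \<and> 1 \<le> s j"
      by (intro bchoice) auto
    then obtain s where s: "\<And>j. j < p \<Longrightarrow> \<rho> j = real (s j)" "\<And>j. j < p \<Longrightarrow> 1 \<le> s j"
      by blast
    define q where "q = (\<Sum>k\<in>K. Polynomial.monom (c k * (\<Prod>j<p. \<rho> j ^ k j)) (?deg k))"
    have "Polynomial.degree q \<le> n"
    proof (rule poly_bounded_degree)
      fix x :: nat assume x: "max 1 (max N M) \<le> x"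
      have big: "max N M \<le> x * s j" if "j < p" for j
        using s(2)[OF that] x by (metis max.boundedE mult.right_neutral mult_le_mono order_trans)
      have "poly q (real x) = (\<Sum>k\<in>K. c k * (\<Prod>j<p. real (x * s j) ^ k j))"
        unfolding q_def poly_sum poly_monom
        by (intro sum.cong refl) (simp add: s power_mult_distrib prod.distrib power_sum mult_ac)
      also have "\<dots> = h (\<lambda>j. x * s j)"
        using big by (subst f(3)) auto
      finally have "\<bar>poly q (real x)\<bar> \<le> C * real ((\<Sum>j<p. x * s j) + 1) ^ n"
        using bd[of "\<lambda>j. x * s j"] big by auto
      also have "\<dots> \<le> \<bar>C\<bar> * (real ((\<Sum>j<p. s j) + 1) * real x) ^ n"
      proof (intro mult_mono power_mono)
        have "(\<Sum>j<p. x * s j) + 1 \<le> ((\<Sum>j<p. s j) + 1) * x"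
          using x by (simp add: sum_distrib_left[symmetric] algebra_simps)
        then show "real ((\<Sum>j<p. x * s j) + 1) \<le> real ((\<Sum>j<p. s j) + 1) * real x"
          by (metis of_nat_le_iff of_nat_mult)
      qed (simp_all del: of_nat_add of_nat_sum)
      finally show "\<bar>poly q (real x)\<bar> \<le> (\<bar>C\<bar> * real ((\<Sum>j<p. s j) + 1) ^ n) * real x ^ n"
        by (simp add: power_mult_distrib mult_ac)
    qed
    then have "Polynomial.coeff q (?deg l) = 0"
      using l by (intro coeff_eq_0) auto
    then show "(\<Sum>k\<in>{k\<in>K. ?deg k = ?deg l}. c k * (\<Prod>j\<in>{..<p}. \<rho> j ^ k j)) = 0"
      using f(1) by (simp add: q_def coeff_sum sum.inter_filter if_distrib cong: if_cong)
  qed (use f l in auto)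
  let ?P = "{k. (\<forall>j\<ge>p. k j = 0) \<and> ?deg k \<le> n}"
  let ?c = "\<lambda>k. if k \<in> K then c k else 0"
  have "finite ?P"
    by (rule finite_bounded_exponents)
  then have "(\<Sum>k\<in>K. c k * (\<Prod>j<p. real (r j) ^ k j)) = (\<Sum>k\<in>?P. ?c k * (\<Prod>j<p. real (r j) ^ k j))" for r
    using f(1)
  proof (rule sum.mono_neutral_cong)
    show "?c k * (\<Prod>j<p. real (r j) ^ k j) = 0" if "k \<in> ?P - K" for k
      using that by simp
    show "c k * (\<Prod>j<p. real (r j) ^ k j) = 0" if "k \<in> K - ?P" for k
      using that zero[of k] f(2) by (auto simp: not_le)
  qed simp
  then show ?thesis
    using f(3) by (intro exI[of _ ?c] exI[of _ M]) simp
qed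

text \<open>This makes the \<open>THE\<close> in \<open>mixed_multiplicity\<close> well
  defined.\<close>

lemma eventually_poly_coeff_unique:
  fixes c d :: "(nat \<Rightarrow> nat) \<Rightarrow> real"
  assumes "finite K" "K \<subseteq> {k. \<forall>j\<ge>p. k j = 0}"
    and c: "\<And>r. (\<forall>j<p. N \<le> r j) \<Longrightarrow> h r = (\<Sum>k\<in>K. c k * (\<Prod>j<p. real (r j) ^ k j))"
    and d: "\<And>r. (\<forall>j<p. M \<le> r j) \<Longrightarrow> h r = (\<Sum>k\<in>K. d k * (\<Prod>j<p. real (r j) ^ k j))"
    and "k \<in> K"
  shows "c k = d k"
proof -
  have "c k - d k = 0"
  proof (rule multivariate_poly_vanish[of "{..<p}" "real ` {max N M..}" K "\<lambda>k. c k - d k" k])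
    show "infinite (real ` {max N M..})"
      by (simp add: finite_image_iff infinite_Ici)
    show "inj_on (\<lambda>k. restrict k {..<p}) K"
      using assms(2) inj_on_subset inj_on_restrict_zero_outside by blast
    fix \<rho> :: "nat \<Rightarrow> real" assume "\<forall>j\<in>{..<p}. \<rho> j \<in> real ` {max N M..}"
    then have "\<exists>s. \<forall>j\<in>{..<p}. \<rho> j = real (s j) \<and> max N M \<le> s j"
      by (intro bchoice) (fastforce simp: image_iff)
    then obtain s where s: "\<And>j. j < p \<Longrightarrow> \<rho> j = real (s j)" "\<And>j. j < p \<Longrightarrow> max N M \<le> s j"
      by blast
    have "(\<Sum>k\<in>K. c k * (\<Prod>j<p. real (s j) ^ k j)) = (\<Sum>k\<in>K. d k * (\<Prod>j<p. real (s j) ^ k j))"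
      using s(2) by (subst c[symmetric], force, subst d[symmetric], auto)
    then show "(\<Sum>k\<in>K. (c k - d k) * (\<Prod>j\<in>{..<p}. \<rho> j ^ k j)) = 0"
      using s(1) by (simp add: left_diff_distrib sum_subtractf)
  qed (use assms in auto)
  then show ?thesis by simp
qed

text \<open>Substituting \<open>r j = x \<rho> j\<close> for \<open>j < i\<close> and \<open>r j = x m \<rho> j\<close> for \<open>j \<ge> i\<close> and letting first
  \<open>x\<close> and then \<open>m\<close> tend to infinity isolates the coefficients of bidegree \<open>(i, n - i)\<close>.\<close>

lemma multilinear_coeff_vanishes:
  fixes c :: "(nat \<Rightarrow> nat) \<Rightarrow> real" and C :: real and n :: nat
  defines "F \<equiv> \<lambda>r. \<Sum>k | (\<forall>j\<ge>n. k j = 0) \<and> (\<Sum>j<n. k j) \<le> n. c k * (\<Prod>j<n. real (r j) ^ k j)"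
  assumes i: "1 \<le> i" "d + i < n" and C: "0 \<le> C"
    and nonneg: "\<And>r. (\<forall>j<n. N \<le> r j) \<Longrightarrow> 0 \<le> F r"
    and bound: "\<And>m r. (\<forall>j<n. N \<le> r j) \<Longrightarrow> 1 \<le> m \<Longrightarrow> (\<Sum>j=i..<n. r j) \<le> m * (\<Sum>j<i. r j) \<Longrightarrow>
      F r \<le> C * (real m ^ d * real (\<Sum>j<i. r j) ^ n + real (\<Sum>j<n. r j) ^ (n - 1))"
  shows "c (\<lambda>j. if j < n then 1 else 0) = 0"
proof -
  define P where "P = {k :: nat \<Rightarrow> nat. (\<forall>j\<ge>n. k j = 0) \<and> (\<Sum>j<n. k j) \<le> n}"
  have finP: "finite P"
    unfolding P_def by (rule finite_bounded_exponents)
  let ?hi = "\<lambda>k :: nat \<Rightarrow> nat. \<Sum>j=i..<n. k j" and ?deg = "\<lambda>k :: nat \<Rightarrow> nat. \<Sum>j<n. k j"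
  \<comment> \<open>The exponents of bidegree \<open>(i, n - i)\<close>; the exponent with all
    entries 1 is one of them.\<close>
  let ?Q = "{k\<in>P. ?deg k = n \<and> ?hi k = n - i}"
  have split: "{..<n} = {..<i} \<union> {i..<n}" "{..<i} \<inter> {i..<n} = {}"
    using i by auto
  show ?thesis
  proof (rule multivariate_poly_vanish[of "{..<n}" "real ` {1..}" ?Q c])
    show "infinite (real ` {1..})"
      by (simp add: finite_image_iff infinite_Ici)
    show "inj_on (\<lambda>k. restrict k {..<n}) ?Q"
      by (intro inj_on_subset[OF inj_on_restrict_zero_outside]) (auto simp: P_def)
    fix \<rho> :: "nat \<Rightarrow> real" assume "\<forall>j\<in>{..<n}. \<rho> j \<in> real ` {1..}"
    then have "\<exists>s. \<forall>j\<in>{..<n}. \<rho> j = real (s j) \<and> 1 \<le> s j"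
      by (intro bchoice) auto
    then obtain s where s: "\<And>j. j < n \<Longrightarrow> \<rho> j = real (s j)" "\<And>j. j < n \<Longrightarrow> 1 \<le> s j"
      by blast
    define A where "A = (\<Sum>j<i. s j)"
    define B where "B = (\<Sum>j=i..<n. s j)"
    have "s 0 \<le> A"
      unfolding A_def using i by (intro member_le_sum) auto
    then have A1: "1 \<le> A"
      using s(2)[of 0] i by simp
    have "s i \<le> B"
      unfolding B_def using i by (intro member_le_sum) auto
    then have B1: "1 \<le> B"
      using s(2)[of i] i by simp
    \<comment> \<open>For fixed \<open>m\<close>, \<open>q m\<close> is the function
      \<open>F\<close> along the two-speed ray as a polynomial in \<open>x\<close>; \<open>e\<close>
      is its coefficient at \<open>x^n\<close>, seen as a polynomial in \<open>m\<close>.\<close>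
    define q where "q = (\<lambda>m::nat. \<Sum>k\<in>P. Polynomial.monom (c k * real m ^ ?hi k * (\<Prod>j<n. \<rho> j ^ k j)) (?deg k))"
    define e where "e = (\<Sum>k\<in>P. if ?deg k = n then Polynomial.monom (c k * (\<Prod>j<n. \<rho> j ^ k j)) (?hi k) else 0)"
    have top: "Polynomial.coeff (q m) n = poly e (real m)" for m
      unfolding q_def e_def poly_sum coeff_sum by (intro sum.cong refl) (auto simp: poly_monom)
    have deg: "Polynomial.degree (q m) \<le> n" for m
      unfolding q_def by (intro degree_sum_le finP) (auto simp: P_def intro: order_trans[OF degree_monom_le])
    define R where "R = (\<lambda>m x j. if j < i then x * s j else x * m * s j)"
    have sumlow: "(\<Sum>j<i. R m x j) = x * A" for m x
      unfolding R_def A_def by (simp add: sum_distrib_left)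
    have sumhi: "(\<Sum>j=i..<n. R m x j) = x * m * B" for m x
      unfolding R_def B_def by (simp add: sum_distrib_left)
    have sumR: "(\<Sum>j<n. R m x j) = x * (A + m * B)" for m x
      unfolding split(1) by (subst sum.union_disjoint) (auto simp: sumlow sumhi algebra_simps)
    have polyq: "poly (q m) (real x) = F (R m x)" for m x
    proof -
      have "(\<Prod>j<n. real (R m x j) ^ k j) = real x ^ ?deg k * real m ^ ?hi k * (\<Prod>j<n. \<rho> j ^ k j)" for k
      proof -
        have "(\<Prod>j<n. real (R m x j) ^ k j) = (\<Prod>j<n. real x ^ k j * (if j < i then 1 else real m ^ k j) * \<rho> j ^ k j)"
          by (intro prod.cong) (auto simp: R_def s power_mult_distrib)
        also have "\<dots> = real x ^ ?deg k * (\<Prod>j<n. if j < i then 1 else real m ^ k j) * (\<Prod>j<n. \<rho> j ^ k j)"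
          by (simp add: prod.distrib power_sum)
        also have "(\<Prod>j<n. if j < i then 1 else real m ^ k j) = real m ^ ?hi k"
          unfolding split(1) by (subst prod.union_disjoint) (auto simp: power_sum)
        finally show ?thesis .
      qed
      then show ?thesis
        unfolding q_def F_def P_def[symmetric] poly_sum poly_monom by (simp add: mult_ac)
    qed
    have big: "\<forall>j<n. N \<le> R m x j" if "N \<le> x" "1 \<le> m" for m x
    proof (intro allI impI)
      fix j assume "j < n"
      have "1 \<le> s j" "1 \<le> m * s j"
        using s(2)[OF \<open>j < n\<close>] that by simp_all
      then have "x * 1 \<le> x * (m * s j)" "x * 1 \<le> x * s j"
        by (intro mult_le_mono2; simp)+
      then have "x \<le> x * (m * s j)" "x \<le> x * s j"
        by (simp_all only: mult.right_neutral)
      then have "N \<le> x * (m * s j)" "N \<le> x * s j"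
        using that(1) by linarith+
      then show "N \<le> R m x j"
        by (simp add: R_def mult.assoc)
    qed
    have e_lim: "(\<lambda>x. F (R m x) / real x ^ n) \<longlonglongrightarrow> poly e (real m)" for m
      using poly_over_power_tendsto[OF deg[of m]] by (simp add: polyq top)
    \<comment> \<open>The limit in \<open>x\<close> kills the term of exponent \<open>n - 1\<close>.
      What remains grows at most like \<open>m^d\<close>, and \<open>d < n - i\<close>, so the
      coefficient of \<open>e\<close> at \<open>n - i\<close> is 0.\<close>
    have "\<bar>poly e (real m)\<bar> \<le> (C * real B ^ d * real A ^ n) * real m ^ d" if m: "1 \<le> m" for m
    proof -
      have "0 \<le> poly e (real m)"
      proof (rule tendsto_lowerbound[OF e_lim])
        show "\<forall>\<^sub>F x in sequentially. 0 \<le> F (R m x) / real x ^ n"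
          using eventually_ge_at_top[of N] by eventually_elim (use m nonneg big in auto)
      qed simp
      moreover have "poly e (real m) \<le> C * (real (m * B) ^ d * real A ^ n)"
      proof (rule tendsto_le[OF _ _ e_lim])
        show "\<forall>\<^sub>F x in sequentially. F (R m x) / real x ^ n \<le>
            C * (real (m * B) ^ d * real A ^ n) + C * real (A + m * B) ^ (n - 1) * inverse (real x)"
          using eventually_ge_at_top[of "Suc N"]
        proof eventually_elim
          case (elim x)
          have "F (R m x) \<le> C * (real (m * B) ^ d * real (x * A) ^ n + real (x * (A + m * B)) ^ (n - 1))"
          proof -
            \<comment> \<open>The two block sums are \<open>x * A\<close> and
              \<open>x * m * B\<close>, and \<open>1 \<le> A\<close>; so \<open>bound\<close> is
              available with \<open>m * B\<close> as its ratio.\<close>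
            have "x * m * B \<le> m * B * (x * A)"
              using A1 by simp
            then show ?thesis
              using bound[of "R m x" "m * B"] big[of x m] elim m B1 by (simp only: sumlow sumhi sumR) auto
          qed
          also have "\<dots> = C * (real (m * B) ^ d * real A ^ n) * real x ^ n + C * real (A + m * B) ^ (n - 1) * real x ^ (n - 1)"
            by (simp only: of_nat_mult power_mult_distrib distrib_left[of C] mult_ac)
          finally have "F (R m x) / real x ^ n \<le>
            (C * (real (m * B) ^ d * real A ^ n) * real x ^ n + C * real (A + m * B) ^ (n - 1) * real x ^ (n - 1)) / real x ^ n"
            by (rule divide_right_mono) simp
          also have "\<dots> = C * (real (m * B) ^ d * real A ^ n) + C * real (A + m * B) ^ (n - 1) * inverse (real x)"
            using elim i by (cases n) (auto simp: field_simps)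
          finally show ?case .
        qed
        show "(\<lambda>x. C * (real (m * B) ^ d * real A ^ n) + C * real (A + m * B) ^ (n - 1) * inverse (real x))
            \<longlonglongrightarrow> C * (real (m * B) ^ d * real A ^ n)"
          using tendsto_add[OF tendsto_const tendsto_mult_right_zero[OF lim_inverse_n]] by auto
      qed simp
      ultimately show ?thesis
        by (simp add: power_mult_distrib mult_ac)
    qed
    then have "Polynomial.degree e \<le> d"
      by (rule poly_bounded_degree)
    then have "Polynomial.coeff e (n - i) = 0"
      using i by (intro coeff_eq_0) auto
    moreover have "Polynomial.coeff e (n - i) = (\<Sum>k\<in>P. if ?deg k = n \<and> ?hi k = n - i then c k * (\<Prod>j<n. \<rho> j ^ k j) else 0)"
      unfolding e_def coeff_sum by (intro sum.cong refl) auto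
    ultimately show "(\<Sum>k\<in>?Q. c k * (\<Prod>j\<in>{..<n}. \<rho> j ^ k j)) = 0"
      using finP by (simp add: sum.inter_filter)
  next
    show "finite ?Q"
      using finP by simp
    show "(\<lambda>j. if j < n then 1 else 0) \<in> ?Q"
      using i by (auto simp: P_def)
  qed simp
qed

section \<open>Values of coloured sums\<close>

text \<open>Dickson's lemma. Forgetting the coordinate \<open>a\<close>, finitely many elements of
  \<open>S\<close> lie below all others; let \<open>M\<close> bound their values at
  \<open>a\<close>. They also serve for every function whose value at \<open>a\<close> is at least
  \<open>M\<close>, and the finitely many slices with a smaller value are treated one by
  one.\<close>

lemma dickson_fun:
  fixes S :: "('a \<Rightarrow> nat) set"
  assumes "finite T" "S \<subseteq> {f. \<forall>t. t \<notin> T \<longrightarrow> f t = 0}"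
  shows "\<exists>S0. finite S0 \<and> S0 \<subseteq> S \<and> (\<forall>s\<in>S. \<exists>s0\<in>S0. s0 \<le> s)"
  using assms
proof (induction T arbitrary: S rule: finite_induct)
  case empty
  then have "S \<subseteq> {\<lambda>_. 0}" by auto
  then have "finite S"
    using finite_subset by blast
  then show ?case by (intro exI[of _ S]) auto
next
  case (insert a T)
  let ?z = "\<lambda>f::'a \<Rightarrow> nat. f(a := 0)"
  have sub: "?z ` A \<subseteq> {f. \<forall>t. t \<notin> T \<longrightarrow> f t = 0}" if "A \<subseteq> S" for A
    using insert.prems that by auto
  have "\<exists>S0. finite S0 \<and> S0 \<subseteq> A \<and> (\<forall>s\<in>A. \<exists>s0\<in>S0. ?z s0 \<le> ?z s)" if A: "A \<subseteq> S" for A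
  proof -
    obtain B where B: "finite B" "B \<subseteq> ?z ` A" "\<forall>s\<in>?z ` A. \<exists>s0\<in>B. s0 \<le> s"
      using insert.IH[OF sub[OF A]] by blast
    then obtain S0 where "finite S0" "S0 \<subseteq> A" "B = ?z ` S0"
      by (meson finite_subset_image)
    then show ?thesis
      using B(3) by (intro exI[of _ S0]) auto
  qed
  then obtain G where G: "\<And>A. A \<subseteq> S \<Longrightarrow> finite (G A) \<and> G A \<subseteq> A \<and> (\<forall>s\<in>A. \<exists>s0\<in>G A. ?z s0 \<le> ?z s)"
    by metis
  define M where "M = Max (insert 0 ((\<lambda>f. f a) ` G S))"
  have M: "f a \<le> M" if "f \<in> G S" for f
    unfolding M_def using that G[of S] by (intro Max_ge) auto
  have GS: "G A \<subseteq> S" if "A \<subseteq> S" for A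
    using G[OF that] that by blast
  define S0 where "S0 = G S \<union> (\<Union>e<M. G {f\<in>S. f a = e})"
  show ?case
  proof (intro exI[of _ S0] conjI ballI)
    show "finite S0"
      unfolding S0_def using G by (intro finite_UnI finite_UN_I) auto
    show "S0 \<subseteq> S"
      unfolding S0_def by (intro Un_least UN_least GS) auto
    fix s assume s: "s \<in> S"
    show "\<exists>s0\<in>S0. s0 \<le> s"
    proof (cases "M \<le> s a")
      case True
      obtain s0 where s0: "s0 \<in> G S" "?z s0 \<le> ?z s"
        using G[of S] s by auto
      have "s0 t \<le> s t" for t
        using le_funD[OF s0(2), of t] M[OF s0(1)] True by (cases "t = a") auto
      then have "s0 \<le> s" by (rule le_funI)
      then show ?thesis
        using s0(1) unfolding S0_def by blast
    next
      case False
      let ?A = "{f\<in>S. f a = s a}"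
      have "?A \<subseteq> S" by auto
      from G[OF this] obtain s0 where s0: "s0 \<in> G ?A" "?z s0 \<le> ?z s" "s0 \<in> ?A"
        using s by blast
      have "s0 t \<le> s t" for t
        using le_funD[OF s0(2), of t] s0(3) by (cases "t = a") auto
      then have "s0 \<le> s" by (rule le_funI)
      moreover have "s0 \<in> S0"
        using s0(1) False unfolding S0_def by (intro UnI2 UN_I[of "s a"]) auto
      ultimately show ?thesis by blast
    qed
  qed
qed

text \<open>Stars and bars, transferred from lists along an enumeration of \<open>S\<close>. For
  empty \<open>S\<close> the truncated subtraction still gives the right count: 1 if
  \<open>N = 0\<close>, and 0 otherwise.\<close>

lemma card_bounded_sum_functions:
  assumes "finite S"
  shows "card {f :: 'a \<Rightarrow> nat. (\<forall>t. t \<notin> S \<longrightarrow> f t = 0) \<and> sum f S = N} = (N + card S - 1) choose N"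
proof -
  obtain xs where xs: "set xs = S" "distinct xs"
    using finite_distinct_list[OF assms] by blast
  let ?F = "{f :: 'a \<Rightarrow> nat. (\<forall>t. t \<notin> S \<longrightarrow> f t = 0) \<and> sum f S = N}"
  have "bij_betw (\<lambda>f. map f xs) ?F {l. size l = card S \<and> sum_list l = N}"
  proof (rule bij_betw_imageI)
    show "inj_on (\<lambda>f. map f xs) ?F"
    proof (intro inj_onI ext)
      fix f g t assume fg: "f \<in> ?F" "g \<in> ?F" "map f xs = map g xs"
      show "f t = g t"
      proof (cases "t \<in> S")
        case True
        then show ?thesis using fg(3) xs(1) unfolding map_eq_conv by blast
      next
        case False
        then have "f t = 0" "g t = 0" using fg(1,2) by blast+
        then show ?thesis by simp
      qed
    qed
    show "(\<lambda>f. map f xs) ` ?F = {l. size l = card S \<and> sum_list l = N}"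
    proof (intro equalityI subsetI)
      fix l assume "l \<in> (\<lambda>f. map f xs) ` ?F"
      then obtain f where f: "l = map f xs" "sum f S = N"
        by blast
      have "size l = card S"
        unfolding f(1) length_map xs(1)[symmetric] by (rule distinct_card[OF xs(2), symmetric])
      moreover have "sum_list l = N"
        unfolding f(1) sum_list_distinct_conv_sum_set[OF xs(2)] xs(1) by (rule f(2))
      ultimately show "l \<in> {l. size l = card S \<and> sum_list l = N}"
        by blast
    next
      fix l :: "nat list" assume l: "l \<in> {l. size l = card S \<and> sum_list l = N}"
      then have len: "length xs = length l"
        using distinct_card[OF xs(2)] xs(1) by simp
      define f where "f t = (case map_of (zip xs l) t of None \<Rightarrow> 0 | Some y \<Rightarrow> y)" for t
      have "f t = 0" if "t \<notin> S" for t
        using that xs(1) len by (auto simp: f_def split: option.splits dest!: map_of_SomeD set_zip_leftD)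
      moreover have map: "map f xs = l"
        using len xs(2) by (intro nth_equalityI) (auto simp: f_def map_of_zip_nth)
      moreover have "sum f S = N"
        using l sum_list_distinct_conv_sum_set[OF xs(2), of f] unfolding map xs(1) by simp
      ultimately show "l \<in> (\<lambda>f. map f xs) ` ?F"
        by (intro image_eqI[of _ _ f]) blast+
    qed
  qed
  from bij_betw_same_card[OF this] show ?thesis
    unfolding card_length_sum_list .
qed

lemma choose_add_poly: "\<exists>q::real poly. \<forall>x::nat. real ((x + m) choose m) = poly q (real x)"
proof (induction m)
  case 0
  show ?case by (intro exI[of _ 1]) simp
next
  case (Suc m)
  then obtain q :: "real poly" where q: "\<And>x::nat. real ((x + m) choose m) = poly q (real x)"
    by blast
  have "real ((x + Suc m) choose Suc m) = poly (Polynomial.smult (inverse (real (Suc m))) (q * [:real (Suc m), 1:])) (real x)" for x :: nat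
  proof -
    have "Suc m * (Suc (x + m) choose Suc m) = Suc (x + m) * ((x + m) choose m)"
      by (rule Suc_times_binomial_eq[symmetric, simplified mult.commute] | metis Suc_times_binomial_eq mult.commute)
    then have "real (Suc m) * real (Suc (x + m) choose Suc m) = real (Suc (x + m)) * real ((x + m) choose m)"
      by (metis of_nat_mult)
    then show ?thesis
      by (simp add: q[symmetric] field_simps del: binomial_Suc_Suc)
  qed
  then show ?case by blast
qed

text \<open>The threshold is due to \<open>m = 0\<close>, where the count is 1 at
  \<open>x = 0\<close> and 0 afterwards.\<close>

lemma stars_and_bars_poly:
  "\<exists>q::real poly. \<exists>N. \<forall>x\<ge>N. real ((x + m - 1) choose x) = poly q (real x)"
proof (cases m)
  case 0
  have "(x + m - 1) choose x = 0" if "1 \<le> x" for x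
    using that 0 by (simp add: binomial_eq_0)
  then show ?thesis
    by (intro exI[of _ 0] exI[of _ 1]) auto
next
  case (Suc k)
  obtain q :: "real poly" where "\<And>x::nat. real ((x + k) choose k) = poly q (real x)"
    using choose_add_poly by blast
  moreover have "(x + k) choose x = (x + k) choose k" for x
    using binomial_symmetric[of x "x + k"] by simp
  ultimately show ?thesis
    using Suc by (intro exI[of _ q] exI[of _ 0]) simp
qed


text \<open>A function on \<open>T\<close> is a multiset of generators, and
  \<open>\<kappa> t\<close> is the index of the ideal to which \<open>t\<close> belongs. So
  \<open>level r\<close> consists of the products with exactly \<open>r j\<close> factors from the
  ideal \<open>j\<close>.\<close>

locale coloured_sums =
  fixes T :: "'a set" and \<kappa> :: "'a \<Rightarrow> nat" and p :: nat
  assumes fin: "finite T" and col: "\<kappa> ` T \<subseteq> {..<p}"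
begin

definition supported :: "('a \<Rightarrow> nat) set" where
  "supported = {f. \<forall>t. t \<notin> T \<longrightarrow> f t = 0}"

definition fibre :: "nat \<Rightarrow> 'a set" where
  "fibre j = {t\<in>T. \<kappa> t = j}"

definition level :: "(nat \<Rightarrow> nat) \<Rightarrow> ('a \<Rightarrow> nat) set" where
  "level r = {f\<in>supported. \<forall>j<p. sum f (fibre j) = r j}"

lemma finite_fibre: "finite (fibre j)"
  unfolding fibre_def using fin by simp

lemma member_le_level:
  assumes "f \<in> level r" "t \<in> T"
  shows "f t \<le> r (\<kappa> t)"
proof -
  have "f t \<le> sum f (fibre (\<kappa> t))"
    using assms(2) by (intro member_le_sum finite_fibre) (auto simp: fibre_def)
  then show ?thesis
    using assms col by (auto simp: level_def)
qed

lemma finite_level: "finite (level r)"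
proof (rule finite_subset)
  define M where "M = Max (insert 0 (r ` {..<p}))"
  have M: "r j \<le> M" if "j < p" for j
    unfolding M_def using that by (intro Max_ge) auto
  show "level r \<subseteq> {f. \<forall>t. (t \<in> T \<longrightarrow> f t \<in> {..M}) \<and> (t \<notin> T \<longrightarrow> f t = 0)}"
  proof
    fix f assume f: "f \<in> level r"
    have "f t \<le> M" if "t \<in> T" for t
    proof -
      have "\<kappa> t < p" using that col by auto
      then show ?thesis
        using member_le_level[OF f that] M order_trans by blast
    qed
    then show "f \<in> {f. \<forall>t. (t \<in> T \<longrightarrow> f t \<in> {..M}) \<and> (t \<notin> T \<longrightarrow> f t = 0)}"
      using f by (simp add: level_def supported_def)
  qed
  show "finite {f :: 'a \<Rightarrow> nat. \<forall>t. (t \<in> T \<longrightarrow> f t \<in> {..M}) \<and> (t \<notin> T \<longrightarrow> f t = 0)}"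
    using fin by (intro finite_set_of_finite_funs) auto
qed

text \<open>A multiset splits into its colour classes, each counted by stars and bars;
  \<open>\<phi>\<close> and \<open>\<psi>\<close> are the splitting and its inverse.\<close>

lemma card_level: "card (level r) = (\<Prod>j<p. (r j + card (fibre j) - 1) choose r j)"
proof -
  define H where "H j = {f :: 'a \<Rightarrow> nat. (\<forall>t. t \<notin> fibre j \<longrightarrow> f t = 0) \<and> sum f (fibre j) = r j}" for j
  define \<phi> where "\<phi> f = (\<lambda>j\<in>{..<p}. \<lambda>t. if t \<in> fibre j then f t else 0)" for f :: "'a \<Rightarrow> nat"
  define \<psi> where "\<psi> g = (\<lambda>t. if t \<in> T then g (\<kappa> t) t else 0)" for g :: "nat \<Rightarrow> 'a \<Rightarrow> nat"
  have kp: "\<kappa> t < p" if "t \<in> T" for t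
    using that col by auto
  have "bij_betw \<phi> (level r) (PiE {..<p} H)"
  proof (rule bij_betw_byWitness[of _ \<psi>])
    show "\<forall>f\<in>level r. \<psi> (\<phi> f) = f"
      using kp by (auto simp: \<psi>_def \<phi>_def level_def supported_def fibre_def fun_eq_iff)
    show "\<forall>g\<in>PiE {..<p} H. \<phi> (\<psi> g) = g"
    proof
      fix g assume g: "g \<in> PiE {..<p} H"
      show "\<phi> (\<psi> g) = g"
      proof (rule ext)
        fix j
        show "\<phi> (\<psi> g) j = g j"
        proof (cases "j < p")
          case True
          then have "g j \<in> H j"
            using PiE_mem[OF g] by simp
          then show ?thesis
            using True by (auto simp: \<phi>_def \<psi>_def H_def fibre_def fun_eq_iff)
        next
          case False
          then show ?thesis
            using PiE_arb[OF g, of j] by (simp add: \<phi>_def)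
        qed
      qed
    qed
    show "\<phi> ` level r \<subseteq> PiE {..<p} H"
      by (auto simp: \<phi>_def level_def H_def)
    show "\<psi> ` PiE {..<p} H \<subseteq> level r"
    proof
      fix f assume "f \<in> \<psi> ` PiE {..<p} H"
      then obtain g where g: "g \<in> PiE {..<p} H" "f = \<psi> g" by blast
      have "sum f (fibre j) = r j" if "j < p" for j
      proof -
        have "sum f (fibre j) = sum (g j) (fibre j)"
          by (intro sum.cong) (auto simp: g(2) \<psi>_def fibre_def)
        also have "\<dots> = r j"
          using PiE_mem[OF g(1), of j] that by (simp add: H_def)
        finally show ?thesis .
      qed
      then show "f \<in> level r"
        by (simp add: level_def supported_def g(2) \<psi>_def)
    qed
  qed
  then have "card (level r) = card (PiE {..<p} H)"
    by (rule bij_betw_same_card)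
  also have "\<dots> = (\<Prod>j<p. card (H j))"
    by (simp add: card_PiE)
  also have "\<dots> = (\<Prod>j<p. (r j + card (fibre j) - 1) choose r j)"
    unfolding H_def by (intro prod.cong refl card_bounded_sum_functions finite_fibre)
  finally show ?thesis .
qed

text \<open>Subtracting \<open>s\<close> maps these functions bijectively onto the level with sums
  \<open>r j - v j\<close>, whose cardinality is a product of binomials in one variable each. The
  truncated subtraction is harmless once \<open>r j\<close> is at least \<open>v j\<close>.\<close>

lemma eventually_poly_level_above:
  assumes s: "s \<in> supported"
  shows "eventually_poly p (\<lambda>r. real (card {f\<in>level r. s \<le> f}))"
proof (rule eventually_poly_cong)
  define v where "v j = sum s (fibre j)" for j
  define g where "g j x = real ((x - v j + card (fibre j) - 1) choose (x - v j))" for j x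
  show "eventually_poly p (\<lambda>r. \<Prod>j<p. g j (r j))"
  proof (rule eventually_poly_prod_univariate)
    fix j
    obtain q :: "real poly" and N where q: "\<And>x. N \<le> x \<Longrightarrow> real ((x + card (fibre j) - 1) choose x) = poly q (real x)"
      using stars_and_bars_poly by blast
    have "g j x = poly (q \<circ>\<^sub>p [:- real (v j), 1:]) (real x)" if "N + v j \<le> x" for x
      using that q[of "x - v j"] by (simp add: g_def poly_pcompose of_nat_diff)
    then show "\<exists>q N. \<forall>x\<ge>N. g j x = poly q (real x)"
      by blast
  qed
  define N where "N = Max (insert 0 (v ` {..<p}))"
  have N: "v j \<le> N" if "j < p" for j
    unfolding N_def using that by (intro Max_ge) auto
  fix r assume r: "\<forall>j<p. N \<le> r j"
  then have vr: "v j \<le> r j" if "j < p" for j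
    using N that order_trans by blast
  have "bij_betw (\<lambda>f t. f t + s t) (level (\<lambda>j. r j - v j)) {f\<in>level r. s \<le> f}"
  proof (rule bij_betw_byWitness[of _ "\<lambda>f t. f t - s t"])
    show "(\<lambda>f t. f t + s t) ` level (\<lambda>j. r j - v j) \<subseteq> {f\<in>level r. s \<le> f}"
    proof clarify
      fix f assume f: "f \<in> level (\<lambda>j. r j - v j)"
      have "(\<Sum>t\<in>fibre j. f t + s t) = r j" if "j < p" for j
        using f that vr[OF that] by (simp add: level_def sum.distrib v_def[symmetric])
      then show "(\<lambda>t. f t + s t) \<in> level r \<and> s \<le> (\<lambda>t. f t + s t)"
        using f s by (simp add: level_def supported_def le_fun_def)
    qed
    show "(\<lambda>f t. f t - s t) ` {f\<in>level r. s \<le> f} \<subseteq> level (\<lambda>j. r j - v j)"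
    proof clarify
      fix f assume f: "f \<in> level r" "s \<le> f"
      have "(\<Sum>t\<in>fibre j. f t - s t) = r j - v j" if "j < p" for j
        using f that by (subst sum_subtractf_nat) (auto simp: level_def v_def le_fun_def)
      then show "(\<lambda>t. f t - s t) \<in> level (\<lambda>j. r j - v j)"
        using f by (simp add: level_def supported_def)
    qed
  qed (auto simp: le_fun_def fun_eq_iff)
  then have "card {f\<in>level r. s \<le> f} = (\<Prod>j<p. (r j - v j + card (fibre j) - 1) choose (r j - v j))"
    unfolding card_level[symmetric] by (rule bij_betw_same_card[symmetric])
  then show "(\<Prod>j<p. g j (r j)) = real (card {f\<in>level r. s \<le> f})"
    by (simp add: g_def)
qed

text \<open>Inclusion and exclusion, one generator \<open>s\<close> at a time: a function lies above
  both \<open>s\<close> and some element of \<open>S1\<close> iff it lies above some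
  \<open>sup s s'\<close>. This up-set has fewer generators than \<open>S\<close>, hence the
  induction on \<open>card S\<close>.\<close>

lemma eventually_poly_level_upset:
  assumes "finite S" "S \<subseteq> supported"
  shows "eventually_poly p (\<lambda>r. real (card {f\<in>level r. \<exists>s\<in>S. s \<le> f}))"
  using assms
proof (induction "card S" arbitrary: S rule: less_induct)
  case less
  show ?case
  proof (cases "S = {}")
    case True
    then show ?thesis by (simp add: eventually_poly_zero)
  next
    case False
    then obtain s S1 where S: "S = insert s S1" "s \<notin> S1"
      by (metis ex_in_conv mk_disjoint_insert)
    have S1: "finite S1" "card S1 < card S"
      using less.prems S by (auto simp: card_insert_if)
    let ?A = "\<lambda>r. {f\<in>level r. \<exists>s\<in>S1. s \<le> f}" and ?B = "\<lambda>r. {f\<in>level r. s \<le> f}"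
      and ?C = "\<lambda>r. {f\<in>level r. \<exists>s'\<in>sup s ` S1. s' \<le> f}"
    have A: "eventually_poly p (\<lambda>r. real (card (?A r)))"
      using less.hyps[OF S1(2) S1(1)] less.prems S by simp
    have C: "eventually_poly p (\<lambda>r. real (card (?C r)))"
    proof (rule less.hyps)
      show "card (sup s ` S1) < card S"
        using S1 card_image_le[of S1 "sup s"] by simp
      show "sup s ` S1 \<subseteq> supported"
      proof (rule image_subsetI)
        fix s' assume "s' \<in> S1"
        then have "s \<in> supported" "s' \<in> supported"
          using less.prems(2) unfolding S(1) by blast+
        then show "sup s s' \<in> supported"
          unfolding supported_def by simp
      qed
    qed (use S1 in simp)
    have B: "eventually_poly p (\<lambda>r. real (card (?B r)))"
      using less.prems(2) S(1) by (intro eventually_poly_level_above) simp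
    have eq: "real (card (?A r)) + real (card (?B r)) - real (card (?C r)) = real (card {f\<in>level r. \<exists>s\<in>S. s \<le> f})" for r
    proof -
      have "(\<exists>s'\<in>sup s ` S1. s' \<le> f) \<longleftrightarrow> s \<le> f \<and> (\<exists>s'\<in>S1. s' \<le> f)" for f
        unfolding bex_simps(7) le_sup_iff by blast
      then have eqs: "?A r \<inter> ?B r = ?C r" "?A r \<union> ?B r = {f\<in>level r. \<exists>s\<in>S. s \<le> f}"
        unfolding S(1) by blast+
      have "card (?A r) + card (?B r) = card (?A r \<union> ?B r) + card (?A r \<inter> ?B r)"
        by (rule card_Un_Int) (rule finite_subset[OF _ finite_level[of r]], blast)+
      then have "card (?A r) + card (?B r) = card {f\<in>level r. \<exists>s\<in>S. s \<le> f} + card (?C r)"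
        unfolding eqs .
      then show ?thesis by linarith
    qed
    show ?thesis
      using eventually_poly_diff[OF eventually_poly_add[OF A B] C] unfolding eq .
  qed
qed

text \<open>Khovanskii's theorem. Each value is counted through its smallest representation for a
  monomial order, here the order of integer polynomials; the non-minimal representations form an
  up-set.\<close>

theorem eventually_poly_card_values:
  fixes V :: "('a \<Rightarrow> nat) \<Rightarrow> 'm::plus"
  assumes V: "\<And>f g. V (\<lambda>t. f t + g t) = V f + V g"
  shows "eventually_poly p (\<lambda>r. real (card (V ` level r)))"
proof -
  obtain e :: "'a \<Rightarrow> nat" where e: "inj_on e T"
    using fin finite_imp_inj_to_nat_seg by blast
  \<comment> \<open>Integer polynomials are totally ordered compatibly with addition. As
    \<open>e\<close> gives distinct exponents to the elements of \<open>T\<close>,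
    \<open>\<Phi>\<close> is additive and injective on \<open>supported\<close>, so this order pulls
    back to the multisets.\<close>
  define \<Phi> where "\<Phi> f = (\<Sum>t\<in>T. Polynomial.monom (int (f t)) (e t))" for f :: "'a \<Rightarrow> nat"
  have coeff: "Polynomial.coeff (\<Phi> f) (e t) = int (f t)" if "t \<in> T" for f t
  proof -
    have "Polynomial.coeff (\<Phi> f) (e t) = (\<Sum>u\<in>T. if u = t then int (f u) else 0)"
      unfolding \<Phi>_def coeff_sum coeff_monom using e that
      by (intro sum.cong refl if_cong) (auto dest: inj_onD)
    then show ?thesis
      using fin that by simp
  qed
  have inj: "f = g" if "f \<in> supported" "g \<in> supported" "\<Phi> f = \<Phi> g" for f g
  proof
    fix t show "f t = g t"
    proof (cases "t \<in> T")
      case True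
      then show ?thesis using coeff[OF True] that(3) by (metis of_nat_eq_iff)
    next
      case False
      then show ?thesis using that by (simp add: supported_def)
    qed
  qed
  have add: "\<Phi> (\<lambda>t. f t + g t) = \<Phi> f + \<Phi> g" for f g
    unfolding \<Phi>_def of_nat_add add_monom[symmetric] sum.distrib ..
  define same where "same f g \<longleftrightarrow> (\<forall>j<p. sum g (fibre j) = sum f (fibre j)) \<and> V g = V f" for f g
  define U where "U = {f\<in>supported. \<exists>g\<in>supported. same f g \<and> \<Phi> g < \<Phi> f}"
  have "U \<subseteq> {f. \<forall>t. t \<notin> T \<longrightarrow> f t = 0}"
    unfolding U_def supported_def by blast
  from dickson_fun[OF fin this] obtain S where S: "finite S" "S \<subseteq> U" "\<forall>s\<in>U. \<exists>s0\<in>S. s0 \<le> s"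
    by blast
  \<comment> \<open>If \<open>g\<close> represents the same value as \<open>s\<close> and is
    smaller, adding \<open>f - s\<close> to both exhibits a smaller representation of the value of
    \<open>f\<close>.\<close>
  have up: "f \<in> U" if f: "f \<in> supported" and s: "s \<in> U" "s \<le> f" for f s
  proof -
    obtain g where g: "g \<in> supported" "same s g" "\<Phi> g < \<Phi> s"
      using s(1) unfolding U_def by blast
    define h where "h t = f t - s t" for t
    have fh: "f = (\<lambda>t. s t + h t)"
      using s(2) by (auto simp: h_def le_fun_def fun_eq_iff)
    have hs: "h \<in> supported"
      using f by (simp add: h_def supported_def)
    have "(\<lambda>t. g t + h t) \<in> supported"
      using g(1) hs by (simp add: supported_def)
    moreover have "same f (\<lambda>t. g t + h t)"
      using g(2) unfolding same_def fh by (simp add: sum.distrib V)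
    moreover have "\<Phi> (\<lambda>t. g t + h t) < \<Phi> f"
      unfolding fh add using g(3) by simp
    ultimately show ?thesis
      using f unfolding U_def by blast
  qed
  \<comment> \<open>The zero function as sole generator presents \<open>level r\<close> itself as an
    up-set, so one lemma covers both counts.\<close>
  have card: "real (card (V ` level r)) = real (card {f\<in>level r. \<exists>s\<in>{\<lambda>_. 0}. s \<le> f}) - real (card {f\<in>level r. \<exists>s\<in>S. s \<le> f})" for r
  proof -
    have US: "{f\<in>level r. \<exists>s\<in>S. s \<le> f} = level r \<inter> U"
      using S(2,3) up by (auto simp: level_def)
    have "inj_on V (level r - U)"
    proof (rule inj_onI)
      fix f g assume fg: "f \<in> level r - U" "g \<in> level r - U" "V f = V g"
      then have "same f g" "same g f" "f \<in> supported" "g \<in> supported"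
        by (auto simp: same_def level_def)
      then have "\<not> \<Phi> g < \<Phi> f" "\<not> \<Phi> f < \<Phi> g"
        using fg unfolding U_def by blast+
      then show "f = g"
        using inj \<open>f \<in> supported\<close> \<open>g \<in> supported\<close> by (meson antisym_conv3)
    qed
    moreover have "V ` level r = V ` (level r - U)"
    proof (intro equalityI subsetI)
      fix x assume "x \<in> V ` level r"
      then have ne: "{f\<in>level r. V f = x} \<noteq> {}" by blast
      have fin': "finite {f\<in>level r. V f = x}"
        using finite_level by simp
      obtain f where f: "f \<in> level r" "V f = x" "\<And>g. g \<in> level r \<Longrightarrow> V g = x \<Longrightarrow> \<Phi> f \<le> \<Phi> g"
        using arg_min_if_finite[OF fin' ne, of \<Phi>] by (auto simp: not_less)
      have "f \<notin> U"
      proof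
        assume "f \<in> U"
        then obtain g where g: "g \<in> supported" "same f g" "\<Phi> g < \<Phi> f"
          unfolding U_def by blast
        then have "g \<in> level r" "V g = x"
          using f(1,2) by (auto simp: level_def same_def)
        then show False
          using f(3) g(3) by fastforce
      qed
      then show "x \<in> V ` (level r - U)"
        using f by blast
    qed blast
    ultimately have "card (V ` level r) = card (level r - U)"
      by (simp add: card_image)
    also have "\<dots> = card (level r) - card (level r \<inter> U)"
      using finite_level by (simp add: card_Diff_subset_Int)
    finally have "real (card (V ` level r)) = real (card (level r)) - real (card (level r \<inter> U))"
      using card_mono[OF finite_level, of "level r \<inter> U" r] by (simp add: of_nat_diff)
    moreover have "{f\<in>level r. \<exists>s\<in>{\<lambda>_. 0}. s \<le> f} = level r"
      by (auto simp: le_fun_def)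
    ultimately show ?thesis
      unfolding US by simp
  qed
  show ?thesis
    unfolding card using S by (intro eventually_poly_diff eventually_poly_level_upset) (auto simp: supported_def U_def)
qed

end

section \<open>Monomial ideals of germs\<close>

definition total_degree :: "nat ^ 'n \<Rightarrow> nat" where
  "total_degree k = (\<Sum>j\<in>UNIV. k $ j)"

lemma total_degree_add: "total_degree (k + l) = total_degree k + total_degree l"
  by (simp add: total_degree_def sum.distrib)

lemma total_degree_ge: "k $ j \<le> total_degree k"
  unfolding total_degree_def by (intro member_le_sum) auto

lemma finite_total_degree_le: "finite {k :: nat ^ 'n::finite. total_degree k \<le> d}"
proof (rule finite_subset[OF _ finite_imageI[OF finite_add_fibre[of "\<chi> j. d"], of fst]])
  show "{k :: nat ^ 'n. total_degree k \<le> d} \<subseteq> fst ` {p. fst p + snd p = (\<chi> j. d)}"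
  proof
    fix k :: "nat ^ 'n" assume "k \<in> {k. total_degree k \<le> d}"
    then have "k $ j \<le> d" for j
      using total_degree_ge[of k j] by simp
    then show "k \<in> fst ` {p. fst p + snd p = (\<chi> j. d)}"
      by (intro image_eqI[of _ _ "(k, (\<chi> j. d) - k)"]) (auto simp: vec_eq_iff)
  qed
qed

section \<open>Uniqueness of power series expansions\<close>

lemma monom_fun_scale: "monom_fun k (t *s x) = t ^ total_degree k * monom_fun k x"
  by (simp add: monom_fun_def total_degree_def power_mult_distrib prod.distrib power_sum)

lemma homogeneous_poly_vanish:
  fixes e :: "nat ^ 'n::finite \<Rightarrow> complex"
  assumes "0 < \<delta>" and zero: "\<And>x. norm x < \<delta> \<Longrightarrow> (\<Sum>k | total_degree k = d. e k * monom_fun k x) = 0"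
    and "total_degree k = d"
  shows "e k = 0"
proof -
  have fin: "finite {k :: nat ^ 'n. total_degree k = d}"
    by (rule finite_subset[OF _ finite_total_degree_le[of d]]) auto
  \<comment> \<open>The norm is at most the sum of the moduli of the coordinates, so the polydisc of
    radius \<open>\<epsilon>\<close> lies in the ball of radius \<open>\<delta>\<close>.\<close>
  define \<epsilon> where "\<epsilon> = \<delta> / real CARD('n)"
  have "0 < \<epsilon>"
    using assms(1) by (simp add: \<epsilon>_def)
  have inj: "inj_on vec_nth {k :: nat ^ 'n. total_degree k = d}"
    by (auto simp: inj_on_def vec_eq_iff)
  have "(\<lambda>\<kappa>. e (vec_lambda \<kappa>)) (vec_nth k) = 0"
  proof (rule multivariate_poly_vanish[of UNIV "ball 0 \<epsilon>" "vec_nth ` {k :: nat ^ 'n. total_degree k = d}"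
        "\<lambda>\<kappa>. e (vec_lambda \<kappa>)" "vec_nth k"])
    show "infinite (ball 0 \<epsilon> :: complex set)"
      using \<open>0 < \<epsilon>\<close> uncountable_ball uncountable_infinite by blast
    fix \<rho> :: "'n \<Rightarrow> complex" assume \<rho>: "\<forall>j\<in>UNIV. \<rho> j \<in> ball 0 \<epsilon>"
    have "norm (\<chi> j. \<rho> j) \<le> (\<Sum>j\<in>UNIV. norm (\<rho> j))"
      by (simp add: L2_set_le_sum norm_vec_def)
    also have "\<dots> < (\<Sum>j\<in>(UNIV :: 'n set). \<epsilon>)"
      using \<rho> by (intro sum_strict_mono) auto
    also have "\<dots> = \<delta>"
      by (simp add: \<epsilon>_def)
    finally have "(\<Sum>k | total_degree k = d. e k * monom_fun k (\<chi> j. \<rho> j)) = 0"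
      by (rule zero)
    then show "(\<Sum>\<kappa>\<in>vec_nth ` {k :: nat ^ 'n. total_degree k = d}. e (vec_lambda \<kappa>) * (\<Prod>j\<in>UNIV. \<rho> j ^ \<kappa> j)) = 0"
      unfolding sum.reindex[OF inj] by (simp add: monom_fun_def)
  qed (use fin assms(3) in \<open>auto simp: inj_on_def restrict_UNIV\<close>)
  then show ?thesis by simp
qed

text \<open>Along the complex line through \<open>x\<close> the series becomes a power series in
  \<open>t\<close> whose coefficients are the homogeneous components at \<open>x\<close>. It is 0 on
  the unit disc, so every component vanishes on a ball.\<close>

lemma has_expansion_zero_unique:
  fixes e :: "nat ^ 'n::finite \<Rightarrow> complex"
  assumes "has_expansion (\<lambda>x. 0) e"
  shows "e k = 0"
proof -
  obtain \<delta> where \<delta>: "0 < \<delta>" "\<And>x. norm x < \<delta> \<Longrightarrow> ((\<lambda>k. e k * monom_fun k x) has_sum 0) UNIV"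
    using assms unfolding has_expansion_def eventually_nhds_metric by (auto simp: dist_norm)
  have fin: "finite {k :: nat ^ 'n. total_degree k = d}" for d
    by (rule finite_subset[OF _ finite_total_degree_le[of d]]) auto
  have "(\<Sum>k | total_degree k = d. e k * monom_fun k x) = 0" if x: "norm x < \<delta>" for x d
  proof -
    define h where "h d = (\<Sum>k | total_degree k = d. e k * monom_fun k x)" for d
    have sums: "(\<lambda>d. h d * t ^ d) sums 0" if "norm t \<le> 1" for t
    proof -
      have "norm (t *s x) = norm t * norm x"
        unfolding norm_vec_def by (simp add: norm_mult L2_set_right_distrib)
      also have "\<dots> \<le> 1 * norm x"
        using that by (intro mult_right_mono) auto
      finally have "((\<lambda>k. e k * monom_fun k (t *s x)) has_sum 0) UNIV"
        using x by (intro \<delta>(2)) auto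
      also have "((\<lambda>k. e k * monom_fun k (t *s x)) has_sum 0) UNIV \<longleftrightarrow>
          ((\<lambda>q. e (snd q) * monom_fun (snd q) (t *s x)) has_sum 0) (Sigma UNIV (\<lambda>d. {k. total_degree k = d}))"
        by (rule has_sum_reindex_bij_witness[of _ snd "\<lambda>k. (total_degree k, k)"]) auto
      finally have "((\<lambda>d. h d * t ^ d) has_sum 0) UNIV"
      proof (rule has_sum_SigmaD)
        fix d
        have "(\<Sum>k | total_degree k = d. e k * monom_fun k (t *s x)) = h d * t ^ d"
          unfolding h_def sum_distrib_right by (intro sum.cong) (auto simp: monom_fun_scale)
        then show "((\<lambda>k. e (snd (d, k)) * monom_fun (snd (d, k)) (t *s x)) has_sum h d * t ^ d) {k. total_degree k = d}"
          using fin has_sum_finite[OF fin[of d], of "\<lambda>k. e k * monom_fun k (t *s x)"] by simp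
      qed
      then show ?thesis
        by (rule has_sum_imp_sums)
    qed
    have "Abs_fps h = 0"
    proof (rule eval_fps_eqD)
      have "summable h"
        using sums[of 1] by (simp add: sums_iff)
      then have "norm (1::complex) \<le> conv_radius h"
        by (intro conv_radius_geI) (auto simp: )
      then show r: "0 < fps_conv_radius (Abs_fps h)"
        unfolding fps_conv_radius_def by (simp add: order.strict_trans2[of 0 1] one_ereal_def)
      show "0 < fps_conv_radius (0 :: complex fps)"
        by simp
      have "\<forall>\<^sub>F t in nhds (0::complex). norm t < 1"
        by (rule eventually_nhds_metric[THEN iffD2]) (auto intro!: exI[of _ 1] simp: dist_norm)
      then show "\<forall>\<^sub>F t in nhds 0. eval_fps (Abs_fps h) t = eval_fps 0 t"
        by eventually_elim (use sums in \<open>auto simp: eval_fps_def sums_iff\<close>)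
    qed
    then show ?thesis
      using h_def[of d] by (metis fps_nth_Abs_fps fps_zero_nth)
  qed
  then show ?thesis
    using homogeneous_poly_vanish[OF \<delta>(1)] by blast
qed

lemma has_expansion_unique:
  assumes "has_expansion f c" "has_expansion f d"
  shows "c = d"
proof
  fix k
  have "has_expansion (\<lambda>x. f x + - f x) (\<lambda>k. c k + - d k)"
    by (intro has_expansion_add has_expansion_uminus assms)
  then show "c k = d k"
    using has_expansion_zero_unique[of "\<lambda>k. c k + - d k" k] by simp
qed

lemma the_expansion: "has_expansion f c \<Longrightarrow> (THE c. has_expansion f c) = c"
  using has_expansion_unique by blast

section \<open>Taylor coefficients and the ring operations\<close>

lemma taylor_coeff_add: "taylor_coeff (a + b) k = taylor_coeff a k + taylor_coeff b k"
proof (transfer fixing: k)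
  fix f g :: "complex ^ 'a \<Rightarrow> complex"
  assume "analytic_at_0 f \<and> analytic_at_0 f \<and> (\<forall>\<^sub>F x in nhds 0. f x = f x)"
    "analytic_at_0 g \<and> analytic_at_0 g \<and> (\<forall>\<^sub>F x in nhds 0. g x = g x)"
  then obtain c d where "has_expansion f c" "has_expansion g d"
    unfolding analytic_at_0_def by blast
  then show "(THE c. has_expansion (\<lambda>x. f x + g x) c) k = (THE c. has_expansion f c) k + (THE c. has_expansion g c) k"
    by (simp add: the_expansion the_expansion[OF has_expansion_add])
qed

lemma taylor_coeff_mult:
  "taylor_coeff (a * b) m = (\<Sum>p | fst p + snd p = m. taylor_coeff a (fst p) * taylor_coeff b (snd p))"
proof (transfer fixing: m)
  fix f g :: "complex ^ 'a \<Rightarrow> complex"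
  assume "analytic_at_0 f \<and> analytic_at_0 f \<and> (\<forall>\<^sub>F x in nhds 0. f x = f x)"
    "analytic_at_0 g \<and> analytic_at_0 g \<and> (\<forall>\<^sub>F x in nhds 0. g x = g x)"
  then obtain c d where "has_expansion f c" "has_expansion g d"
    unfolding analytic_at_0_def by blast
  then show "(THE c. has_expansion (\<lambda>x. f x * g x) c) m =
      (\<Sum>p | fst p + snd p = m. (THE c. has_expansion f c) (fst p) * (THE c. has_expansion g c) (snd p))"
    by (simp add: the_expansion the_expansion[OF has_expansion_mult])
qed

lemma taylor_coeff_monom: "taylor_coeff (monom_germ k) l = (if l = k then 1 else 0)"
proof (transfer fixing: k l)
  show "(THE c. has_expansion (monom_fun k) c) l = (if l = k then 1 else 0)"
    using has_expansion_monomial[of 1 k] by (simp add: the_expansion)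
qed

lemma taylor_coeff_const: "taylor_coeff (const_germ z) l = (if l = 0 then z else 0)"
proof (transfer fixing: z l)
  show "(THE c. has_expansion (\<lambda>x :: complex ^ 'a. z) c) l = (if l = 0 then z else 0)"
    using has_expansion_monomial[of z "0 :: nat ^ 'a"] by (simp add: the_expansion)
qed

lemma germ_eqI:
  assumes "\<And>k. taylor_coeff a k = taylor_coeff b k"
  shows "a = b"
proof -
  have "taylor_coeff a = taylor_coeff b"
    using assms by blast
  then show ?thesis
  proof transfer
    fix f g :: "complex ^ 'a \<Rightarrow> complex"
    assume fg: "analytic_at_0 f \<and> analytic_at_0 f \<and> (\<forall>\<^sub>F x in nhds 0. f x = f x)"
      "analytic_at_0 g \<and> analytic_at_0 g \<and> (\<forall>\<^sub>F x in nhds 0. g x = g x)"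
      "(THE c. has_expansion f c) = (THE c. has_expansion g c)"
    then obtain c d where cd: "has_expansion f c" "has_expansion g d"
      unfolding analytic_at_0_def by blast
    have "c = d"
      using fg(3) cd by (simp add: the_expansion)
    have "\<forall>\<^sub>F x in nhds 0. f x = g x"
      using cd(1) cd(2)[folded \<open>c = d\<close>] unfolding has_expansion_def
      by (rule eventually_elim2) (rule has_sum_unique)
    then show "analytic_at_0 f \<and> analytic_at_0 g \<and> (\<forall>\<^sub>F x in nhds 0. f x = g x)"
      using fg by blast
  qed
qed

lemma taylor_coeff_zero: "taylor_coeff 0 k = 0"
  using taylor_coeff_add[of 0 0 k] by simp

lemma taylor_coeff_uminus: "taylor_coeff (- a) k = - taylor_coeff a k"
  using taylor_coeff_add[of a "- a" k] by (simp add: taylor_coeff_zero add_eq_0_iff)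

lemma taylor_coeff_sum: "taylor_coeff (sum f A) k = (\<Sum>x\<in>A. taylor_coeff (f x) k)"
  by (induction A rule: infinite_finite_induct) (simp_all add: taylor_coeff_zero taylor_coeff_add)

lemma taylor_coeff_const_mult: "taylor_coeff (const_germ z * a) k = z * taylor_coeff a k"
proof -
  have "taylor_coeff (const_germ z * a) k = (\<Sum>p | fst p + snd p = k. if p = (0, k) then z * taylor_coeff a k else 0)"
    unfolding taylor_coeff_mult taylor_coeff_const by (intro sum.cong) auto
  then show ?thesis
    using finite_add_fibre[of k] by (simp add: sum.delta)
qed

lemma taylor_coeff_mult_monom:
  "taylor_coeff (a * monom_germ s) k = (if s \<le> k then taylor_coeff a (k - s) else 0)"
proof -
  have "taylor_coeff (a * monom_germ s) k =
      (\<Sum>p | fst p + snd p = k. if p = (k - s, s) then taylor_coeff a (k - s) else 0)"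
    unfolding taylor_coeff_mult taylor_coeff_monom
  proof (intro sum.cong refl)
    fix p assume "p \<in> {p. fst p + snd p = k}"
    then have "p = (k - s, s) \<longleftrightarrow> snd p = s" "snd p = s \<Longrightarrow> fst p = k - s"
      by (auto simp: prod_eq_iff)
    then show "taylor_coeff a (fst p) * (if snd p = s then 1 else 0) = (if p = (k - s, s) then taylor_coeff a (k - s) else 0)"
      by simp
  qed
  also have "\<dots> = (if k - s + s = k then taylor_coeff a (k - s) else 0)"
    using finite_add_fibre[of k] by (simp add: sum.delta')
  also have "k - s + s = k \<longleftrightarrow> s \<le> k"
    by (auto simp: vec_eq_iff less_eq_vec_def) (metis le_add2)
  finally show ?thesis .
qed

lemma monom_germ_add: "monom_germ (k + l) = monom_germ k * monom_germ l"
proof (rule germ_eqI)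
  fix m
  have "m = k + l \<longleftrightarrow> l \<le> m \<and> m - l = k"
    by (auto simp: vec_eq_iff less_eq_vec_def) (metis le_add_diff_inverse2)
  then show "taylor_coeff (monom_germ (k + l)) m = taylor_coeff (monom_germ k * monom_germ l) m"
    by (auto simp: taylor_coeff_mult_monom taylor_coeff_monom)
qed

text \<open>The source of germs with prescribed coefficients: a series dominated by a shift of a
  convergent one converges. The comparison takes place at \<open>y\<close>, where the modulus of a
  monomial depends on its total degree only.\<close>

lemma ex_germ_dominated:
  fixes a :: "'n::finite germ"
  assumes "\<And>l. norm (c l) \<le> norm (taylor_coeff a (l + s))"
  shows "\<exists>b. \<forall>l. taylor_coeff b l = c l"
proof -
  have "\<exists>g. analytic_at_0 g \<and> has_expansion g c"
    using assms
  proof (transfer fixing: c s)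
    fix f :: "complex ^ 'n \<Rightarrow> complex"
    assume f: "analytic_at_0 f \<and> analytic_at_0 f \<and> (\<forall>\<^sub>F x in nhds 0. f x = f x)"
      and le: "\<And>l. norm (c l) \<le> norm ((THE c. has_expansion f c) (l + s))"
    then obtain d where d: "has_expansion f d"
      unfolding analytic_at_0_def by blast
    have cd: "norm (c l) \<le> norm (d (l + s))" for l
      using le[of l] d by (simp add: the_expansion)
    obtain \<delta> where \<delta>: "0 < \<delta>" "\<And>x. norm x < \<delta> \<Longrightarrow> ((\<lambda>k. d k * monom_fun k x) has_sum f x) UNIV"
      using d unfolding has_expansion_def eventually_nhds_metric by (auto simp: dist_norm)
    \<comment> \<open>The factor 2 keeps \<open>y\<close> strictly inside the ball: its norm is at
      most \<open>\<delta> / 2\<close>.\<close>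
    define \<rho> where "\<rho> = \<delta> / (2 * real CARD('n))"
    have \<rho>: "0 < \<rho>"
      using \<delta>(1) by (simp add: \<rho>_def)
    define y :: "complex ^ 'n" where "y = (\<chi> j. of_real \<rho>)"
    have "norm y \<le> (\<Sum>j\<in>(UNIV :: 'n set). norm (y $ j))"
      by (simp add: L2_set_le_sum norm_vec_def)
    also have "\<dots> = real CARD('n) * \<rho>"
      using \<rho> by (simp add: y_def)
    also have "\<dots> < \<delta>"
      using \<delta>(1) by (simp add: \<rho>_def)
    finally have "(\<lambda>k. d k * monom_fun k y) summable_on UNIV"
      using \<delta>(2) summable_on_def by blast
    then have "(\<lambda>k. norm (d k * monom_fun k y)) summable_on UNIV"
      by (rule summable_on_iff_abs_summable_on_complex[THEN iffD1])
    then have "(\<lambda>k. norm (d k * monom_fun k y)) summable_on (range (\<lambda>l. l + s))"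
      by (rule summable_on_subset_banach) simp
    then have "((\<lambda>k. norm (d k * monom_fun k y)) \<circ> (\<lambda>l. l + s)) summable_on UNIV"
      by (subst summable_on_reindex[symmetric]) (auto simp: inj_on_def)
    moreover have "norm (monom_fun k y) = \<rho> ^ total_degree k" for k
      using \<rho> by (simp add: monom_fun_def y_def prod_norm[symmetric] norm_power total_degree_def power_sum)
    ultimately have sum1: "(\<lambda>l. norm (d (l + s)) * \<rho> ^ total_degree (l + s)) summable_on UNIV"
      by (simp add: norm_mult o_def)
    have sum: "(\<lambda>l. c l * monom_fun l x) summable_on UNIV" if x: "norm x < \<rho>" for x
    proof -
      have le: "norm (c l * monom_fun l x) \<le> norm (d (l + s)) * \<rho> ^ total_degree (l + s) * inverse (\<rho> ^ total_degree s)" for l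
      proof -
        have "norm (monom_fun l x) \<le> (\<Prod>j\<in>UNIV. \<rho> ^ (l $ j))"
          unfolding monom_fun_def prod_norm[symmetric] norm_power
          using x Finite_Cartesian_Product.norm_nth_le[of x] by (intro prod_mono) (auto intro!: power_mono order_trans[OF _ less_imp_le[OF x]])
        then have "norm (monom_fun l x) \<le> \<rho> ^ total_degree l"
          by (simp add: total_degree_def power_sum)
        then have "norm (c l * monom_fun l x) \<le> norm (d (l + s)) * \<rho> ^ total_degree l"
          unfolding norm_mult using cd \<rho> by (intro mult_mono) auto
        also have "\<dots> = norm (d (l + s)) * \<rho> ^ total_degree (l + s) * inverse (\<rho> ^ total_degree s)"
          using \<rho> by (simp add: total_degree_add power_add)
        finally show ?thesis .
      qed
      have "(\<lambda>l. norm (d (l + s)) * \<rho> ^ total_degree (l + s) * inverse (\<rho> ^ total_degree s)) summable_on UNIV"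
        using sum1 by (rule summable_on_cmult_left)
      then have "(\<lambda>l. norm (c l * monom_fun l x)) summable_on UNIV"
        by (rule summable_on_comparison_test) (auto intro: le)
      then show ?thesis
        by (rule abs_summable_summable)
    qed
    have "has_expansion (\<lambda>x. \<Sum>\<^sub>\<infinity>l. c l * monom_fun l x) c"
      unfolding has_expansion_def eventually_nhds_metric
      using \<rho> sum by (intro exI[of _ \<rho>]) (auto simp: dist_norm)
    then show "\<exists>g. analytic_at_0 g \<and> has_expansion g c"
      unfolding analytic_at_0_def by blast
  qed
  then obtain g where g: "analytic_at_0 g" "has_expansion g c"
    by blast
  have "taylor_coeff (abs_germ g) = (THE c. has_expansion g c)"
    using g(1) by (intro taylor_coeff.abs_eq) (simp add: eq_onp_def)
  then show ?thesis
    using the_expansion[OF g(2)] by (intro exI[of _ "abs_germ g"]) simp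
qed


section \<open>Up-sets of exponents and the ideals they define\<close>

definition upward :: "(nat ^ 'n) set \<Rightarrow> (nat ^ 'n) set" where
  "upward S = {k. \<exists>s\<in>S. s \<le> k}"

lemma upward_mono: "A \<subseteq> B \<Longrightarrow> upward A \<subseteq> upward B"
  unfolding upward_def by blast

lemma subset_upward: "S \<subseteq> upward S"
  unfolding upward_def by auto

lemma upward_upward: "upward (upward S) = upward S"
  unfolding upward_def by (auto intro: order_trans)

lemma upward_UNIV: "upward UNIV = UNIV"
  using subset_upward by blast

lemma nat_vec_le_iff_add: "(k :: nat ^ 'n) \<le> l \<longleftrightarrow> (\<exists>m. l = k + m)"
proof
  assume "k \<le> l"
  then have "l = k + (l - k)"
    by (auto simp: vec_eq_iff less_eq_vec_def)
  then show "\<exists>m. l = k + m" ..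
qed (auto simp: less_eq_vec_def)

lemma dickson_vec:
  fixes S :: "(nat ^ 'n::finite) set"
  shows "\<exists>S0. finite S0 \<and> S0 \<subseteq> S \<and> upward S0 = upward S"
proof -
  have "\<exists>B. finite B \<and> B \<subseteq> vec_nth ` S \<and> (\<forall>s\<in>vec_nth ` S. \<exists>s0\<in>B. s0 \<le> s)"
    by (rule dickson_fun[of UNIV]) auto
  then obtain B where B: "finite B" "B \<subseteq> vec_nth ` S" "\<forall>s\<in>vec_nth ` S. \<exists>s0\<in>B. s0 \<le> s"
    by blast
  then obtain S0 where S0: "finite S0" "S0 \<subseteq> S" "B = vec_nth ` S0"
    by (meson finite_subset_image)
  have "\<exists>s0\<in>S0. s0 \<le> s" if "s \<in> S" for s
    using B(3) that unfolding S0(3) by (auto simp: less_eq_vec_def le_fun_def)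
  then have "S \<subseteq> upward S0"
    unfolding upward_def by blast
  then have "upward S \<subseteq> upward S0"
    using upward_mono upward_upward by metis
  then show ?thesis
    using S0 upward_mono[OF S0(2)] by blast
qed

lemma germ_ring_simps:
  "carrier \<O> = UNIV" "mult \<O> = (*)" "one \<O> = 1" "zero \<O> = 0" "add \<O> = (+)"
  by (auto simp: ring_of_type_algebra_def)

lemma cring_germ: "cring (\<O> :: 'n::finite germ ring)"
  by (rule cring_from_type_algebra)

lemma ring_germ: "ring (\<O> :: 'n::finite germ ring)"
  by (rule ring_from_type_algebra)

text \<open>For upward closed \<open>A\<close> this is the monomial ideal with exponent set
  \<open>A\<close>. Products and sums of such ideals become Minkowski sums and unions of
  up-sets.\<close>

definition germs_in :: "(nat ^ 'n) set \<Rightarrow> 'n::finite germ set" where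
  "germs_in A = {a. \<forall>k. taylor_coeff a k \<noteq> 0 \<longrightarrow> k \<in> A}"

lemma germs_in_zero: "0 \<in> germs_in A"
  by (simp add: germs_in_def taylor_coeff_zero)

lemma germs_in_add: "a \<in> germs_in A \<Longrightarrow> b \<in> germs_in A \<Longrightarrow> a + b \<in> germs_in A"
  by (auto simp: germs_in_def taylor_coeff_add) (metis add.right_neutral)

lemma germs_in_mult:
  assumes "a \<in> germs_in A" "b \<in> germs_in B" "\<And>k l. k \<in> A \<Longrightarrow> l \<in> B \<Longrightarrow> k + l \<in> C"
  shows "a * b \<in> germs_in C"
  unfolding germs_in_def
proof clarify
  fix m assume "taylor_coeff (a * b) m \<noteq> 0"
  then obtain p where p: "fst p + snd p = m" "taylor_coeff a (fst p) * taylor_coeff b (snd p) \<noteq> 0"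
    unfolding taylor_coeff_mult by (auto elim: sum.not_neutral_contains_not_neutral)
  then have "fst p \<in> A" "snd p \<in> B"
    using assms(1,2) by (auto simp: germs_in_def)
  then show "m \<in> C"
    using assms(3) p(1) by blast
qed

lemma monom_in_germs_in: "monom_germ k \<in> germs_in A \<longleftrightarrow> k \<in> A"
  by (simp add: germs_in_def taylor_coeff_monom)

lemma ideal_germs_in:
  fixes A :: "(nat ^ 'n::finite) set"
  assumes "upward A = A"
  shows "ideal (germs_in A) \<O>"
proof (rule idealI[OF ring_germ])
  interpret cring "\<O> :: 'n germ ring"
    by (rule cring_germ)
  have mult: "a * b \<in> germs_in A" if "a \<in> germs_in A" for a b
  proof (rule germs_in_mult[OF that, of b UNIV])
    show "b \<in> germs_in UNIV" by (simp add: germs_in_def)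
    show "k + l \<in> A" if "k \<in> A" for k l
      using that assms unfolding upward_def nat_vec_le_iff_add by blast
  qed
  show "subgroup (germs_in A) (add_monoid \<O>)"
  proof (rule add.subgroupI)
    fix a :: "'n germ" assume a: "a \<in> germs_in A"
    have "\<ominus>\<^bsub>\<O>\<^esub> a = - a"
      by (rule minus_equality) (simp_all add: germ_ring_simps)
    then show "\<ominus>\<^bsub>\<O>\<^esub> a \<in> germs_in A"
      using a by (simp add: germs_in_def taylor_coeff_uminus)
  next
    show "germs_in A \<noteq> {}"
      using germs_in_zero by blast
  qed (use germs_in_add in \<open>auto simp: germ_ring_simps\<close>)
  fix a x :: "'n germ" assume "a \<in> germs_in A"
  then show "x \<otimes>\<^bsub>\<O>\<^esub> a \<in> germs_in A" "a \<otimes>\<^bsub>\<O>\<^esub> x \<in> germs_in A"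
    using mult by (auto simp: germ_ring_simps mult.commute[of x])
qed

text \<open>The choice \<open>\<sigma>\<close> assigns each exponent to one generator below it.
  Collecting the terms assigned to \<open>s\<close> and dividing by its monomial gives
  \<open>b s\<close>, which converges by \<open>ex_germ_dominated\<close>.\<close>

lemma germ_decomposition:
  fixes a :: "'n::finite germ"
  assumes S: "finite S" and a: "a \<in> germs_in (upward S)"
  shows "\<exists>b. a = (\<Sum>s\<in>S. b s * monom_germ s)"
proof -
  obtain \<sigma> where \<sigma>: "\<And>k. k \<in> upward S \<Longrightarrow> \<sigma> k \<in> S \<and> \<sigma> k \<le> k"
    unfolding upward_def by (atomize_elim, intro choice) blast
  have "\<exists>b. \<forall>l. taylor_coeff b l = (if \<sigma> (l + s) = s then taylor_coeff a (l + s) else 0)" for s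
    by (rule ex_germ_dominated[of _ a s]) auto
  then obtain b where b: "\<And>s l. taylor_coeff (b s) l = (if \<sigma> (l + s) = s then taylor_coeff a (l + s) else 0)"
    by metis
  have "a = (\<Sum>s\<in>S. b s * monom_germ s)"
  proof (rule germ_eqI)
    fix k
    have "taylor_coeff (\<Sum>s\<in>S. b s * monom_germ s) k =
        (\<Sum>s\<in>S. if s \<le> k then if \<sigma> k = s then taylor_coeff a k else 0 else 0)"
      unfolding taylor_coeff_sum
    proof (intro sum.cong refl)
      fix s
      have "k - s + s = k" if "s \<le> k"
        using that by (auto simp: vec_eq_iff less_eq_vec_def)
      then show "taylor_coeff (b s * monom_germ s) k = (if s \<le> k then if \<sigma> k = s then taylor_coeff a k else 0 else 0)"
        by (simp add: taylor_coeff_mult_monom b)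
    qed
    also have "\<dots> = (\<Sum>s\<in>S. if s = \<sigma> k then if \<sigma> k \<le> k then taylor_coeff a k else 0 else 0)"
      by (intro sum.cong) auto
    also have "\<dots> = (if \<sigma> k \<in> S \<and> \<sigma> k \<le> k then taylor_coeff a k else 0)"
      using S by (simp add: sum.delta')
    also have "\<dots> = taylor_coeff a k"
      using a \<sigma>[of k] by (auto simp: germs_in_def)
    finally show "taylor_coeff a k = taylor_coeff (\<Sum>s\<in>S. b s * monom_germ s) k" by simp
  qed
  then show ?thesis by (intro exI[of _ b])
qed

text \<open>Dickson's lemma replaces \<open>S\<close> by a finite set, since an ideal is closed
  under finite sums only.\<close>

lemma germs_in_upward_subset:
  fixes I :: "'n::finite germ set"
  assumes I: "ideal I \<O>" and S: "monom_germ ` S \<subseteq> I"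
  shows "germs_in (upward S) \<subseteq> I"
proof
  fix a :: "'n germ" assume a: "a \<in> germs_in (upward S)"
  interpret ideal I "\<O> :: 'n germ ring" by (rule I)
  obtain S0 where S0: "finite S0" "S0 \<subseteq> S" "upward S0 = upward S"
    using dickson_vec by blast
  obtain b where b: "a = (\<Sum>s\<in>S0. b s * monom_germ s)"
    using germ_decomposition[OF S0(1)] a S0(3) by metis
  have "(\<Sum>s\<in>B. b s * monom_germ s) \<in> I" if "finite B" "B \<subseteq> S" for B
    using that
  proof (induction B rule: finite_induct)
    case empty
    then show ?case
      using additive_subgroup.zero_closed[OF ideal.axioms(1)[OF I]] by (simp add: germ_ring_simps)
  next
    case (insert s B)
    have "b s * monom_germ s \<in> I"
      using I_l_closed[of "monom_germ s" "b s"] S insert.prems by (auto simp: germ_ring_simps)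
    then show ?case
      using additive_subgroup.a_closed[OF ideal.axioms(1)[OF I]] insert by (simp add: germ_ring_simps)
  qed
  then show "a \<in> I"
    using b S0 by blast
qed

lemma genideal_monomials: "Idl\<^bsub>\<O>\<^esub> (monom_germ ` S) = germs_in (upward S)"
proof
  interpret cring "\<O> :: 'a germ ring" by (rule cring_germ)
  show "Idl\<^bsub>\<O>\<^esub> (monom_germ ` S) \<subseteq> germs_in (upward S)"
    using subset_upward[of S] by (intro genideal_minimal ideal_germs_in) (auto simp: upward_upward monom_in_germs_in)
  have sub: "monom_germ ` S \<subseteq> carrier \<O>"
    by (simp add: germ_ring_simps)
  show "germs_in (upward S) \<subseteq> Idl\<^bsub>\<O>\<^esub> (monom_germ ` S)"
    by (rule germs_in_upward_subset[OF genideal_ideal[OF sub] genideal_self[OF sub]])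
qed

lemma ideal_prod_germs_in:
  fixes A B :: "(nat ^ 'n::finite) set"
  assumes A: "upward A = A" and B: "upward B = B"
  shows "germs_in A \<cdot>\<^bsub>\<O>\<^esub> germs_in B = germs_in (A + B)" "upward (A + B) = A + B"
proof -
  interpret cring "\<O> :: 'n germ ring" by (rule cring_germ)
  show up: "upward (A + B) = A + B"
  proof
    show "upward (A + B) \<subseteq> A + B"
    proof
      fix k assume "k \<in> upward (A + B)"
      then obtain a b m where "a \<in> A" "b \<in> B" "k = a + b + m"
        unfolding upward_def nat_vec_le_iff_add set_plus_def by blast
      moreover then have "b + m \<in> B"
        using B unfolding upward_def nat_vec_le_iff_add by blast
      ultimately show "k \<in> A + B"
        by (simp add: add.assoc set_plus_intro)
    qed
  qed (rule subset_upward)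
  show "germs_in A \<cdot>\<^bsub>\<O>\<^esub> germs_in B = germs_in (A + B)"
  proof
    show "germs_in A \<cdot>\<^bsub>\<O>\<^esub> germs_in B \<subseteq> germs_in (A + B)"
    proof
      fix s assume "s \<in> germs_in A \<cdot>\<^bsub>\<O>\<^esub> germs_in B"
      then show "s \<in> germs_in (A + B)"
        by (induction rule: ideal_prod.induct)
          (auto simp: germ_ring_simps germs_in_add intro: germs_in_mult set_plus_intro)
    qed
    have "monom_germ ` (A + B) \<subseteq> germs_in A \<cdot>\<^bsub>\<O>\<^esub> germs_in B"
    proof
      fix x :: "'n germ" assume "x \<in> monom_germ ` (A + B)"
      then obtain a b where "a \<in> A" "b \<in> B" "x = monom_germ a * monom_germ b"
        by (auto simp: set_plus_def monom_germ_add)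
      then show "x \<in> germs_in A \<cdot>\<^bsub>\<O>\<^esub> germs_in B"
        using ideal_prod.prod[of "monom_germ a" "germs_in A" "monom_germ b" "germs_in B" \<O>]
        by (simp add: germ_ring_simps monom_in_germs_in)
    qed
    then show "germs_in (A + B) \<subseteq> germs_in A \<cdot>\<^bsub>\<O>\<^esub> germs_in B"
      using germs_in_upward_subset[OF ideal_prod_is_ideal[OF ideal_germs_in[OF A] ideal_germs_in[OF B]]] up by metis
  qed
qed

lemma set_add_germs_in:
  fixes A B :: "(nat ^ 'n::finite) set"
  assumes A: "upward A = A" and B: "upward B = B"
  shows "germs_in A <+>\<^bsub>\<O>\<^esub> germs_in B = germs_in (A \<union> B)"
proof
  interpret cring "\<O> :: 'n germ ring" by (rule cring_germ)
  have mono: "germs_in A \<subseteq> germs_in (A \<union> B)" "germs_in B \<subseteq> germs_in (A \<union> B)"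
    by (auto simp: germs_in_def)
  show "germs_in A <+>\<^bsub>\<O>\<^esub> germs_in B \<subseteq> germs_in (A \<union> B)"
    unfolding set_add_def' using mono by (auto simp: germ_ring_simps intro!: germs_in_add)
  have "monom_germ ` (A \<union> B) \<subseteq> germs_in A <+>\<^bsub>\<O>\<^esub> germs_in B"
  proof
    fix x :: "'n germ" assume "x \<in> monom_germ ` (A \<union> B)"
    then have "(x \<in> germs_in A \<and> x = x + 0) \<or> (x \<in> germs_in B \<and> x = 0 + x)"
      by (auto simp: monom_in_germs_in)
    then show "x \<in> germs_in A <+>\<^bsub>\<O>\<^esub> germs_in B"
      unfolding set_add_def' germ_ring_simps using germs_in_zero by blast
  qed
  moreover have "upward (A \<union> B) = A \<union> B"
    using A B unfolding upward_def by blast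
  ultimately show "germs_in (A \<union> B) \<subseteq> germs_in A <+>\<^bsub>\<O>\<^esub> germs_in B"
    using germs_in_upward_subset[OF add_ideals[OF ideal_germs_in[OF A] ideal_germs_in[OF B]]] by metis
qed

text \<open>The empty product is the unit ideal, whose exponent set is \<open>UNIV\<close> rather
  than \<open>{0}\<close>; so all powers of up-sets are up-sets.\<close>

primrec set_power :: "(nat ^ 'n::finite) set \<Rightarrow> nat \<Rightarrow> (nat ^ 'n) set" where
  "set_power A 0 = UNIV"
| "set_power A (Suc r) = set_power A r + A"

lemma ideal_pow_germs_in:
  fixes A :: "(nat ^ 'n::finite) set"
  assumes A: "upward A = A"
  shows "ideal_pow (germs_in A) r = germs_in (set_power A r)" "upward (set_power A r) = set_power A r"
proof (induction r)
  case 0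
  show "ideal_pow (germs_in A) 0 = germs_in (set_power A 0)"
    by (simp add: ideals_set_def germs_in_def germ_ring_simps)
  show "upward (set_power A 0) = set_power A 0"
    by (simp add: upward_UNIV)
next
  case (Suc r)
  interpret cring "\<O> :: 'n germ ring" by (rule cring_germ)
  show "ideal_pow (germs_in A) (Suc r) = germs_in (set_power A (Suc r))"
    using Suc ideal_prod_germs_in(1)[OF Suc(2) A] by (simp add: ideals_set_def)
  show "upward (set_power A (Suc r)) = set_power A (Suc r)"
    using ideal_prod_germs_in(2)[OF Suc(2) A] by simp
qed

primrec set_power_prod :: "(nat \<Rightarrow> (nat ^ 'n::finite) set) \<Rightarrow> (nat \<Rightarrow> nat) \<Rightarrow> nat \<Rightarrow> (nat ^ 'n) set" where
  "set_power_prod A r 0 = UNIV"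
| "set_power_prod A r (Suc p) = set_power_prod A r p + set_power (A p) (r p)"

lemma finprod_germs_in:
  fixes A :: "nat \<Rightarrow> (nat ^ 'n::finite) set"
  assumes A: "\<And>j. upward (A j) = A j"
  shows "(\<Otimes>\<^bsub>ideals_set \<O>\<^esub>j\<in>{..<p}. ideal_pow (germs_in (A j)) (r j)) = germs_in (set_power_prod A r p)"
    "upward (set_power_prod A r p) = set_power_prod A r p"
proof (induction p)
  case 0
  interpret cring "\<O> :: 'n germ ring" by (rule cring_germ)
  interpret IS: comm_monoid "ideals_set (\<O> :: 'n germ ring)"
    by (rule ideals_set_is_comm_monoid)
  show "(\<Otimes>\<^bsub>ideals_set \<O>\<^esub>j\<in>{..<0}. ideal_pow (germs_in (A j)) (r j)) = germs_in (set_power_prod A r 0)"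
    unfolding lessThan_0 IS.finprod_empty by (simp add: ideals_set_def germs_in_def germ_ring_simps)
  show "upward (set_power_prod A r 0) = set_power_prod A r 0"
    by (simp add: upward_UNIV)
next
  case (Suc p)
  interpret cring "\<O> :: 'n germ ring" by (rule cring_germ)
  interpret IS: comm_monoid "ideals_set (\<O> :: 'n germ ring)"
    by (rule ideals_set_is_comm_monoid)
  have carr: "ideal_pow (germs_in (A j)) (r j) \<in> carrier (ideals_set \<O>)" for j
    using ideal_germs_in[OF ideal_pow_germs_in(2)[OF A, of j "r j"]] ideal_pow_germs_in(1)[OF A]
    by (simp add: ideals_set_def)
  note pw = ideal_pow_germs_in[OF A, of p "r p"]
  show "(\<Otimes>\<^bsub>ideals_set \<O>\<^esub>j\<in>{..<Suc p}. ideal_pow (germs_in (A j)) (r j)) = germs_in (set_power_prod A r (Suc p))"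
  proof -
    have "(\<Otimes>\<^bsub>ideals_set \<O>\<^esub>j\<in>{..<Suc p}. ideal_pow (germs_in (A j)) (r j)) =
        ideal_pow (germs_in (A p)) (r p) \<otimes>\<^bsub>ideals_set \<O>\<^esub> (\<Otimes>\<^bsub>ideals_set \<O>\<^esub>j\<in>{..<p}. ideal_pow (germs_in (A j)) (r j))"
      unfolding lessThan_Suc by (rule IS.finprod_insert) (use carr in auto)
    also have "\<dots> = germs_in (set_power (A p) (r p)) \<cdot>\<^bsub>\<O>\<^esub> germs_in (set_power_prod A r p)"
      unfolding Suc(1) pw(1) by (simp add: ideals_set_def)
    also have "\<dots> = germs_in (set_power_prod A r (Suc p))"
      using ideal_prod_germs_in(1)[OF pw(2) Suc(2)] by (simp add: add.commute)
    finally show ?thesis .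
  qed
  show "upward (set_power_prod A r (Suc p)) = set_power_prod A r (Suc p)"
    using ideal_prod_germs_in(2)[OF Suc(2) pw(2)] by simp
qed

section \<open>Colength of a monomial ideal\<close>

lemma const_germ_add: "const_germ (z + w) = const_germ z + const_germ w"
  by (rule germ_eqI) (simp add: taylor_coeff_add taylor_coeff_const)

lemma const_germ_mult: "const_germ (z * w) = const_germ z * const_germ w"
  by (rule germ_eqI) (simp add: taylor_coeff_const_mult taylor_coeff_const)

lemma monom_germ_0: "monom_germ 0 = (1 :: 'n::finite germ)"
proof transfer
  have "monom_fun 0 = (\<lambda>x :: complex ^ 'n. 1)"
    by (rule ext) simp
  then show "analytic_at_0 (monom_fun 0 :: complex ^ 'n \<Rightarrow> complex) \<and> analytic_at_0 (\<lambda>x :: complex ^ 'n. 1) \<and>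
      (\<forall>\<^sub>F x :: complex ^ 'n in nhds 0. monom_fun 0 x = 1)"
    by (simp add: analytic_at_0_const)
qed

lemma const_germ_1: "const_germ 1 = 1"
  unfolding monom_germ_0[symmetric] by (rule germ_eqI) (simp add: taylor_coeff_const taylor_coeff_monom)

lemma germs_in_uminus: "a \<in> germs_in A \<Longrightarrow> - a \<in> germs_in A"
  by (simp add: germs_in_def taylor_coeff_uminus)

lemma taylor_coeff_diff: "taylor_coeff (a - b) k = taylor_coeff a k - taylor_coeff b k"
  using taylor_coeff_add[of a "- b" k] by (simp add: taylor_coeff_uminus)

definition lin_comb :: "complex list \<Rightarrow> (nat ^ 'n) list \<Rightarrow> 'n::finite germ" where
  "lin_comb cs ks = (\<Sum>(c, k)\<leftarrow>zip cs ks. const_germ c * monom_germ k)"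

lemma taylor_coeff_lin_comb:
  "taylor_coeff (lin_comb cs ks) l = (\<Sum>(c, k)\<leftarrow>zip cs ks. if l = k then c else 0)"
proof (induction cs ks rule: list_induct2')
  case (4 c cs k ks)
  then show ?case
    by (simp add: lin_comb_def taylor_coeff_add taylor_coeff_const_mult taylor_coeff_monom)
qed (simp_all add: lin_comb_def taylor_coeff_zero)

lemma taylor_coeff_lin_comb_notin:
  "l \<notin> set ks \<Longrightarrow> taylor_coeff (lin_comb cs ks) l = 0"
  unfolding taylor_coeff_lin_comb by (induction cs ks rule: list_induct2') auto

lemma taylor_coeff_lin_comb_nth:
  "distinct ks \<Longrightarrow> i < length ks \<Longrightarrow> i < length cs \<Longrightarrow> taylor_coeff (lin_comb cs ks) (ks ! i) = cs ! i"
proof (induction cs ks arbitrary: i rule: list_induct2')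
  case (4 c cs k ks)
  have eq: "taylor_coeff (lin_comb (c # cs) (k # ks)) l = (if l = k then c else 0) + taylor_coeff (lin_comb cs ks) l" for l
    by (simp add: taylor_coeff_lin_comb)
  show ?case
    unfolding eq using 4 taylor_coeff_lin_comb_notin[of k ks cs]
    by (cases i) (auto simp: nth_mem)
qed simp_all

text \<open>Properness keeps the quotient nonzero, so that the classes of the constants form a
  field.\<close>

locale monomial_quotient =
  fixes A :: "(nat ^ 'n::finite) set"
  assumes upward: "upward A = A" and proper: "0 \<notin> A"
begin

abbreviation Q where "Q \<equiv> \<O> Quot germs_in A"

abbreviation proj :: "'n germ \<Rightarrow> 'n germ set" where
  "proj a \<equiv> germs_in A +>\<^bsub>\<O>\<^esub> a"

lemma ideal: "ideal (germs_in A) \<O>"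
  by (rule ideal_germs_in[OF upward])

sublocale germ_ring: cring "\<O> :: 'n germ ring"
  by (rule cring_germ)

sublocale proj: ring_hom_ring "\<O> :: 'n germ ring" Q proj
  by (rule ideal.rcos_ring_hom_ring[OF ideal])

lemma proj_add: "proj (a + b) = proj a \<oplus>\<^bsub>Q\<^esub> proj b"
  using proj.hom_add[of a b] by (simp add: germ_ring_simps)

lemma proj_mult: "proj (a * b) = proj a \<otimes>\<^bsub>Q\<^esub> proj b"
  using proj.hom_mult[of a b] by (simp add: germ_ring_simps)

lemma proj_one: "proj 1 = \<one>\<^bsub>Q\<^esub>"
  using proj.hom_one by (simp add: germ_ring_simps)

lemma proj_zero: "proj 0 = \<zero>\<^bsub>Q\<^esub>"
  using proj.hom_zero by (simp add: germ_ring_simps)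

lemma carrier_quot: "carrier Q = range proj"
  unfolding FactRing_def by (auto simp: A_RCOSETS_def' germ_ring_simps)

lemma proj_eq_zero_iff: "proj a = \<zero>\<^bsub>Q\<^esub> \<longleftrightarrow> a \<in> germs_in A"
proof -
  have coset: "proj a = (\<lambda>i. i + a) ` germs_in A"
    by (auto simp: a_r_coset_def' germ_ring_simps)
  have zero: "\<zero>\<^bsub>Q\<^esub> = germs_in A"
    by (simp only: FactRing_def ring.select_convs)
  show ?thesis
  proof
    assume "proj a = \<zero>\<^bsub>Q\<^esub>"
    then show "a \<in> germs_in A"
      unfolding zero coset using germs_in_zero by (metis add_0 imageI)
  next
    assume a: "a \<in> germs_in A"
    show "proj a = \<zero>\<^bsub>Q\<^esub>"
      unfolding zero coset
    proof
      show "(\<lambda>i. i + a) ` germs_in A \<subseteq> germs_in A"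
        using a germs_in_add by blast
      show "germs_in A \<subseteq> (\<lambda>i. i + a) ` germs_in A"
      proof
        fix x assume "x \<in> germs_in A"
        then have "x + - a \<in> germs_in A"
          using a germs_in_add germs_in_uminus by blast
        then show "x \<in> (\<lambda>i. i + a) ` germs_in A"
          by (intro image_eqI[of _ _ "x + - a"]) auto
      qed
    qed
  qed
qed

lemma proj_uminus: "proj (- a) = \<ominus>\<^bsub>Q\<^esub> proj a"
proof -
  have "proj (- a) \<oplus>\<^bsub>Q\<^esub> proj a = \<zero>\<^bsub>Q\<^esub>"
    unfolding proj_add[symmetric] proj_zero[symmetric] by (simp only: add.left_inverse)
  moreover have "proj (- a) \<in> carrier Q" "proj a \<in> carrier Q"
    unfolding carrier_quot by blast+
  ultimately have "\<ominus>\<^bsub>Q\<^esub> proj a = proj (- a)"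
    by (intro proj.S.minus_equality)
  then show ?thesis by (rule sym)
qed

lemma proj_const_eq_zero_iff: "proj (const_germ z) = \<zero>\<^bsub>Q\<^esub> \<longleftrightarrow> z = 0"
  unfolding proj_eq_zero_iff using proper by (auto simp: germs_in_def taylor_coeff_const)

lemma scalars_subfield: "subfield (quot_scalars (germs_in A)) Q"
proof (rule proj.S.subfieldI)
  let ?K = "quot_scalars (germs_in A)"
  have K: "?K = range (\<lambda>z. proj (const_germ z))"
    by (simp add: quot_scalars_def)
  have "subring ?K Q"
  proof (rule proj.S.subringI)
    show "?K \<subseteq> carrier Q"
      unfolding K carrier_quot by blast
    show "\<one>\<^bsub>Q\<^esub> \<in> ?K"
      unfolding K proj_one[symmetric] const_germ_1[symmetric] by blast
    show "\<ominus>\<^bsub>Q\<^esub> h \<in> ?K" if h: "h \<in> ?K" for h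
    proof -
      obtain z where z: "h = proj (const_germ z)"
        using h unfolding K by blast
      have "- const_germ z = (const_germ (- z) :: 'n germ)"
        by (rule germ_eqI) (simp add: taylor_coeff_uminus taylor_coeff_const)
      then have "\<ominus>\<^bsub>Q\<^esub> h = proj (const_germ (- z))"
        unfolding z proj_uminus[symmetric] by simp
      then show ?thesis
        unfolding K by blast
    qed
    show "h \<otimes>\<^bsub>Q\<^esub> h' \<in> ?K" if "h \<in> ?K" "h' \<in> ?K" for h h'
      using that unfolding K by (auto simp: proj_mult[symmetric] const_germ_mult[symmetric])
    show "h \<oplus>\<^bsub>Q\<^esub> h' \<in> ?K" if "h \<in> ?K" "h' \<in> ?K" for h h'
      using that unfolding K by (auto simp: proj_add[symmetric] const_germ_add[symmetric])
  qed
  moreover have "h \<otimes>\<^bsub>Q\<^esub> h' = h' \<otimes>\<^bsub>Q\<^esub> h" if "h \<in> ?K" "h' \<in> ?K" for h h'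
    using that unfolding K by (auto simp: proj_mult[symmetric] mult.commute)
  ultimately show "subcring ?K Q"
    by (rule proj.S.subcringI)
  show "Units (Q\<lparr>carrier := ?K\<rparr>) = ?K - {\<zero>\<^bsub>Q\<^esub>}"
  proof (intro equalityI subsetI)
    fix x assume "x \<in> Units (Q\<lparr>carrier := ?K\<rparr>)"
    then obtain y where xy: "x \<in> ?K" "y \<in> ?K" "x \<otimes>\<^bsub>Q\<^esub> y = \<one>\<^bsub>Q\<^esub>"
      by (auto simp: Units_def)
    then obtain z w where zw: "x = proj (const_germ z)" "y = proj (const_germ w)"
      unfolding K by blast
    have "x \<noteq> \<zero>\<^bsub>Q\<^esub>"
    proof
      assume "x = \<zero>\<^bsub>Q\<^esub>"
      then have "proj (const_germ (z * w)) = \<zero>\<^bsub>Q\<^esub>"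
        using zw(1) proj_const_eq_zero_iff by simp
      moreover have "proj (const_germ (z * w)) = proj (const_germ 1)"
        using xy(3) by (simp add: const_germ_mult proj_mult zw const_germ_1 proj_one)
      ultimately show False
        using proj_const_eq_zero_iff[of 1] by simp
    qed
    then show "x \<in> ?K - {\<zero>\<^bsub>Q\<^esub>}"
      using xy(1) by blast
  next
    fix x assume x: "x \<in> ?K - {\<zero>\<^bsub>Q\<^esub>}"
    then obtain z where z: "x = proj (const_germ z)"
      unfolding K by blast
    then have "z \<noteq> 0"
      using x proj_const_eq_zero_iff by auto
    then have "x \<otimes>\<^bsub>Q\<^esub> proj (const_germ (inverse z)) = \<one>\<^bsub>Q\<^esub>" "proj (const_germ (inverse z)) \<otimes>\<^bsub>Q\<^esub> x = \<one>\<^bsub>Q\<^esub>"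
      by (simp_all add: z proj_mult[symmetric] const_germ_mult[symmetric] const_germ_1 proj_one)
    then show "x \<in> Units (Q\<lparr>carrier := ?K\<rparr>)"
      using x unfolding Units_def K by auto
  qed
qed

lemma combine_proj:
  "proj.S.combine (map (\<lambda>z. proj (const_germ z)) cs) (map (\<lambda>k. proj (monom_germ k)) ks) = proj (lin_comb cs ks)"
  by (induction cs ks rule: list_induct2') (simp_all add: lin_comb_def proj_zero proj_add proj_mult)

lemma scalars_list:
  assumes "set Ks \<subseteq> quot_scalars (germs_in A)"
  shows "\<exists>cs. Ks = map (\<lambda>z. proj (const_germ z)) cs"
  using assms unfolding quot_scalars_def by (simp add: ex_map_conv) blast

text \<open>A combination that vanishes in the quotient lies in \<open>germs_in A\<close>, so its
  Taylor coefficients at exponents outside \<open>A\<close> are 0; these are the scalars.\<close>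

lemma independent_monomials:
  assumes ks: "distinct ks" "set ks \<subseteq> - A"
  shows "proj.S.independent (quot_scalars (germs_in A)) (map (\<lambda>k. proj (monom_germ k)) ks)"
proof (rule proj.S.trivial_combine_imp_independent[OF scalars_subfield])
  show "set (map (\<lambda>k. proj (monom_germ k)) ks) \<subseteq> carrier Q"
    unfolding carrier_quot by auto
  fix Ks assume "set Ks \<subseteq> quot_scalars (germs_in A)"
    and zero: "proj.S.combine Ks (map (\<lambda>k. proj (monom_germ k)) ks) = \<zero>\<^bsub>Q\<^esub>"
  then obtain cs where cs: "Ks = map (\<lambda>z. proj (const_germ z)) cs"
    using scalars_list by blast
  have "lin_comb cs ks \<in> germs_in A"
    using zero unfolding cs combine_proj proj_eq_zero_iff .
  then have "cs ! i = 0" if "i < length cs" "i < length ks" for i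
  proof -
    have "ks ! i \<notin> A"
      using ks(2) nth_mem[OF that(2)] by blast
    then show ?thesis
      using taylor_coeff_lin_comb_nth[OF ks(1) that(2,1)] \<open>lin_comb cs ks \<in> germs_in A\<close>
      unfolding germs_in_def by force
  qed
  then show "set (take (length (map (\<lambda>k. proj (monom_germ k)) ks)) Ks) \<subseteq> {\<zero>\<^bsub>Q\<^esub>}"
  proof -
    have "proj (const_germ 0) = \<zero>\<^bsub>Q\<^esub>"
      by (simp only: proj_const_eq_zero_iff)
    then show ?thesis
      using \<open>\<And>i. i < length cs \<Longrightarrow> i < length ks \<Longrightarrow> cs ! i = 0\<close>
      unfolding cs by (auto simp only: in_set_conv_nth length_take length_map nth_take nth_map min_less_iff_conj singleton_iff)
  qed
qed

lemma dimension_quot: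
  assumes "finite (- A)"
  shows "proj.S.dimension (card (- A)) (quot_scalars (germs_in A)) (carrier Q)"
proof -
  obtain ks where ks: "set ks = - A" "distinct ks"
    using finite_distinct_list[OF assms] by blast
  let ?Us = "map (\<lambda>k. proj (monom_germ k)) ks"
  have Us: "set ?Us \<subseteq> carrier Q"
    unfolding carrier_quot by auto
  have "proj.S.Span (quot_scalars (germs_in A)) ?Us = carrier Q"
  proof
    show "proj.S.Span (quot_scalars (germs_in A)) ?Us \<subseteq> carrier Q"
      using proj.S.Span_in_carrier[OF _ Us] subfieldE(3)[OF scalars_subfield] by blast
    show "carrier Q \<subseteq> proj.S.Span (quot_scalars (germs_in A)) ?Us"
    proof
      fix x assume "x \<in> carrier Q"
      then obtain a where a: "x = proj a"
        unfolding carrier_quot by blast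
      \<comment> \<open>Only the finitely many coefficients outside \<open>A\<close> matter:
        subtracting that part of \<open>a\<close> leaves an element of
        \<open>germs_in A\<close>.\<close>
      let ?cs = "map (taylor_coeff a) ks"
      have "a + - lin_comb ?cs ks \<in> germs_in A"
        unfolding germs_in_def
      proof clarify
        fix k assume k: "taylor_coeff (a + - lin_comb ?cs ks) k \<noteq> 0"
        show "k \<in> A"
        proof (rule ccontr)
          assume "k \<notin> A"
          then obtain i where "i < length ks" "k = ks ! i"
            using ks(1) by (metis ComplI in_set_conv_nth)
          then show False
            using k taylor_coeff_lin_comb_nth[OF ks(2), of i ?cs] by (simp add: taylor_coeff_diff)
        qed
      qed
      then have "proj (a + - lin_comb ?cs ks) = \<zero>\<^bsub>Q\<^esub>"
        by (simp only: proj_eq_zero_iff)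
      then have "proj (lin_comb ?cs ks) \<oplus>\<^bsub>Q\<^esub> proj (a + - lin_comb ?cs ks) = proj (lin_comb ?cs ks) \<oplus>\<^bsub>Q\<^esub> \<zero>\<^bsub>Q\<^esub>"
        by (simp only:)
      then have "proj a = proj (lin_comb ?cs ks)"
        unfolding proj_zero[symmetric] proj_add[symmetric] by (simp add: algebra_simps)
      then have "x = proj.S.combine (map (\<lambda>z. proj (const_germ z)) ?cs) ?Us"
        unfolding a combine_proj .
      moreover have "set (map (\<lambda>z. proj (const_germ z)) ?cs) \<subseteq> quot_scalars (germs_in A)"
        unfolding quot_scalars_def by auto
      ultimately show "x \<in> proj.S.Span (quot_scalars (germs_in A)) ?Us"
        using proj.S.Span_eq_combine_set[OF scalars_subfield Us] by blast
    qed
  qed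
  then show ?thesis
    using proj.S.dimensionI[OF scalars_subfield independent_monomials, of ks] ks distinct_card[OF ks(2)] by simp
qed

lemma colength_eq: "finite (- A) \<Longrightarrow> colength (germs_in A) = card (- A)"
  using proj.S.dimI[OF scalars_subfield dimension_quot] by (simp add: colength_def over_def)

text \<open>Otherwise there would be more independent monomials than the dimension allows.\<close>

lemma finite_colength_imp: "finite_colength (germs_in A) \<Longrightarrow> finite (- A)"
proof (rule ccontr)
  assume "finite_colength (germs_in A)" "infinite (- A)"
  then obtain n where n: "proj.S.dimension n (quot_scalars (germs_in A)) (carrier Q)"
    unfolding finite_colength_def proj.S.finite_dimension_def by blast
  obtain B where B: "B \<subseteq> - A" "finite B" "card B = Suc n"
    using infinite_arbitrarily_large[OF \<open>infinite (- A)\<close>] by blast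
  obtain ks where ks: "set ks = B" "distinct ks"
    using finite_distinct_list[OF B(2)] by blast
  have "set ks \<subseteq> - A"
    using ks B by simp
  have "length (map (\<lambda>k. proj (monom_germ k)) ks) \<le> n"
    by (rule proj.S.independent_length_le_dimension[OF scalars_subfield n independent_monomials[OF ks(2) \<open>set ks \<subseteq> - A\<close>]])
      (auto simp: carrier_quot)
  then show False
    using ks B distinct_card[OF ks(2)] by simp
qed

end

section \<open>Hilbert polynomials of monomial ideals\<close>

lemma set_power_upward_iff:
  fixes G :: "(nat ^ 'n::finite) set"
  assumes G: "finite G"
  shows "x \<in> set_power (upward G) r \<longleftrightarrow> (\<exists>f. sum f G = r \<and> (\<Sum>g\<in>G. f g *s g) \<le> x)"
proof (induction r arbitrary: x)
  case 0
  show ?case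
    by (auto intro!: exI[of _ "\<lambda>_. 0"] simp: less_eq_vec_def)
next
  case (Suc r)
  have upd: "sum (f(g := f g + 1)) G = sum f G + 1" "(\<Sum>h\<in>G. (f(g := f g + 1)) h *s h) = (\<Sum>h\<in>G. f h *s h) + g"
    if "g \<in> G" for f and g :: "nat ^ 'n"
  proof -
    have "(f(g := f g + 1)) h = f h + (if h = g then 1 else 0)" for h
      by simp
    then show "sum (f(g := f g + 1)) G = sum f G + 1"
      using G that by (simp add: sum.distrib del: fun_upd_apply)
    have "(f(g := f g + 1)) h *s h = f h *s h + (if h = g then g else 0)" for h
    proof (cases "h = g")
      case True
      show ?thesis unfolding True by (simp add: vec_eq_iff)
    next
      case False
      then show ?thesis by simp
    qed
    then show "(\<Sum>h\<in>G. (f(g := f g + 1)) h *s h) = (\<Sum>h\<in>G. f h *s h) + g"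
      using G that by (simp add: sum.distrib del: fun_upd_apply)
  qed
  show ?case
  proof
    assume "x \<in> set_power (upward G) (Suc r)"
    then obtain y z where yz: "x = y + z" "y \<in> set_power (upward G) r" "z \<in> upward G"
      by (auto simp: set_plus_def)
    then obtain f g where f: "sum f G = r" "(\<Sum>g\<in>G. f g *s g) \<le> y" and g: "g \<in> G" "g \<le> z"
      using Suc by (auto simp: upward_def)
    have "(\<Sum>h\<in>G. f h *s h) + g \<le> x"
      using f(2) g(2) unfolding yz(1) by (auto simp: less_eq_vec_def intro: add_mono)
    then show "\<exists>f. sum f G = Suc r \<and> (\<Sum>g\<in>G. f g *s g) \<le> x"
      using upd[OF g(1), of f] f(1) by (intro exI[of _ "f(g := f g + 1)"]) (simp del: fun_upd_apply)
  next
    assume "\<exists>f. sum f G = Suc r \<and> (\<Sum>g\<in>G. f g *s g) \<le> x"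
    then obtain f where f: "sum f G = Suc r" "(\<Sum>g\<in>G. f g *s g) \<le> x" by blast
    then obtain g where g: "g \<in> G" "f g \<noteq> 0"
      by (metis nat.distinct(1) sum.not_neutral_contains_not_neutral)
    define f' where "f' = f(g := f g - 1)"
    have ff: "f = f'(g := f' g + 1)"
      using g by (auto simp: f'_def)
    have s: "sum f' G = r" "(\<Sum>h\<in>G. f' h *s h) + g \<le> x"
      using f upd[OF g(1), of f'] ff by simp_all
    from s(2) obtain m where "x = (\<Sum>h\<in>G. f' h *s h) + g + m"
      unfolding nat_vec_le_iff_add by blast
    then have x: "x = ((\<Sum>h\<in>G. f' h *s h) + m) + g"
      by (simp add: ac_simps)
    have "(\<Sum>h\<in>G. f' h *s h) \<le> (\<Sum>h\<in>G. f' h *s h) + m"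
      unfolding nat_vec_le_iff_add by blast
    then have "(\<Sum>h\<in>G. f' h *s h) + m \<in> set_power (upward G) r"
      using Suc s(1) by blast
    moreover have "g \<in> upward G"
      using g(1) subset_upward by blast
    ultimately show "x \<in> set_power (upward G) (Suc r)"
      unfolding x by (simp add: set_plus_intro)
  qed
qed

lemma set_power_prod_upward_iff:
  fixes G :: "nat \<Rightarrow> (nat ^ 'n::finite) set"
  assumes "\<And>j. finite (G j)"
  shows "x \<in> set_power_prod (\<lambda>j. upward (G j)) r p \<longleftrightarrow>
    (\<exists>f. (\<forall>j<p. sum (f j) (G j) = r j) \<and> (\<Sum>j<p. \<Sum>g\<in>G j. f j g *s g) \<le> x)"
proof (induction p arbitrary: x)
  case 0
  show ?case by (simp add: less_eq_vec_def)
next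
  case (Suc p)
  show ?case
  proof
    assume "x \<in> set_power_prod (\<lambda>j. upward (G j)) r (Suc p)"
    then obtain y z where yz: "x = y + z" "y \<in> set_power_prod (\<lambda>j. upward (G j)) r p" "z \<in> set_power (upward (G p)) (r p)"
      by (auto simp: set_plus_def)
    obtain f where f: "\<forall>j<p. sum (f j) (G j) = r j" "(\<Sum>j<p. \<Sum>g\<in>G j. f j g *s g) \<le> y"
      using Suc yz(2) by blast
    obtain h where h: "sum h (G p) = r p" "(\<Sum>g\<in>G p. h g *s g) \<le> z"
      using set_power_upward_iff[OF assms, of z p "r p"] yz(3) by blast
    have "(\<Sum>j<p. \<Sum>g\<in>G j. (f(p := h)) j g *s g) = (\<Sum>j<p. \<Sum>g\<in>G j. f j g *s g)"
      by (intro sum.cong) auto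
    then have "(\<Sum>j<Suc p. \<Sum>g\<in>G j. (f(p := h)) j g *s g) \<le> x"
      using f(2) h(2) unfolding yz(1) by (auto simp: less_eq_vec_def simp del: sum_component intro: add_mono)
    moreover have "\<forall>j<Suc p. sum ((f(p := h)) j) (G j) = r j"
      using f(1) h(1) by (auto simp: less_Suc_eq)
    ultimately show "\<exists>f. (\<forall>j<Suc p. sum (f j) (G j) = r j) \<and> (\<Sum>j<Suc p. \<Sum>g\<in>G j. f j g *s g) \<le> x"
      by blast
  next
    assume "\<exists>f. (\<forall>j<Suc p. sum (f j) (G j) = r j) \<and> (\<Sum>j<Suc p. \<Sum>g\<in>G j. f j g *s g) \<le> x"
    then obtain f where f: "\<forall>j<Suc p. sum (f j) (G j) = r j" "(\<Sum>j<p. \<Sum>g\<in>G j. f j g *s g) + (\<Sum>g\<in>G p. f p g *s g) \<le> x"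
      by auto
    then obtain m where "x = (\<Sum>j<p. \<Sum>g\<in>G j. f j g *s g) + ((\<Sum>g\<in>G p. f p g *s g) + m)"
      unfolding nat_vec_le_iff_add by (auto simp: add.assoc)
    moreover have "(\<Sum>j<p. \<Sum>g\<in>G j. f j g *s g) \<in> set_power_prod (\<lambda>j. upward (G j)) r p"
      using Suc f(1) by (auto intro!: exI[of _ f])
    moreover have "(\<Sum>g\<in>G p. f p g *s g) + m \<in> set_power (upward (G p)) (r p)"
      unfolding set_power_upward_iff[OF assms] using f(1) by (intro exI[of _ "f p"]) (simp add: less_eq_vec_def)
    ultimately show "x \<in> set_power_prod (\<lambda>j. upward (G j)) r (Suc p)"
      by (simp add: set_plus_intro)
  qed
qed

lemma total_degree_zero: "total_degree 0 = 0"
  by (simp add: total_degree_def)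

lemma total_degree_sum: "total_degree (sum f A) = (\<Sum>x\<in>A. total_degree (f x))"
  by (induction A rule: infinite_finite_induct) (simp_all add: total_degree_add total_degree_zero)

lemma total_degree_scale: "total_degree (c *s x) = c * total_degree x"
  by (simp add: total_degree_def sum_distrib_left)

lemma total_degree_mono: "x \<le> y \<Longrightarrow> total_degree x \<le> total_degree y"
  unfolding total_degree_def less_eq_vec_def by (intro sum_mono) auto

lemma total_degree_axis: "total_degree (axis i m) = m"
  by (simp add: total_degree_def axis_def)

text \<open>Up to total degree \<open>c\<close> times the number of factors, the points of the product are exactly the
  sums of points of degree at most \<open>c\<close> of the factors: surplus unit vectors can be distributed.\<close>

lemma set_power_prod_truncated:
  fixes A :: "nat \<Rightarrow> (nat ^ 'n::finite) set"
  assumes up: "\<And>j. upward (A j) = A j" and S: "\<And>j. S j \<subseteq> A j" "\<And>j. A j \<subseteq> upward (S j)"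
    and c: "\<And>j s. s \<in> S j \<Longrightarrow> total_degree s \<le> c"
  shows "eventually_poly p (\<lambda>r. real (card {x \<in> set_power_prod A r p. total_degree x \<le> c * (\<Sum>j<p. r j)}))"
proof -
  \<comment> \<open>Taking all points of degree at most \<open>c\<close> as generators, not just
    those of \<open>S j\<close>, a generator of smaller degree remains a generator when a unit
    vector is added to it.\<close>
  define B where "B j = {k \<in> A j. total_degree k \<le> c}" for j
  have finB: "finite (B j)" for j
    unfolding B_def by (rule finite_subset[OF _ finite_total_degree_le[of c]]) auto
  have SB: "S j \<subseteq> B j" for j
    using S(1) c unfolding B_def by blast
  have A: "A = (\<lambda>j. upward (B j))"
  proof (rule ext, rule equalityI)
    fix j
    show "A j \<subseteq> upward (B j)"
      using S(2)[of j] upward_mono[OF SB[of j]] by blast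
    have "B j \<subseteq> A j"
      unfolding B_def by blast
    then show "upward (B j) \<subseteq> A j"
      using upward_mono up by metis
  qed
  define T where "T = Sigma {..<p} B"
  interpret coloured_sums T fst p
    by unfold_locales (auto simp: T_def finB)
  define V :: "(nat \<times> (nat ^ 'n) \<Rightarrow> nat) \<Rightarrow> nat ^ 'n" where "V f = (\<Sum>t\<in>T. f t *s snd t)" for f
  have V_add: "V (\<lambda>t. f t + g t) = V f + V g" for f g
    unfolding V_def sum.distrib[symmetric] by (intro sum.cong) (auto simp: vec_eq_iff algebra_simps)
  define \<delta> :: "nat \<times> (nat ^ 'n) \<Rightarrow> nat \<times> (nat ^ 'n) \<Rightarrow> nat" where "\<delta> t u = (if u = t then 1 else 0)" for t u
  have V_delta: "V (\<delta> t) = snd t" if "t \<in> T" for t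
  proof -
    have "V (\<delta> t) = (\<Sum>u\<in>T. if u = t then snd t else 0)"
      unfolding V_def \<delta>_def by (intro sum.cong) (auto simp: vec_eq_iff)
    then show ?thesis
      using that fin by simp
  qed
  have fibre: "fibre j = Pair j ` B j" if "j < p" for j
    unfolding fibre_def unfolding T_def using that by auto
  have sum_fibre: "sum f (fibre j) = (\<Sum>g\<in>B j. f (j, g))" if "j < p" for f :: "nat \<times> (nat ^ 'n) \<Rightarrow> nat" and j
    unfolding fibre[OF that] by (subst sum.reindex) (auto simp: inj_on_def)
  have V_eq: "V f = (\<Sum>j<p. \<Sum>g\<in>B j. f (j, g) *s g)" for f
    unfolding V_def T_def by (subst sum.Sigma) (auto simp: finB case_prod_unfold)
  have sum_T: "sum f T = (\<Sum>j<p. r j)" if "f \<in> level r" for f r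
  proof -
    have "sum f T = (\<Sum>j<p. \<Sum>g\<in>B j. f (j, g))"
      unfolding T_def by (subst sum.Sigma) (auto simp: finB case_prod_unfold)
    also have "\<dots> = (\<Sum>j<p. r j)"
      using that by (intro sum.cong) (auto simp: level_def sum_fibre)
    finally show ?thesis .
  qed
  have deg_V: "total_degree (V f) = (\<Sum>t\<in>T. f t * total_degree (snd t))" for f
    unfolding V_def by (simp add: total_degree_sum total_degree_scale)
  \<comment> \<open>Induction on the missing degree. As long as \<open>V f\<close> differs from
    \<open>x\<close>, its degree is below \<open>c\<close> times the number of factors; so some
    factor has degree below \<open>c\<close> and can absorb one more unit vector.\<close>
  have raise: "x \<in> V ` level r" if "f \<in> level r" "V f \<le> x" "total_degree x \<le> c * (\<Sum>j<p. r j)" for f x r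
    using that
  proof (induction "total_degree x - total_degree (V f)" arbitrary: f rule: less_induct)
    case less
    show ?case
    proof (cases "V f = x")
      case True
      then show ?thesis using less.prems by blast
    next
      case False
      then obtain i where i: "V f $ i < x $ i"
        using less.prems(2) by (auto simp: vec_eq_iff less_eq_vec_def) (metis le_neq_implies_less)
      define y where "y = V f + axis i 1"
      have yx: "y \<le> x"
        using i less.prems(2) by (auto simp: y_def less_eq_vec_def axis_def)
      have dy: "total_degree y = Suc (total_degree (V f))"
        by (simp add: y_def total_degree_add total_degree_axis)
      then have lt: "total_degree (V f) < total_degree x"
        using total_degree_mono[OF yx] by simp
      have "\<exists>t\<in>T. f t \<noteq> 0 \<and> total_degree (snd t) < c"
      proof (rule ccontr)
        assume "\<not> (\<exists>t\<in>T. f t \<noteq> 0 \<and> total_degree (snd t) < c)"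
        then have "(\<Sum>t\<in>T. f t * c) \<le> (\<Sum>t\<in>T. f t * total_degree (snd t))"
          by (intro sum_mono) (auto simp: not_less)
        then have "c * sum f T \<le> total_degree (V f)"
          by (simp add: deg_V sum_distrib_left mult.commute)
        then show False
          using lt less.prems(3) sum_T[OF less.prems(1)] by simp
      qed
      then obtain t where t: "t \<in> T" "f t \<noteq> 0" "total_degree (snd t) < c"
        by blast
      define t' where "t' = (fst t, snd t + axis i 1)"
      have "snd t + axis i 1 \<in> upward (A (fst t))"
        using t(1) unfolding T_def B_def upward_def nat_vec_le_iff_add by auto
      then have t': "t' \<in> T"
        using t unfolding up T_def B_def t'_def by (auto simp: total_degree_add total_degree_axis)
      define h where "h u = f u - \<delta> t u" for u
      have fh: "f = (\<lambda>u. h u + \<delta> t u)"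
        using t(2) by (auto simp: h_def \<delta>_def)
      define f' where "f' = (\<lambda>u. h u + \<delta> t' u)"
      have Vf': "V f' = y"
        unfolding f'_def y_def V_add V_delta[OF t'] by (subst fh) (simp add: V_add V_delta[OF t(1)] t'_def add.assoc)
      have "sum (\<delta> t') (fibre j) = sum (\<delta> t) (fibre j)" for j
      proof -
        have "sum (\<delta> u) (fibre j) = (if u \<in> fibre j then 1 else 0)" for u
          by (simp add: \<delta>_def finite_fibre)
        moreover have "t' \<in> fibre j \<longleftrightarrow> t \<in> fibre j"
          using t(1) t' by (simp add: fibre_def) (simp add: t'_def)
        ultimately show ?thesis by simp
      qed
      then have "sum f' (fibre j) = sum f (fibre j)" for j
        by (subst fh) (simp add: f'_def sum.distrib)
      moreover have "f' \<in> supported"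
        using less.prems(1) t(1) t' by (auto simp: level_def supported_def f'_def h_def \<delta>_def)
      ultimately have "f' \<in> level r"
        using less.prems(1) by (simp add: level_def)
      then show ?thesis
        using less.hyps[of f'] Vf' yx dy lt less.prems(3) by simp
    qed
  qed
  have "V ` level r = {x \<in> set_power_prod A r p. total_degree x \<le> c * (\<Sum>j<p. r j)}" for r
  proof (intro equalityI subsetI)
    fix x assume "x \<in> V ` level r"
    then obtain f where f: "f \<in> level r" "x = V f" by blast
    have "x \<in> set_power_prod A r p"
      unfolding A set_power_prod_upward_iff[OF finB] f(2) V_eq
      using f(1) by (intro exI[of _ "\<lambda>j g. f (j, g)"]) (auto simp: level_def sum_fibre)
    moreover have "total_degree x \<le> (\<Sum>t\<in>T. f t * c)"
      unfolding f(2) deg_V by (intro sum_mono mult_le_mono) (auto simp: T_def B_def)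
    then have "total_degree x \<le> c * (\<Sum>j<p. r j)"
      unfolding sum_distrib_right[symmetric] sum_T[OF f(1)] by (simp only: mult.commute)
    ultimately show "x \<in> {x \<in> set_power_prod A r p. total_degree x \<le> c * (\<Sum>j<p. r j)}"
      by blast
  next
    fix x assume x: "x \<in> {x \<in> set_power_prod A r p. total_degree x \<le> c * (\<Sum>j<p. r j)}"
    then obtain f where f: "\<forall>j<p. sum (f j) (B j) = r j" "(\<Sum>j<p. \<Sum>g\<in>B j. f j g *s g) \<le> x"
      unfolding A set_power_prod_upward_iff[OF finB] by blast
    define f' where "f' t = (if t \<in> T then f (fst t) (snd t) else 0)" for t
    have eq: "f' (j, g) = f j g" if "j < p" "g \<in> B j" for j g
      using that by (simp add: f'_def T_def)
    have "f' \<in> level r"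
      using f(1) by (auto simp: level_def supported_def sum_fibre eq) (simp add: f'_def)
    moreover have "V f' \<le> x"
    proof -
      have "V f' = (\<Sum>j<p. \<Sum>g\<in>B j. f j g *s g)"
        unfolding V_eq by (intro sum.cong refl) (simp add: eq)
      then show ?thesis using f(2) by simp
    qed
    ultimately show "x \<in> V ` level r"
      using raise x by blast
  qed
  then show ?thesis
    using eventually_poly_card_values[of V] V_add by simp
qed

lemma card_total_degree_le: "card {k :: nat ^ 'n::finite. total_degree k \<le> d} \<le> (d + 1) ^ CARD('n)"
proof -
  have "card {k :: nat ^ 'n. total_degree k \<le> d} \<le> card (vec_lambda ` (PiE UNIV (\<lambda>_ :: 'n. {..d})) :: (nat ^ 'n) set)"
  proof (rule card_mono)
    show "{k :: nat ^ 'n. total_degree k \<le> d} \<subseteq> vec_lambda ` (PiE UNIV (\<lambda>_. {..d}))"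
    proof
      fix k :: "nat ^ 'n" assume "k \<in> {k. total_degree k \<le> d}"
      then have "k $ j \<le> d" for j
        using total_degree_ge[of k j] by simp
      then show "k \<in> vec_lambda ` (PiE UNIV (\<lambda>_. {..d}))"
        by (intro image_eqI[of _ _ "vec_nth k"]) auto
    qed
  qed (intro finite_imageI finite_PiE, auto)
  also have "\<dots> \<le> card (PiE UNIV (\<lambda>_ :: 'n. {..d}))"
    by (intro card_image_le finite_PiE) auto
  also have "\<dots> = (d + 1) ^ CARD('n)"
    by (simp add: card_PiE)
  finally show ?thesis .
qed

lemma set_power_axis:
  "axis i c \<in> A \<Longrightarrow> axis i (c * q) \<in> set_power A q"
proof (induction q)
  case (Suc q)
  have "axis i (c * Suc q) = axis i (c * q) + axis i c"
    by (auto simp: axis_def vec_eq_iff)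
  then show ?case
    using Suc by (simp add: set_plus_intro)
qed simp

lemma set_power_prod_contains:
  fixes x :: "nat ^ 'n::finite"
  assumes up: "\<And>j. upward (A j) = A j" and c: "\<And>j. axis i c \<in> A j"
    and x: "c * (\<Sum>j<p. r j) \<le> x $ i"
  shows "x \<in> set_power_prod A r p"
proof -
  have "axis i (c * (\<Sum>j<p. r j)) \<in> set_power_prod A r p"
  proof (induction p)
    case (Suc p)
    have "axis i (c * (\<Sum>j<Suc p. r j)) = axis i (c * (\<Sum>j<p. r j)) + axis i (c * r p)"
      by (auto simp: axis_def vec_eq_iff algebra_simps)
    then show ?case
      using Suc set_power_axis[OF c] by (simp add: set_plus_intro)
  qed simp
  moreover have "axis i (c * (\<Sum>j<p. r j)) \<le> x"
    using x by (auto simp: axis_def less_eq_vec_def)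
  ultimately show ?thesis
    using finprod_germs_in(2)[of A, OF up, where r = r and p = p] unfolding upward_def by blast
qed

lemma cofinite_upward_axis:
  fixes A :: "nat \<Rightarrow> (nat ^ 'n::finite) set"
  assumes "\<And>j. finite (- A j)"
  shows "\<exists>c. \<forall>j<p. \<forall>i. \<forall>m\<ge>c. axis i m \<in> A j"
proof -
  have "finite (\<Union>j<p. - A j)"
    using assms by blast
  then have fin: "finite (total_degree ` (\<Union>j<p. - A j))"
    by (rule finite_imageI)
  define c where "c = Suc (Max (insert 0 (total_degree ` (\<Union>j<p. - A j))))"
  have "axis i m \<in> A j" if "j < p" "c \<le> m" for i m j
  proof (rule ccontr)
    assume "axis i m \<notin> A j"
    then have "total_degree (axis i m) \<in> insert 0 (total_degree ` (\<Union>j<p. - A j))"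
      using that(1) by blast
    then have "total_degree (axis i m) < c"
      using fin unfolding c_def by (simp add: le_imp_less_Suc Max_ge)
    then show False
      using that(2) by (simp add: total_degree_axis)
  qed
  then show ?thesis by blast
qed


lemma set_power_prod_cong:
  "(\<And>j. j < p \<Longrightarrow> A j = B j) \<Longrightarrow> set_power_prod A r p = set_power_prod B r p"
  by (induction p) auto

lemma set_power_prod_UNIV: "set_power_prod (\<lambda>_. UNIV :: (nat ^ 'n::finite) set) r p = UNIV"
proof -
  have plus: "(UNIV :: (nat ^ 'n) set) + UNIV = UNIV"
    by (auto simp: set_plus_def intro: exI[of _ 0])
  have "set_power (UNIV :: (nat ^ 'n) set) q = UNIV" for q
    by (induction q) (simp_all add: plus)
  then show ?thesis
    by (induction p) (simp_all add: plus)
qed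

text \<open>Pigeonhole: a large total degree forces a large coordinate \<open>i\<close>, and the
  pure power \<open>axis i c\<close> belongs to every factor.\<close>

lemma set_power_prod_cofinite:
  fixes A :: "nat \<Rightarrow> (nat ^ 'n::finite) set"
  assumes up: "\<And>j. upward (A j) = A j" and fin: "\<And>j. j < p \<Longrightarrow> finite (- A j)"
  shows "\<exists>c. \<forall>r x. c * (\<Sum>j<p. r j) < total_degree x \<longrightarrow> x \<in> set_power_prod A r p"
proof -
  \<comment> \<open>Indices from \<open>p\<close> on do not enter the product; replacing these sets
    by \<open>UNIV\<close> makes the hypotheses uniform in \<open>j\<close>.\<close>
  define A' where "A' j = (if j < p then A j else UNIV)" for j
  have up': "upward (A' j) = A' j" for j
    by (simp add: A'_def up upward_UNIV)
  have fin': "finite (- A' j)" for j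
    using fin by (simp add: A'_def)
  obtain c where c: "\<forall>j<p. \<forall>i. \<forall>m\<ge>c. axis i m \<in> A' j"
    using cofinite_upward_axis[of A' p, OF fin'] by blast
  have c': "axis i c \<in> A' j" for i j
    using c by (cases "j < p") (auto simp: A'_def)
  have "x \<in> set_power_prod A r p" if x: "CARD('n) * c * (\<Sum>j<p. r j) < total_degree x" for r x
  proof -
    have "\<exists>i. c * (\<Sum>j<p. r j) \<le> x $ i"
    proof (rule ccontr)
      assume "\<nexists>i. c * (\<Sum>j<p. r j) \<le> x $ i"
      then have "total_degree x \<le> (\<Sum>i\<in>(UNIV :: 'n set). c * (\<Sum>j<p. r j))"
        unfolding total_degree_def by (intro sum_mono) (meson not_le less_imp_le)
      then show False
        using x by simp
    qed
    then have "x \<in> set_power_prod A' r p"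
      using set_power_prod_contains[of A', OF up' c'] by blast
    then show ?thesis
      using set_power_prod_cong[of p A' A] by (simp add: A'_def)
  qed
  then show ?thesis by blast
qed

lemma finite_compl_set_power_prod:
  fixes A :: "nat \<Rightarrow> (nat ^ 'n::finite) set"
  assumes "\<And>j. upward (A j) = A j" "\<And>j. j < p \<Longrightarrow> finite (- A j)"
  shows "finite (- set_power_prod A r p)"
proof -
  obtain c where c: "\<And>x. c * (\<Sum>j<p. r j) < total_degree x \<Longrightarrow> x \<in> set_power_prod A r p"
    using set_power_prod_cofinite[of A p, OF assms] by blast
  show ?thesis
    by (rule finite_subset[OF _ finite_total_degree_le[of "c * (\<Sum>j<p. r j)"]]) (use c in \<open>auto simp: not_le[symmetric]\<close>)
qed

text \<open>The complement is not itself a set of values of coloured sums. It lies in degree at most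
  \<open>c\<close> times the number of factors, and there it is the difference of two such sets: all
  exponents, which is the case of unit ideals, and the exponents of the product.\<close>

theorem hilbert_function_polynomial:
  fixes A :: "nat \<Rightarrow> (nat ^ 'n::finite) set"
  assumes up: "\<And>j. upward (A j) = A j" and fin: "\<And>j. j < p \<Longrightarrow> finite (- A j)"
  shows "\<exists>c N. \<forall>r. (\<forall>j<p. N \<le> r j) \<longrightarrow> real (card (- set_power_prod A r p)) =
    (\<Sum>k | (\<forall>j\<ge>p. k j = 0) \<and> (\<Sum>j<p. k j) \<le> CARD('n). c k * (\<Prod>j<p. real (r j) ^ k j))"
proof -
  define A' where "A' j = (if j < p then A j else UNIV)" for j
  have up': "upward (A' j) = A' j" for j
    by (simp add: A'_def up upward_UNIV)
  have AA': "set_power_prod A r p = set_power_prod A' r p" for r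
    by (rule set_power_prod_cong) (simp add: A'_def)
  have "\<exists>S0. finite S0 \<and> S0 \<subseteq> A' j \<and> upward S0 = upward (A' j)" for j
    by (rule dickson_vec)
  then obtain S where S: "\<And>j. finite (S j)" "\<And>j. S j \<subseteq> A' j" "\<And>j. upward (S j) = A' j"
    unfolding up' by metis
  obtain c1 where c1: "\<And>r x. c1 * (\<Sum>j<p. r j) < total_degree x \<Longrightarrow> x \<in> set_power_prod A r p"
    using set_power_prod_cofinite[of A p, OF up fin] by blast
  \<comment> \<open>The exponent 0 generates \<open>UNIV\<close> and has degree 0, so it satisfies
    every degree bound.\<close>
  define S' where "S' j = (if j < p then S j else {0})" for j
  \<comment> \<open>\<open>c\<close> bounds the degrees of the generators and is at least
    \<open>c1\<close>, so the truncation loses no point of the complement.\<close>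
  define c where "c = Max (insert c1 (total_degree ` (\<Union>j<p. S j)))"
  have fin_S: "finite (insert c1 (total_degree ` (\<Union>j<p. S j)))"
    using S(1) by blast
  have c1c: "c1 \<le> c"
    unfolding c_def using fin_S by (rule Max_ge) simp
  have deg: "total_degree s \<le> c" if "s \<in> S' j" for j s
  proof (cases "j < p")
    case True
    then have "total_degree s \<in> insert c1 (total_degree ` (\<Union>j<p. S j))"
      using that by (auto simp: S'_def)
    then show ?thesis
      unfolding c_def using fin_S by (intro Max_ge)
  qed (use that in \<open>simp add: S'_def total_degree_def\<close>)
  have zero: "upward {0 :: nat ^ 'n} = UNIV"
    by (auto simp: upward_def less_eq_vec_def)
  have S': "S' j \<subseteq> A' j" "A' j \<subseteq> upward (S' j)" for j
    using S(2,3)[of j] zero by (auto simp: S'_def A'_def)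
  let ?low = "\<lambda>A r. {x \<in> set_power_prod A r p. total_degree x \<le> c * (\<Sum>j<p. r j)}"
  let ?all = "\<lambda>r. {x :: nat ^ 'n. total_degree x \<le> c * (\<Sum>j<p. r j)}"
  have A1: "eventually_poly p (\<lambda>r. real (card (?low A r)))"
    unfolding AA' by (rule set_power_prod_truncated[OF up' S' deg])
  have "eventually_poly p (\<lambda>r. real (card (?low (\<lambda>_. UNIV :: (nat ^ 'n) set) r)))"
    by (rule set_power_prod_truncated[where S = "\<lambda>_. {0}"]) (simp_all add: upward_UNIV zero total_degree_def)
  then have A2: "eventually_poly p (\<lambda>r. real (card (?all r)))"
    by (simp add: set_power_prod_UNIV)
  have sub: "- set_power_prod A r p \<subseteq> ?all r" for r
  proof
    fix x assume "x \<in> - set_power_prod A r p"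
    then have "total_degree x \<le> c1 * (\<Sum>j<p. r j)"
      using c1 not_le by blast
    also have "\<dots> \<le> c * (\<Sum>j<p. r j)"
      using c1c by (rule mult_le_mono1)
    finally show "x \<in> ?all r" by simp
  qed
  have eq: "real (card (?all r)) - real (card (?low A r)) = real (card (- set_power_prod A r p))" for r
  proof -
    have "?all r = ?low A r \<union> - set_power_prod A r p"
      using sub[of r] by blast
    moreover have "?low A r \<inter> - set_power_prod A r p = {}"
      by blast
    moreover have "finite (?low A r)" "finite (- set_power_prod A r p)"
      using finite_subset[OF _ finite_total_degree_le[of "c * (\<Sum>j<p. r j)"], of "?low A r"]
        finite_subset[OF sub[of r] finite_total_degree_le] by auto
    ultimately have "card (?all r) = card (?low A r) + card (- set_power_prod A r p)"
      using card_Un_disjoint[of "?low A r" "- set_power_prod A r p"] by (simp only:)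
    then show ?thesis by linarith
  qed
  have poly: "eventually_poly p (\<lambda>r. real (card (- set_power_prod A r p)))"
    using eventually_poly_diff[OF A2 A1] unfolding eq .
  have bound: "\<bar>real (card (- set_power_prod A r p))\<bar> \<le> real (c + 1) ^ CARD('n) * real ((\<Sum>j<p. r j) + 1) ^ CARD('n)" for r
  proof -
  have "card (- set_power_prod A r p) \<le> card (?all r)"
    using sub by (intro card_mono finite_total_degree_le)
  also have "\<dots> \<le> (c * (\<Sum>j<p. r j) + 1) ^ CARD('n)"
    by (rule card_total_degree_le)
  also have "\<dots> \<le> ((c + 1) * ((\<Sum>j<p. r j) + 1)) ^ CARD('n)"
    by (intro power_mono) auto
  finally have "real (card (- set_power_prod A r p)) \<le> real (((c + 1) * ((\<Sum>j<p. r j) + 1)) ^ CARD('n))"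
    by (simp only: of_nat_le_iff)
  then show ?thesis
    by (simp only: of_nat_mult of_nat_power power_mult_distrib abs_of_nat)
  qed
  show ?thesis
    by (rule eventually_poly_bounded_degree[OF poly bound])
qed

section \<open>Exchanging generators along a normal cone\<close>

lemma real_vec_add: "real_vec (a + b) = real_vec a + real_vec b"
  by (simp add: real_vec_def vec_eq_iff)

lemma real_vec_scale: "real_vec (c *s a) = real c *\<^sub>R real_vec a"
  by (simp add: real_vec_def vec_eq_iff)

lemma real_vec_zero: "real_vec 0 = 0"
  by (simp add: real_vec_def vec_eq_iff)

lemma real_vec_sum: "real_vec (sum f A) = (\<Sum>x\<in>A. real_vec (f x))"
  by (induction A rule: infinite_finite_induct) (simp_all add: real_vec_add real_vec_zero)

lemma inj_real_vec: "inj real_vec"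
  by (auto simp: inj_def real_vec_def vec_eq_iff)

lemma real_vec_nth: "real_vec a $ j = real (a $ j)"
  by (simp add: real_vec_def)

text \<open>The polytope plus the cone is closed, being compact plus closed. If \<open>q\<close> lay
  outside, a hyperplane would separate it strictly; the separating functional is bounded below on
  the sum, hence nonnegative on \<open>S\<close>, against the hypothesis.\<close>

lemma farkas_convex_hull:
  fixes P S :: "'a::euclidean_space set"
  assumes P: "finite P" "P \<noteq> {}" and S: "finite S"
    and v: "\<And>v. (\<And>s. s \<in> S \<Longrightarrow> 0 \<le> v \<bullet> s) \<Longrightarrow> \<exists>p\<in>P. v \<bullet> p \<le> v \<bullet> q"
  shows "\<exists>p\<in>convex hull P. q - p \<in> convex_cone hull S"
proof (rule ccontr)
  assume neg: "\<not> ?thesis"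
  define Z where "Z = (\<Union>x\<in>convex hull P. \<Union>y\<in>convex_cone hull S. {x + y})"
  have "closed Z"
    unfolding Z_def
    by (rule compact_closed_sums[OF finite_imp_compact_convex_hull[OF P(1)] closed_convex_cone_hull[OF S]])
  moreover have "convex Z"
    unfolding Z_def by (intro convex_sums convex_convex_hull convex_convex_cone_hull)
  moreover have "q \<notin> Z"
  proof
    assume "q \<in> Z"
    then obtain x y where "x \<in> convex hull P" "y \<in> convex_cone hull S" "q = x + y"
      unfolding Z_def by blast
    then show False
      using neg by (metis add_diff_cancel_left')
  qed
  ultimately obtain a b where ab: "a \<bullet> q < b" "\<And>x. x \<in> Z \<Longrightarrow> b < a \<bullet> x"
    using separating_hyperplane_closed_point[of Z q] by blast
  have PZ: "p \<in> Z" if "p \<in> P" for p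
    unfolding Z_def using that hull_inc[of p P convex] convex_cone_hull_contains_0[of S]
    by (intro UN_I[of p] UN_I[of 0]) auto
  have "0 \<le> a \<bullet> s" if s: "s \<in> S" for s
  proof (rule ccontr)
    assume "\<not> 0 \<le> a \<bullet> s"
    then have neg': "a \<bullet> s < 0" by simp
    obtain p where p: "p \<in> P" using P(2) by blast
    \<comment> \<open>Far enough along \<open>s\<close> the functional at \<open>p + t s\<close>
      drops to at most \<open>b\<close>.\<close>
    define t where "t = max 0 ((b - a \<bullet> p) / (a \<bullet> s))"
    have "t *\<^sub>R s \<in> convex_cone hull S"
      using s by (intro convex_cone_hull_mul hull_inc) (auto simp: t_def)
    then have "p + t *\<^sub>R s \<in> Z"
      unfolding Z_def using hull_inc[OF p, of convex] by blast
    then have "b < a \<bullet> p + t * (a \<bullet> s)"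
      using ab(2) by (fastforce simp: inner_add_right)
    moreover have "t * (a \<bullet> s) \<le> (b - a \<bullet> p) / (a \<bullet> s) * (a \<bullet> s)"
      using neg' by (intro mult_right_mono_neg) (auto simp: t_def)
    ultimately show False
      using neg' by simp
  qed
  then obtain p where "p \<in> P" "a \<bullet> p \<le> a \<bullet> q"
    using v by blast
  then show False
    using ab(1) ab(2)[OF PZ] by fastforce
qed

text \<open>\<open>v\<close> ranges over the normal cone of the face spanned by \<open>B\<close> and the coordinate directions in
  \<open>U\<close>. The coefficients \<open>\<delta>\<close> and \<open>y\<close> may be negative only along that face.\<close>

lemma exchange_single:
  fixes P G B :: "(real ^ 'n) set" and U :: "'n set"
  assumes P: "finite P" "P \<noteq> {}" and G: "finite G" and B: "B \<subseteq> G"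
    and v: "\<And>v. (\<And>j. 0 \<le> v $ j) \<Longrightarrow> (\<And>j. j \<in> U \<Longrightarrow> v $ j = 0) \<Longrightarrow>
      (\<And>w w'. w \<in> B \<Longrightarrow> w' \<in> G \<Longrightarrow> v \<bullet> w \<le> v \<bullet> w') \<Longrightarrow> \<exists>p\<in>P. v \<bullet> p \<le> v \<bullet> q"
  shows "\<exists>\<pi> \<delta> y. (\<forall>p\<in>P. 0 \<le> \<pi> p) \<and> sum \<pi> P = 1 \<and> sum \<delta> G = 0 \<and> (\<forall>w\<in>G - B. 0 \<le> \<delta> w) \<and>
    (\<forall>j. j \<notin> U \<longrightarrow> 0 \<le> y $ j) \<and> q = (\<Sum>p\<in>P. \<pi> p *\<^sub>R p) + (\<Sum>w\<in>G. \<delta> w *\<^sub>R w) + y"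
proof -
  \<comment> \<open>Nonnegativity of \<open>v\<close> on \<open>S\<close> encodes the three
    conditions on \<open>v\<close>: minimality on \<open>B\<close> among \<open>G\<close>,
    nonnegative coordinates, and zero coordinates in \<open>U\<close>.\<close>
  define S where "S = (\<lambda>(w, w'). w - w') ` (G \<times> B) \<union> range (\<lambda>j. axis j 1) \<union> (\<lambda>j. - axis j 1) ` U"
  have "finite S"
    unfolding S_def using G finite_subset[OF B G] by (intro finite_UnI finite_imageI finite_cartesian_product) auto
  \<comment> \<open>The cone generated by \<open>S\<close> lies in \<open>K\<close>, whose
    description yields the sign conditions on \<open>\<delta>\<close> and \<open>y\<close>.\<close>
  define K where "K = {(\<Sum>w\<in>G. \<delta> w *\<^sub>R w) + y | \<delta> y. sum \<delta> G = 0 \<and> (\<forall>w\<in>G - B. 0 \<le> \<delta> w) \<and> (\<forall>j. j \<notin> U \<longrightarrow> 0 \<le> y $ j)}"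
  have "S \<subseteq> K"
  proof
    fix s assume "s \<in> S"
    then consider (diff) w w' where "w \<in> G" "w' \<in> B" "s = w - w'"
      | (pos) j where "s = axis j 1" | (neg) j where "j \<in> U" "s = - axis j 1"
      unfolding S_def by auto
    then show "s \<in> K"
    proof cases
      case diff
      let ?\<delta> = "\<lambda>x. (if x = w then 1 else 0) - (if x = w' then 1 else (0::real))"
      have eq: "(\<Sum>x\<in>G. ?\<delta> x *\<^sub>R x) + 0 = s"
      proof -
        have "?\<delta> x *\<^sub>R x = (if x = w then w else 0) - (if x = w' then w' else 0)" for x
          by (simp add: scaleR_left_diff_distrib)
        then have "(\<Sum>x\<in>G. ?\<delta> x *\<^sub>R x) = (\<Sum>x\<in>G. if x = w then w else 0) - (\<Sum>x\<in>G. if x = w' then w' else 0)"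
          by (simp only: sum_subtractf)
        then show ?thesis
          using diff G B by (auto simp: subset_iff)
      qed
      have "sum ?\<delta> G = 0"
        unfolding sum_subtractf using diff G B by (auto simp: subset_iff)
      moreover have "\<forall>x\<in>G - B. 0 \<le> ?\<delta> x"
        using diff by auto
      ultimately show ?thesis
        unfolding K_def mem_Collect_eq by (intro exI[of _ ?\<delta>] exI[of _ 0] conjI) (assumption | rule eq[symmetric] | simp)+
    next
      case pos
      then show ?thesis
        unfolding K_def mem_Collect_eq by (intro exI[of _ "\<lambda>_. 0"] exI[of _ s]) (auto simp: axis_def)
    next
      case neg
      then show ?thesis
        unfolding K_def mem_Collect_eq by (intro exI[of _ "\<lambda>_. 0"] exI[of _ s]) (auto simp: axis_def)
    qed
  qed
  moreover have "convex_cone K"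
    unfolding convex_cone_iff
  proof (intro conjI ballI allI impI)
    show "0 \<in> K"
      unfolding K_def mem_Collect_eq by (intro exI[of _ "\<lambda>_. 0"] exI[of _ 0]) auto
    fix x assume "x \<in> K"
    then obtain \<delta> y where x: "x = (\<Sum>w\<in>G. \<delta> w *\<^sub>R w) + y" "sum \<delta> G = 0" "\<forall>w\<in>G - B. 0 \<le> \<delta> w" "\<forall>j. j \<notin> U \<longrightarrow> 0 \<le> y $ j"
      unfolding K_def by blast
    show "c *\<^sub>R x \<in> K" if c: "0 \<le> c" for c
      unfolding K_def mem_Collect_eq using x c
      by (intro exI[of _ "\<lambda>w. c * \<delta> w"] exI[of _ "c *\<^sub>R y"])
        (auto simp: scaleR_right_distrib scaleR_sum_right sum_distrib_left[symmetric])
    fix x' assume "x' \<in> K"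
    then obtain \<delta>' y' where x': "x' = (\<Sum>w\<in>G. \<delta>' w *\<^sub>R w) + y'" "sum \<delta>' G = 0" "\<forall>w\<in>G - B. 0 \<le> \<delta>' w" "\<forall>j. j \<notin> U \<longrightarrow> 0 \<le> y' $ j"
      unfolding K_def by blast
    show "x + x' \<in> K"
      unfolding K_def mem_Collect_eq using x x'
      by (intro exI[of _ "\<lambda>w. \<delta> w + \<delta>' w"] exI[of _ "y + y'"])
        (auto simp: scaleR_left_distrib sum.distrib)
  qed
  ultimately have hull: "convex_cone hull S \<subseteq> K"
    by (rule hull_minimal)
  have "\<exists>p\<in>convex hull P. q - p \<in> convex_cone hull S"
  proof (rule farkas_convex_hull[OF P \<open>finite S\<close>])
    fix u assume u: "\<And>s. s \<in> S \<Longrightarrow> 0 \<le> u \<bullet> s"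
    have pos: "0 \<le> u $ j" for j
      using u[of "axis j 1"] by (auto simp: S_def inner_axis)
    have neg: "u $ j = 0" if "j \<in> U" for j
      using u[of "- axis j 1"] pos[of j] that by (auto simp: S_def inner_axis)
    have le: "u \<bullet> w \<le> u \<bullet> w'" if "w \<in> B" "w' \<in> G" for w w'
    proof -
      have "w' - w \<in> S"
        using that unfolding S_def by auto
      then show ?thesis
        using u by (fastforce simp: inner_diff_right)
    qed
    show "\<exists>p\<in>P. u \<bullet> p \<le> u \<bullet> q"
      by (rule v[OF pos neg le])
  qed
  then obtain p where p: "p \<in> convex hull P" "q - p \<in> K"
    using hull by blast
  obtain \<pi> where \<pi>: "\<forall>x\<in>P. 0 \<le> \<pi> x" "sum \<pi> P = 1" "(\<Sum>x\<in>P. \<pi> x *\<^sub>R x) = p"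
    using p(1) unfolding convex_hull_finite[OF P(1)] by blast
  obtain \<delta> y where d: "q - p = (\<Sum>w\<in>G. \<delta> w *\<^sub>R w) + y" "sum \<delta> G = 0" "\<forall>w\<in>G - B. 0 \<le> \<delta> w" "\<forall>j. j \<notin> U \<longrightarrow> 0 \<le> y $ j"
    using p(2) unfolding K_def by blast
  have "q = (\<Sum>p\<in>P. \<pi> p *\<^sub>R p) + (\<Sum>w\<in>G. \<delta> w *\<^sub>R w) + y"
    using d(1) \<pi>(3) by (simp add: algebra_simps)
  then show ?thesis
    using \<pi>(1,2) d(2-4) by blast
qed

text \<open>Superposes the exchanges of the single elements of \<open>Q\<close> with weights
  \<open>n\<close>. Each lowers coefficients only on \<open>B\<close> and \<open>U\<close>, by at
  most \<open>R\<close>; so reserves of \<open>R * sum n Q\<close> there keep everything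
  nonnegative.\<close>

lemma exchange:
  fixes P Q G B :: "(real ^ 'n) set" and U :: "'n set"
  assumes P: "finite P" "P \<noteq> {}" and Q: "finite Q" and G: "finite G" and B: "B \<subseteq> G"
    and v: "\<And>v q. q \<in> Q \<Longrightarrow> (\<And>j. 0 \<le> v $ j) \<Longrightarrow> (\<And>j. j \<in> U \<Longrightarrow> v $ j = 0) \<Longrightarrow>
      (\<And>w w'. w \<in> B \<Longrightarrow> w' \<in> G \<Longrightarrow> v \<bullet> w \<le> v \<bullet> w') \<Longrightarrow> \<exists>p\<in>P. v \<bullet> p \<le> v \<bullet> q"
  shows "\<exists>R\<ge>0. \<forall>n l u. (\<forall>q\<in>Q. 0 \<le> n q) \<longrightarrow> (\<forall>w\<in>G. 0 \<le> l w) \<longrightarrow> (\<forall>j. 0 \<le> u $ j) \<longrightarrow>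
    (\<forall>w\<in>B. R * sum n Q \<le> l w) \<longrightarrow> (\<forall>j\<in>U. R * sum n Q \<le> u $ j) \<longrightarrow>
    (\<exists>\<pi> l' u'. (\<forall>p\<in>P. 0 \<le> \<pi> p) \<and> sum \<pi> P = sum n Q \<and> (\<forall>w\<in>G. 0 \<le> l' w) \<and> sum l' G = sum l G \<and>
      (\<forall>j. 0 \<le> u' $ j) \<and> (\<Sum>q\<in>Q. n q *\<^sub>R q) + (\<Sum>w\<in>G. l w *\<^sub>R w) + u =
        (\<Sum>p\<in>P. \<pi> p *\<^sub>R p) + (\<Sum>w\<in>G. l' w *\<^sub>R w) + u')"
proof -
  define E where "E q \<pi> \<delta> y \<longleftrightarrow> (\<forall>p\<in>P. 0 \<le> \<pi> p) \<and> sum \<pi> P = 1 \<and> sum \<delta> G = 0 \<and> (\<forall>w\<in>G - B. 0 \<le> \<delta> w) \<and>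
      (\<forall>j. j \<notin> U \<longrightarrow> 0 \<le> y $ j) \<and> q = (\<Sum>p\<in>P. \<pi> p *\<^sub>R p) + (\<Sum>w\<in>G. \<delta> w *\<^sub>R w) + y"
    for q y :: "real ^ 'n" and \<pi> \<delta>
  have "\<forall>q\<in>Q. \<exists>\<pi> \<delta> y. E q \<pi> \<delta> y"
    unfolding E_def using exchange_single[OF P G B] v by blast
  then obtain \<pi> where "\<forall>q\<in>Q. \<exists>\<delta> y. E q (\<pi> q) \<delta> y"
    by (rule bchoice[THEN exE])
  then obtain \<delta> where "\<forall>q\<in>Q. \<exists>y. E q (\<pi> q) (\<delta> q) y"
    by (rule bchoice[THEN exE])
  then obtain y where "\<forall>q\<in>Q. E q (\<pi> q) (\<delta> q) (y q)"
    by (rule bchoice[THEN exE])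
  then have e: "(\<forall>p\<in>P. 0 \<le> \<pi> q p) \<and> sum (\<pi> q) P = 1 \<and> sum (\<delta> q) G = 0 \<and>
      (\<forall>w\<in>G - B. 0 \<le> \<delta> q w) \<and> (\<forall>j. j \<notin> U \<longrightarrow> 0 \<le> y q $ j) \<and>
      q = (\<Sum>p\<in>P. \<pi> q p *\<^sub>R p) + (\<Sum>w\<in>G. \<delta> q w *\<^sub>R w) + y q" if "q \<in> Q" for q
    using that unfolding E_def by blast
  \<comment> \<open>The sum of the absolute values of all coefficients used in the exchange of
    \<open>q\<close>: a crude bound for every single decrease.\<close>
  define C where "C q = (\<Sum>w\<in>G. \<bar>\<delta> q w\<bar>) + (\<Sum>j\<in>UNIV. \<bar>y q $ j\<bar>)" for q
  define R where "R = sum C Q"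
  have C0: "0 \<le> C q" for q
    unfolding C_def by (intro add_nonneg_nonneg sum_nonneg) auto
  have CR: "C q \<le> R" if "q \<in> Q" for q
    unfolding R_def using that Q C0 by (intro member_le_sum) auto
  have \<delta>R: "- R \<le> \<delta> q w" if "q \<in> Q" "w \<in> G" for q w
  proof -
    have "\<bar>\<delta> q w\<bar> \<le> (\<Sum>w\<in>G. \<bar>\<delta> q w\<bar>)"
      using that G by (intro member_le_sum) auto
    moreover have "0 \<le> (\<Sum>j\<in>UNIV. \<bar>y q $ j\<bar>)"
      by (intro sum_nonneg) auto
    ultimately show ?thesis
      using CR[OF that(1)] unfolding C_def by linarith
  qed
  have yR: "- R \<le> y q $ j" if "q \<in> Q" for q j
  proof -
    have "\<bar>y q $ j\<bar> \<le> (\<Sum>j\<in>UNIV. \<bar>y q $ j\<bar>)"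
      by (intro member_le_sum) auto
    moreover have "0 \<le> (\<Sum>w\<in>G. \<bar>\<delta> q w\<bar>)"
      by (intro sum_nonneg) auto
    ultimately show ?thesis
      using CR[OF that(1)] unfolding C_def by linarith
  qed
  show ?thesis
  proof (rule exI[of _ R], intro conjI allI impI)
    show "0 \<le> R"
      unfolding R_def using C0 by (intro sum_nonneg) auto
    fix n l and u :: "real ^ 'n"
    assume n: "\<forall>q\<in>Q. 0 \<le> n q" and l: "\<forall>w\<in>G. 0 \<le> l w" and u: "\<forall>j. 0 \<le> u $ j"
      and lB: "\<forall>w\<in>B. R * sum n Q \<le> l w" and uU: "\<forall>j\<in>U. R * sum n Q \<le> u $ j"
    define \<pi>' where "\<pi>' p = (\<Sum>q\<in>Q. n q * \<pi> q p)" for p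
    define l' where "l' w = l w + (\<Sum>q\<in>Q. n q * \<delta> q w)" for w
    define u' where "u' = u + (\<Sum>q\<in>Q. n q *\<^sub>R y q)"
    have nR: "- (R * sum n Q) \<le> (\<Sum>q\<in>Q. n q * f q)" if "\<And>q. q \<in> Q \<Longrightarrow> - R \<le> f q" for f
    proof -
      have "(\<Sum>q\<in>Q. n q * - R) \<le> (\<Sum>q\<in>Q. n q * f q)"
        using n that by (intro sum_mono mult_left_mono) auto
      then show ?thesis
        by (simp add: sum_distrib_left sum_negf mult.commute)
    qed
    show "\<exists>\<pi> l' u'. (\<forall>p\<in>P. 0 \<le> \<pi> p) \<and> sum \<pi> P = sum n Q \<and> (\<forall>w\<in>G. 0 \<le> l' w) \<and> sum l' G = sum l G \<and>
      (\<forall>j. 0 \<le> u' $ j) \<and> (\<Sum>q\<in>Q. n q *\<^sub>R q) + (\<Sum>w\<in>G. l w *\<^sub>R w) + u =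
        (\<Sum>p\<in>P. \<pi> p *\<^sub>R p) + (\<Sum>w\<in>G. l' w *\<^sub>R w) + u'"
    proof (rule exI[of _ \<pi>'], rule exI[of _ l'], rule exI[of _ u'], intro conjI ballI allI)
      show "0 \<le> \<pi>' p" if "p \<in> P" for p
        unfolding \<pi>'_def using n e that by (intro sum_nonneg mult_nonneg_nonneg) auto
      have "sum \<pi>' P = (\<Sum>q\<in>Q. n q * sum (\<pi> q) P)"
        unfolding \<pi>'_def by (subst sum.swap) (simp add: sum_distrib_left)
      also have "\<dots> = sum n Q"
        using e by (intro sum.cong) auto
      finally show "sum \<pi>' P = sum n Q" .
      show "0 \<le> l' w" if w: "w \<in> G" for w
      proof (cases "w \<in> B")
        case True
        then show ?thesis
          using lB nR[of "\<lambda>q. \<delta> q w"] \<delta>R w unfolding l'_def by force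
      next
        case False
        then have "0 \<le> (\<Sum>q\<in>Q. n q * \<delta> q w)"
          using n e w by (intro sum_nonneg mult_nonneg_nonneg) auto
        then show ?thesis
          using l w unfolding l'_def by simp
      qed
      have "(\<Sum>w\<in>G. \<Sum>q\<in>Q. n q * \<delta> q w) = (\<Sum>q\<in>Q. n q * sum (\<delta> q) G)"
        by (subst sum.swap) (simp add: sum_distrib_left)
      also have "\<dots> = 0"
        using e by (intro sum.neutral) auto
      finally show "sum l' G = sum l G"
        unfolding l'_def sum.distrib by simp
      show "0 \<le> u' $ j" for j
      proof (cases "j \<in> U")
        case True
        then show ?thesis
          using uU nR[of "\<lambda>q. y q $ j"] yR unfolding u'_def by (force simp: sum_component)
      next
        case False
        then have "0 \<le> (\<Sum>q\<in>Q. n q * y q $ j)"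
          using n e by (intro sum_nonneg mult_nonneg_nonneg) auto
        then show ?thesis
          using u unfolding u'_def by (simp add: sum_component)
      qed
      have "(\<Sum>q\<in>Q. n q *\<^sub>R q) = (\<Sum>q\<in>Q. n q *\<^sub>R ((\<Sum>p\<in>P. \<pi> q p *\<^sub>R p) + (\<Sum>w\<in>G. \<delta> q w *\<^sub>R w) + y q))"
        using e by (intro sum.cong) auto
      also have "\<dots> = (\<Sum>q\<in>Q. \<Sum>p\<in>P. (n q * \<pi> q p) *\<^sub>R p) + (\<Sum>q\<in>Q. \<Sum>w\<in>G. (n q * \<delta> q w) *\<^sub>R w) + (\<Sum>q\<in>Q. n q *\<^sub>R y q)"
        by (simp add: scaleR_right_distrib sum.distrib scaleR_sum_right)
      also have "(\<Sum>q\<in>Q. \<Sum>p\<in>P. (n q * \<pi> q p) *\<^sub>R p) = (\<Sum>p\<in>P. \<pi>' p *\<^sub>R p)"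
        unfolding \<pi>'_def by (subst sum.swap) (simp add: scaleR_sum_left)
      also have "(\<Sum>q\<in>Q. \<Sum>w\<in>G. (n q * \<delta> q w) *\<^sub>R w) = (\<Sum>w\<in>G. (\<Sum>q\<in>Q. n q * \<delta> q w) *\<^sub>R w)"
        by (subst sum.swap) (simp add: scaleR_sum_left)
      finally show "(\<Sum>q\<in>Q. n q *\<^sub>R q) + (\<Sum>w\<in>G. l w *\<^sub>R w) + u =
        (\<Sum>p\<in>P. \<pi>' p *\<^sub>R p) + (\<Sum>w\<in>G. l' w *\<^sub>R w) + u'"
        unfolding l'_def u'_def by (simp add: scaleR_left_distrib sum.distrib)
    qed
  qed
qed

section \<open>Counting lattice points\<close>

text \<open>Round all weights down and put the lost total, at most \<open>card P\<close>, on
  \<open>p0\<close>. The excess is at most \<open>card P\<close> copies of \<open>p0\<close>,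
  independently of \<open>a\<close>.\<close>

lemma integral_rounding:
  fixes P :: "(nat ^ 'n) set"
  assumes P: "finite P" "p0 \<in> P" and \<pi>: "\<And>p. p \<in> P \<Longrightarrow> 0 \<le> \<pi> p" "sum \<pi> P = real a"
  shows "\<exists>f. sum f P = a \<and> (\<forall>j. real ((\<Sum>p\<in>P. f p *s p) $ j) \<le>
    (\<Sum>p\<in>P. \<pi> p *\<^sub>R real_vec p) $ j + real (card P * p0 $ j))"
proof -
  define f where "f p = nat \<lfloor>\<pi> p\<rfloor>" for p
  have f: "real (f p) \<le> \<pi> p" "\<pi> p \<le> real (f p) + 1" if "p \<in> P" for p
    using \<pi>(1)[OF that] unfolding f_def by linarith+
  have "real (sum f P) \<le> real a"
    unfolding of_nat_sum \<pi>(2)[symmetric] using f(1) by (rule sum_mono)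
  then have fa: "sum f P \<le> a"
    by (simp only: of_nat_le_iff)
  have "real a \<le> (\<Sum>p\<in>P. real (f p) + 1)"
    unfolding \<pi>(2)[symmetric] using f(2) by (rule sum_mono)
  also have "\<dots> = real (sum f P + card P)"
    by (simp add: sum.distrib)
  finally have k: "a - sum f P \<le> card P"
    by linarith
  define f' where "f' p = f p + (if p = p0 then a - sum f P else 0)" for p
  have "sum f' P = a"
    using fa P unfolding f'_def by (simp add: sum.distrib)
  moreover have "real ((\<Sum>p\<in>P. f' p *s p) $ j) \<le>
      (\<Sum>p\<in>P. \<pi> p *\<^sub>R real_vec p) $ j + real (card P * p0 $ j)" for j
  proof -
    have "(\<Sum>p\<in>P. f' p *s p) $ j = (\<Sum>p\<in>P. f p * p $ j + (if p = p0 then (a - sum f P) * p0 $ j else 0))"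
      unfolding sum_component by (intro sum.cong) (auto simp: f'_def algebra_simps)
    also have "\<dots> = (\<Sum>p\<in>P. f p * p $ j) + (a - sum f P) * p0 $ j"
      using P by (simp add: sum.distrib)
    finally have "real ((\<Sum>p\<in>P. f' p *s p) $ j) = (\<Sum>p\<in>P. real (f p) * real (p $ j)) + real ((a - sum f P) * p0 $ j)"
      by simp
    also have "\<dots> \<le> (\<Sum>p\<in>P. \<pi> p * real (p $ j)) + real (card P * p0 $ j)"
      using f(1) k by (intro add_mono sum_mono mult_right_mono) (auto simp del: of_nat_mult intro!: of_nat_mono mult_le_mono1)
    finally show ?thesis
      by (simp add: sum_component real_vec_nth)
  qed
  ultimately show ?thesis by blast
qed

lemma set_power_mem:
  fixes G :: "(nat ^ 'n::finite) set"
  assumes "finite G"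
  shows "(\<Sum>g\<in>G. f g *s g) + m \<in> set_power (upward G) (sum f G)"
  unfolding set_power_upward_iff[OF assms] by (intro exI[of _ f]) (simp add: less_eq_vec_def)

text \<open>Passing from real to integral weights costs a translation independent of
  \<open>a\<close> and \<open>b\<close>. This fixed vector is the thickness of the boundary layer in
  \<open>card_exchange_defect\<close>.\<close>

lemma set_powers_rounding:
  fixes P G :: "(nat ^ 'n::finite) set" and u :: "real ^ 'n"
  assumes P: "finite P" "p0 \<in> P" and G: "finite G" "g0 \<in> G"
    and \<pi>: "\<And>p. p \<in> P \<Longrightarrow> 0 \<le> \<pi> p" "sum \<pi> P = real a"
    and l: "\<And>w. w \<in> G \<Longrightarrow> 0 \<le> l w" "sum l G = real b"
    and u: "\<And>j. 0 \<le> u $ j"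
    and x: "real_vec x = (\<Sum>p\<in>P. \<pi> p *\<^sub>R real_vec p) + (\<Sum>w\<in>G. l w *\<^sub>R real_vec w) + u"
  shows "x + (card P *s p0 + card G *s g0) \<in> set_power (upward P) a + set_power (upward G) b"
proof -
  obtain f where f: "sum f P = a" "\<And>j. real ((\<Sum>p\<in>P. f p *s p) $ j) \<le>
      (\<Sum>p\<in>P. \<pi> p *\<^sub>R real_vec p) $ j + real (card P * p0 $ j)"
    using integral_rounding[OF P \<pi>] by blast
  obtain h where h: "sum h G = b" "\<And>j. real ((\<Sum>w\<in>G. h w *s w) $ j) \<le>
      (\<Sum>w\<in>G. l w *\<^sub>R real_vec w) $ j + real (card G * g0 $ j)"
    using integral_rounding[OF G l] by blast
  have "(\<Sum>p\<in>P. f p *s p) + (\<Sum>w\<in>G. h w *s w) \<le> x + (card P *s p0 + card G *s g0)"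
    unfolding less_eq_vec_def
  proof
    fix j
    have "real (x $ j) = (\<Sum>p\<in>P. \<pi> p *\<^sub>R real_vec p) $ j + (\<Sum>w\<in>G. l w *\<^sub>R real_vec w) $ j + u $ j"
      using arg_cong[OF x, of "\<lambda>v. v $ j"] by (simp add: real_vec_nth)
    then have "real (((\<Sum>p\<in>P. f p *s p) + (\<Sum>w\<in>G. h w *s w)) $ j) \<le> real ((x + (card P *s p0 + card G *s g0)) $ j)"
      using f(2)[of j] h(2)[of j] u[of j] by (simp del: sum_component)
    then show "((\<Sum>p\<in>P. f p *s p) + (\<Sum>w\<in>G. h w *s w)) $ j \<le> (x + (card P *s p0 + card G *s g0)) $ j"
      by (simp only: of_nat_le_iff)
  qed
  then obtain m where m: "x + (card P *s p0 + card G *s g0) = (\<Sum>p\<in>P. f p *s p) + (\<Sum>w\<in>G. h w *s w) + m"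
    unfolding nat_vec_le_iff_add by blast
  show ?thesis
    unfolding m add.assoc using set_power_mem[OF P(1), of f 0] set_power_mem[OF G(1), of h m] f(1) h(1)
    by (intro set_plus_intro) auto
qed

lemma card_le_fibres:
  assumes "finite Z" "finite Y" "f ` Z \<subseteq> Y" "\<And>z. z \<in> Z \<Longrightarrow> card {x\<in>Z. f x = f z} \<le> D"
  shows "card Z \<le> card Y * D"
proof -
  have "Z = (\<Union>y\<in>f ` Z. {x\<in>Z. f x = y})"
    by auto
  then have "card Z \<le> (\<Sum>y\<in>f ` Z. card {x\<in>Z. f x = y})"
    using card_UN_le[of "f ` Z" "\<lambda>y. {x\<in>Z. f x = y}"] assms(1) by simp
  also have "\<dots> \<le> (\<Sum>y\<in>f ` Z. D)"
    using assms(4) by (intro sum_mono) auto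
  also have "\<dots> \<le> card Y * D"
    using card_mono[OF assms(2,3)] by simp
  finally show ?thesis .
qed

text \<open>Each line in the direction of \<open>(1, \<dots>, 1)\<close> contains at most \<open>D\<close> of these points.\<close>

lemma card_boundary_layer:
  fixes A :: "(nat ^ 'n::finite) set" and W :: "nat ^ 'n"
  assumes up: "upward A = A" and M: "\<And>x :: nat ^ 'n. \<And>j. x \<notin> A \<Longrightarrow> x $ j \<le> M" and W: "\<And>j. W $ j \<le> D"
  shows "card {x. x \<notin> A \<and> x + W \<in> A} \<le> (2 * M + 1) ^ (CARD('n) - 1) * D"
proof -
  let ?Z = "{x. x \<notin> A \<and> x + W \<in> A}"
  obtain i :: 'n where True by blast
  \<comment> \<open>Two points have the same \<open>f\<close> iff they differ by an integral
    multiple of (1, ..., 1).\<close>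
  define f where "f x = (\<lambda>j\<in>UNIV - {i}. int (x $ j) - int (x $ i))" for x :: "nat ^ 'n"
  define Y where "Y = PiE (UNIV - {i}) (\<lambda>_. {- int M .. int M})"
  have fin: "finite ?Z"
  proof (rule finite_subset)
    show "?Z \<subseteq> {x. total_degree x \<le> CARD('n) * M}"
    proof
      fix x assume "x \<in> ?Z"
      then have "total_degree x \<le> (\<Sum>j\<in>(UNIV :: 'n set). M)"
        unfolding total_degree_def using M by (intro sum_mono) auto
      then show "x \<in> {x. total_degree x \<le> CARD('n) * M}" by simp
    qed
  qed (rule finite_total_degree_le)
  have "card ?Z \<le> card Y * D"
  proof (rule card_le_fibres[OF fin])
    show "finite Y"
      unfolding Y_def by (intro finite_PiE) auto
    show "f ` ?Z \<subseteq> Y"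
    proof
      fix y assume "y \<in> f ` ?Z"
      then obtain x where "x \<notin> A" "y = f x" by blast
      then show "y \<in> Y"
      proof -
        have "int (x $ j) - int (x $ i) \<in> {- int M .. int M}" for j
          using M[OF \<open>x \<notin> A\<close>, of j] M[OF \<open>x \<notin> A\<close>, of i] by simp
        then show ?thesis
          unfolding \<open>y = f x\<close> f_def Y_def by (simp only: PiE_iff restrict_apply extensional_restrict) (auto simp: extensional_def)
      qed
    qed
    fix z assume z: "z \<in> ?Z"
    let ?F = "{x \<in> ?Z. f x = f z}"
    have shift: "int (x $ j) - int (y $ j) = int (x $ i) - int (y $ i)" if "x \<in> ?F" "y \<in> ?F" for x y j
    proof (cases "j = i")
      case False
      have "f x j = f y j" using that by simp
      then show ?thesis using False by (simp add: f_def)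
    qed simp
    \<comment> \<open>If \<open>x\<close> were at least \<open>D\<close> steps beyond
      \<open>y\<close> on their line, it would dominate \<open>y + W\<close> and lie in the up-set
      \<open>A\<close>.\<close>
    have close: "x $ i < y $ i + D" if xy: "x \<in> ?F" "y \<in> ?F" for x y
    proof (rule ccontr)
      assume "\<not> x $ i < y $ i + D"
      have "y + W \<le> x"
        unfolding less_eq_vec_def
      proof
        fix j show "(y + W) $ j \<le> x $ j"
          using shift[OF xy, of j] W[of j] \<open>\<not> x $ i < y $ i + D\<close>
          by (simp only: vector_add_component)
      qed
      then have "x \<in> A"
        using xy(2) up unfolding upward_def by blast
      then show False
        using xy(1) by blast
    qed
    have inj: "inj_on (\<lambda>x. x $ i) ?F"
    proof (rule inj_onI)
      fix x y assume "x \<in> ?F" "y \<in> ?F" "x $ i = y $ i"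
      then show "x = y"
        using shift[of x y] by (simp add: vec_eq_iff)
    qed
    have finF: "finite ?F"
      by (rule finite_subset[OF _ fin]) auto
    define mn where "mn = Min ((\<lambda>x. x $ i) ` ?F)"
    have "mn \<in> (\<lambda>x. x $ i) ` ?F"
      unfolding mn_def using finF z by (intro Min_in) auto
    then obtain y where y: "y \<in> ?F" "y $ i = mn" by blast
    have "(\<lambda>x. x $ i) ` ?F \<subseteq> {mn..<mn + D}"
    proof
      fix t assume "t \<in> (\<lambda>x. x $ i) ` ?F"
      then obtain x where x: "x \<in> ?F" "t = x $ i" by blast
      have "mn \<le> t"
        unfolding mn_def x(2) using finF x(1) by (intro Min_le) auto
      then show "t \<in> {mn..<mn + D}"
        using close[OF x(1) y(1)] y(2) x(2) by simp
    qed
    then have "card ((\<lambda>x. x $ i) ` ?F) \<le> card {mn..<mn + D}"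
      by (intro card_mono) auto
    then show "card ?F \<le> D"
      using card_image[OF inj] by simp
  qed
  also have "card Y = (2 * M + 1) ^ (CARD('n) - 1)"
    unfolding Y_def by (simp add: card_PiE card_Diff_singleton nat_add_distrib nat_mult_distrib)
  finally show ?thesis .
qed

lemma card_nat_vec_box:
  fixes F :: "(nat ^ 'n::finite) set"
  assumes z: "z \<in> F" and r: "\<And>x y :: nat ^ 'n. \<And>j. x \<in> F \<Longrightarrow> y \<in> F \<Longrightarrow> \<bar>real (x $ j) - real (y $ j)\<bar> \<le> real r"
  shows "card F \<le> (2 * r + 1) ^ CARD('n)"
proof -
  have "card F \<le> card (vec_lambda ` (PiE UNIV (\<lambda>j. {z $ j - r .. z $ j + r})) :: (nat ^ 'n) set)"
  proof (rule card_mono)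
    show "F \<subseteq> vec_lambda ` (PiE UNIV (\<lambda>j. {z $ j - r .. z $ j + r}))"
    proof
      fix x assume x: "x \<in> F"
      have "z $ j - r \<le> x $ j \<and> x $ j \<le> z $ j + r" for j
        using r[OF x z, of j] by linarith
      then show "x \<in> vec_lambda ` (PiE UNIV (\<lambda>j. {z $ j - r .. z $ j + r}))"
        by (intro image_eqI[of _ _ "vec_nth x"]) auto
    qed
  qed (intro finite_imageI finite_PiE, auto)
  also have "\<dots> \<le> card (PiE UNIV (\<lambda>j. {z $ j - r .. z $ j + r}))"
    by (intro card_image_le finite_PiE) auto
  also have "\<dots> = (\<Prod>j\<in>(UNIV :: 'n set). card {z $ j - r .. z $ j + r})"
    by (simp add: card_PiE)
  also have "\<dots> \<le> (\<Prod>j\<in>(UNIV :: 'n set). 2 * r + 1)"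
    by (intro prod_mono) auto
  also have "\<dots> = (2 * r + 1) ^ CARD('n)"
    by simp
  finally show ?thesis .
qed

text \<open>Cells of side \<open>a\<close> with respect to an orthonormal basis of \<open>V\<close>:
  of the order of \<open>m^d\<close> of them are met, and each contains at most a multiple of
  \<open>a^n\<close> lattice points.\<close>

lemma card_near_subspace:
  fixes V :: "(real ^ 'n::finite) set" and Z :: "(nat ^ 'n) set"
  assumes V: "subspace V" "dim V \<le> d" and Z: "finite Z" and m: "1 \<le> m" "1 \<le> a"
    and near: "\<And>x. x \<in> Z \<Longrightarrow> \<exists>v\<in>V. norm v \<le> real (C * m * a) \<and> norm (real_vec x - z0 - v) \<le> real (C * a)"
  shows "card Z \<le> ((4 * C + 3) * m) ^ d * ((2 * (2 * C + CARD('n) * (2 * C + 1)) + 1) * a) ^ CARD('n)"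
proof -
  obtain E where E: "E \<subseteq> V" "pairwise orthogonal E" "\<And>e. e \<in> E \<Longrightarrow> norm e = 1" "independent E" "card E = dim V" "span E = V"
    using orthonormal_basis_subspace[OF V(1)] by blast
  have finE: "finite E"
    using E(4) independent_imp_finite by blast
  have cardE: "card E \<le> CARD('n)"
    unfolding E(5) using dim_subset_UNIV[of V] by simp
  have expand: "v = (\<Sum>e\<in>E. (v \<bullet> e) *\<^sub>R e)" if "v \<in> V" for v
  proof -
    have "v \<in> span E" using that E(6) by simp
    then obtain c where c: "v = (\<Sum>e\<in>E. c e *\<^sub>R e)"
      unfolding span_finite[OF finE] by blast
    have "v \<bullet> f = c f" if "f \<in> E" for f
    proof -
      have "v \<bullet> f = (\<Sum>e\<in>E. if e = f then c f else 0)"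
        unfolding c inner_sum_left
      proof (intro sum.cong refl)
        fix e assume "e \<in> E"
        show "(c e *\<^sub>R e) \<bullet> f = (if e = f then c f else 0)"
        proof (cases "e = f")
          case True
          then show ?thesis
            using E(3)[OF that] by (simp add: dot_square_norm)
        next
          case False
          then have "e \<bullet> f = 0"
            using E(2) \<open>e \<in> E\<close> that by (auto simp: pairwise_def orthogonal_def)
          then show ?thesis using False by simp
        qed
      qed
      then show ?thesis using finE that by simp
    qed
    then show ?thesis
      by (subst c) (auto intro!: sum.cong)
  qed
  \<comment> \<open>The cell of \<open>x\<close>: its coordinates along \<open>E\<close> from the
    base point \<open>z0\<close>, in units of \<open>a\<close>.\<close>
  define \<kappa> where "\<kappa> x = (\<lambda>e\<in>E. \<lfloor>((real_vec x - z0) \<bullet> e) / real a\<rfloor>)" for x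
  define N where "N = 2 * C * m + 1"
  define Y where "Y = PiE E (\<lambda>_. {- int N .. int N})"
  \<comment> \<open>Within a cell, \<open>v - w\<close> has at most \<open>n\<close> coordinates
    along \<open>E\<close>, each bounded by \<open>(2 * C + 1) * a\<close>; the two distances to the
    shifted subspace contribute \<open>2 * C * a\<close>.\<close>
  define r where "r = (2 * C + CARD('n) * (2 * C + 1)) * a"
  have "card Z \<le> card Y * (2 * r + 1) ^ CARD('n)"
  proof (rule card_le_fibres[OF Z])
    show "finite Y"
      unfolding Y_def using finE by (intro finite_PiE) auto
    show "\<kappa> ` Z \<subseteq> Y"
    proof
      fix y assume "y \<in> \<kappa> ` Z"
      then obtain x where x: "x \<in> Z" "y = \<kappa> x" by blast
      obtain v where v: "v \<in> V" "norm v \<le> real (C * m * a)" "norm (real_vec x - z0 - v) \<le> real (C * a)"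
        using near[OF x(1)] by blast
      have "norm (real_vec x - z0) \<le> norm v + norm (real_vec x - z0 - v)"
        using norm_triangle_ineq[of v "real_vec x - z0 - v"] by simp
      also have "\<dots> \<le> real (C * m * a) + real (C * a)"
        using v by linarith
      also have "\<dots> \<le> real (2 * C * m * a)"
      proof -
        have "C * 1 * a \<le> C * m * a"
          using m(1) by (intro mult_le_mono order_refl)
        then have "C * m * a + C * a \<le> 2 * C * m * a" by simp
        then show ?thesis
          unfolding of_nat_add[symmetric] of_nat_le_iff .
      qed
      finally have nb: "norm (real_vec x - z0) \<le> real (2 * C * m) * real a"
        by simp
      have "- int N \<le> \<lfloor>((real_vec x - z0) \<bullet> e) / real a\<rfloor> \<and> \<lfloor>((real_vec x - z0) \<bullet> e) / real a\<rfloor> \<le> int N" if "e \<in> E" for e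
      proof -
        have "\<bar>(real_vec x - z0) \<bullet> e\<bar> \<le> norm (real_vec x - z0) * norm e"
          by (rule Cauchy_Schwarz_ineq2)
        also have "\<dots> \<le> real (2 * C * m) * real a"
          using nb E(3)[OF that] by simp
        finally have "\<bar>(real_vec x - z0) \<bullet> e / real a\<bar> \<le> real (2 * C * m)"
          using m(2) by (simp add: abs_divide divide_le_eq)
        then show ?thesis
          unfolding N_def by linarith
      qed
      then show "y \<in> Y"
        unfolding x(2) \<kappa>_def Y_def by auto
    qed
    fix z assume z: "z \<in> Z"
    show "card {x \<in> Z. \<kappa> x = \<kappa> z} \<le> (2 * r + 1) ^ CARD('n)"
    proof (rule card_nat_vec_box)
      show "z \<in> {x \<in> Z. \<kappa> x = \<kappa> z}" using z by simp
      fix x y j assume xy: "x \<in> {x \<in> Z. \<kappa> x = \<kappa> z}" "y \<in> {x \<in> Z. \<kappa> x = \<kappa> z}"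
      obtain v where v: "v \<in> V" "norm (real_vec x - z0 - v) \<le> real (C * a)"
        using near[of x] xy(1) by blast
      obtain w where w: "w \<in> V" "norm (real_vec y - z0 - w) \<le> real (C * a)"
        using near[of y] xy(2) by blast
      have vw: "v - w \<in> V"
        using V(1) v(1) w(1) by (rule subspace_diff)
      have bd: "\<bar>(v - w) \<bullet> e\<bar> \<le> real ((2 * C + 1) * a)" if e: "e \<in> E" for e
      proof -
        have "\<kappa> x e = \<kappa> y e" using xy by simp
        then have "\<lfloor>((real_vec x - z0) \<bullet> e) / real a\<rfloor> = \<lfloor>((real_vec y - z0) \<bullet> e) / real a\<rfloor>"
          using e by (simp add: \<kappa>_def)
        then have "\<bar>((real_vec x - z0) \<bullet> e) / real a - ((real_vec y - z0) \<bullet> e) / real a\<bar> \<le> 1"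
          by linarith
        then have d: "\<bar>(real_vec x - z0) \<bullet> e - (real_vec y - z0) \<bullet> e\<bar> \<le> real a"
          using m(2) by (simp add: diff_divide_distrib[symmetric] abs_divide divide_le_eq)
        have e1: "\<bar>(real_vec x - z0 - v) \<bullet> e\<bar> \<le> real (C * a)" "\<bar>(real_vec y - z0 - w) \<bullet> e\<bar> \<le> real (C * a)"
          using Cauchy_Schwarz_ineq2[of "real_vec x - z0 - v" e] Cauchy_Schwarz_ineq2[of "real_vec y - z0 - w" e]
            E(3)[OF e] v(2) w(2) by simp_all
        have "(v - w) \<bullet> e = ((real_vec x - z0) \<bullet> e - (real_vec y - z0) \<bullet> e) - (real_vec x - z0 - v) \<bullet> e + (real_vec y - z0 - w) \<bullet> e"
          by (simp add: inner_diff_left)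
        then have "\<bar>(v - w) \<bullet> e\<bar> \<le> real a + real (C * a) + real (C * a)"
          using d e1 by linarith
        then show ?thesis by (simp add: algebra_simps)
      qed
      have "norm (v - w) \<le> (\<Sum>e\<in>E. norm (((v - w) \<bullet> e) *\<^sub>R e))"
        by (subst expand[OF vw]) (rule norm_sum)
      also have "\<dots> \<le> (\<Sum>e\<in>E. real ((2 * C + 1) * a))"
        using bd E(3) by (intro sum_mono) auto
      also have "\<dots> = real (card E) * real ((2 * C + 1) * a)"
        by simp
      also have "\<dots> \<le> real CARD('n) * real ((2 * C + 1) * a)"
        using cardE by (intro mult_right_mono) auto
      finally have nvw: "norm (v - w) \<le> real CARD('n) * real ((2 * C + 1) * a)" .
      have eq: "real_vec x - real_vec y = (v - w) + ((real_vec x - z0 - v) - (real_vec y - z0 - w))"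
        by simp
      have "norm (real_vec x - real_vec y) \<le> norm (v - w) + (norm (real_vec x - z0 - v) + norm (real_vec y - z0 - w))"
        unfolding eq
        using norm_triangle_ineq[of "v - w" "(real_vec x - z0 - v) - (real_vec y - z0 - w)"]
          norm_triangle_ineq4[of "real_vec x - z0 - v" "real_vec y - z0 - w"] by linarith
      also have "\<dots> \<le> real r"
        using nvw v(2) w(2) unfolding r_def by (simp add: algebra_simps)
      finally have "norm (real_vec x - real_vec y) \<le> real r" .
      then show "\<bar>real (x $ j) - real (y $ j)\<bar> \<le> real r"
        using component_le_norm_cart[of "real_vec x - real_vec y" j] by (simp add: real_vec_nth)
    qed
  qed
  also have "card Y = (2 * N + 1) ^ card E"
    unfolding Y_def using finE by (simp add: card_PiE nat_add_distrib nat_mult_distrib)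
  also have "(2 * N + 1) ^ card E \<le> ((4 * C + 3) * m) ^ d"
  proof -
    have "(2 * N + 1) ^ card E \<le> (2 * N + 1) ^ d"
      using V(2) E(5) by (intro power_increasing) auto
    also have "\<dots> \<le> ((4 * C + 3) * m) ^ d"
      using m(1) unfolding N_def by (intro power_mono) (simp_all add: algebra_simps)
    finally show ?thesis .
  qed
  also have "(2 * r + 1) ^ CARD('n) \<le> ((2 * (2 * C + CARD('n) * (2 * C + 1)) + 1) * a) ^ CARD('n)"
    using m(2) unfolding r_def by (intro power_mono) (simp_all add: algebra_simps)
  finally show ?thesis
    by (simp add: mult_le_mono)
qed

text \<open>In a representation of a point by generators, \<open>B\<close> and \<open>U\<close> below collect the generators in \<open>G\<close>
  and the coordinate directions with coefficient at least a fixed multiple of \<open>a\<close>. If they span a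
  face of dimension greater than \<open>d\<close>, an exchange applies; otherwise the point is near \<open>b\<close> times a
  polytope of dimension at most \<open>d\<close>.\<close>

theorem card_exchange_defect:
  fixes P Q G :: "(nat ^ 'n::finite) set"
  assumes fin: "finite P" "finite Q" "finite G"
    and axis: "\<And>j. \<exists>c. axis j c \<in> P" "\<And>j. \<exists>c. axis j c \<in> G"
    and H: "\<And>(v :: real ^ 'n) q. (\<And>j. 0 < v $ j) \<Longrightarrow>
      int d < aff_dim {w \<in> real_vec ` G. \<forall>w'\<in>real_vec ` G. v \<bullet> w \<le> v \<bullet> w'} \<Longrightarrow> q \<in> Q \<Longrightarrow>
      \<exists>p\<in>P. v \<bullet> real_vec p \<le> v \<bullet> real_vec q"
  shows "\<exists>C. \<forall>m a b. 1 \<le> m \<longrightarrow> 1 \<le> a \<longrightarrow> b \<le> m * a \<longrightarrow>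
    card ((set_power (upward Q) a + set_power (upward G) b) - (set_power (upward P) a + set_power (upward G) b)) \<le>
      C * (m ^ d * a ^ CARD('n) + (a + b) ^ (CARD('n) - 1))"
proof -
  obtain p0 g0 where p0: "p0 \<in> P" and g0: "g0 \<in> G"
    using axis by blast
  let ?P = "real_vec ` P" and ?Q = "real_vec ` Q" and ?G = "real_vec ` G"
  have inj: "inj_on real_vec Z" for Z :: "(nat ^ 'n) set"
    using inj_real_vec inj_on_subset by blast
  define iv :: "real ^ 'n \<Rightarrow> nat ^ 'n" where "iv = inv_into UNIV real_vec"
  have iv: "iv (real_vec x) = x" for x
    unfolding iv_def by (rule inv_f_f[OF inj_real_vec])
  \<comment> \<open>A direction \<open>j\<close> in \<open>U\<close> forces
    \<open>v $ j = 0\<close>, where a pure power in \<open>P\<close> makes the exchange possible;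
    otherwise \<open>B\<close> must span a face of dimension above \<open>d\<close>.\<close>
  define good where "good B U \<longleftrightarrow> U \<noteq> {} \<or> int d < aff_dim B" for B :: "(real ^ 'n) set" and U :: "'n set"
  define exch where "exch R B U \<longleftrightarrow> 0 \<le> R \<and> (\<forall>n l u. (\<forall>q\<in>?Q. 0 \<le> n q) \<longrightarrow> (\<forall>w\<in>?G. 0 \<le> l w) \<longrightarrow> (\<forall>j. 0 \<le> u $ j) \<longrightarrow>
    (\<forall>w\<in>B. R * sum n ?Q \<le> l w) \<longrightarrow> (\<forall>j\<in>U. R * sum n ?Q \<le> u $ j) \<longrightarrow>
    (\<exists>\<pi> l' u'. (\<forall>p\<in>?P. 0 \<le> \<pi> p) \<and> sum \<pi> ?P = sum n ?Q \<and> (\<forall>w\<in>?G. 0 \<le> l' w) \<and> sum l' ?G = sum l ?G \<and>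
      (\<forall>j. 0 \<le> u' $ j) \<and> (\<Sum>q\<in>?Q. n q *\<^sub>R q) + (\<Sum>w\<in>?G. l w *\<^sub>R w) + u =
        (\<Sum>p\<in>?P. \<pi> p *\<^sub>R p) + (\<Sum>w\<in>?G. l' w *\<^sub>R w) + u'))"
    for R :: real and B :: "(real ^ 'n) set" and U :: "'n set"
  have ex_R: "\<exists>R. exch R B U" if "B \<subseteq> ?G" "good B U" for B U
  proof -
    have cond: "\<exists>p\<in>?P. v \<bullet> p \<le> v \<bullet> q"
      if q: "q \<in> ?Q" and v: "\<And>j. 0 \<le> v $ j" "\<And>j. j \<in> U \<Longrightarrow> v $ j = 0"
        "\<And>w w'. w \<in> B \<Longrightarrow> w' \<in> ?G \<Longrightarrow> v \<bullet> w \<le> v \<bullet> w'" for v q :: "real ^ 'n"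
    proof (cases "\<forall>j. 0 < v $ j")
      case True
      then have "U = {}"
        using v(2) by (metis equals0I less_irrefl)
      then have "int d < aff_dim B"
        using \<open>good B U\<close> by (simp add: good_def)
      also have "aff_dim B \<le> aff_dim {w \<in> ?G. \<forall>w'\<in>?G. v \<bullet> w \<le> v \<bullet> w'}"
        using v(3) \<open>B \<subseteq> ?G\<close> by (intro aff_dim_subset) blast
      finally show ?thesis
        using H[of v "iv q"] True q iv by auto
    next
      case False
      then obtain j where "v $ j = 0"
        using v(1) by (metis order_le_less)
      \<comment> \<open>If \<open>v\<close> vanishes at \<open>j\<close>, the pure power of the
        variable \<open>j\<close> in \<open>P\<close> has value 0, at most that of any
        \<open>q\<close>. So \<open>H\<close> is invoked for positive \<open>v\<close> only.\<close>
      moreover obtain c where "axis j c \<in> P"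
        using axis(1) by blast
      moreover have "v \<bullet> real_vec (axis j c) = v $ j * real c"
        unfolding inner_vec_def by (simp add: real_vec_nth axis_def if_distrib if_distribR cong: if_cong)
      moreover have "0 \<le> v \<bullet> q"
        unfolding inner_vec_def using v(1) q by (intro sum_nonneg) (auto simp: real_vec_nth)
      ultimately show ?thesis
        by (intro bexI[of _ "real_vec (axis j c)"]) auto
    qed
    have "\<exists>R\<ge>0. \<forall>n l u. (\<forall>q\<in>?Q. 0 \<le> n q) \<longrightarrow> (\<forall>w\<in>?G. 0 \<le> l w) \<longrightarrow> (\<forall>j. 0 \<le> u $ j) \<longrightarrow>
    (\<forall>w\<in>B. R * sum n ?Q \<le> l w) \<longrightarrow> (\<forall>j\<in>U. R * sum n ?Q \<le> u $ j) \<longrightarrow>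
    (\<exists>\<pi> l' u'. (\<forall>p\<in>?P. 0 \<le> \<pi> p) \<and> sum \<pi> ?P = sum n ?Q \<and> (\<forall>w\<in>?G. 0 \<le> l' w) \<and> sum l' ?G = sum l ?G \<and>
      (\<forall>j. 0 \<le> u' $ j) \<and> (\<Sum>q\<in>?Q. n q *\<^sub>R q) + (\<Sum>w\<in>?G. l w *\<^sub>R w) + u =
        (\<Sum>p\<in>?P. \<pi> p *\<^sub>R p) + (\<Sum>w\<in>?G. l' w *\<^sub>R w) + u')"
      by (rule exchange) (use fin p0 that(1) cond in auto)
    then show ?thesis
      unfolding exch_def .
  qed
  have "\<forall>t\<in>{t \<in> Pow ?G \<times> (UNIV :: 'n set set). good (fst t) (snd t)}. \<exists>R. exch R (fst t) (snd t)"
    using ex_R by auto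
  then obtain R where R: "\<And>B U. B \<subseteq> ?G \<Longrightarrow> good B U \<Longrightarrow> exch (R (B, U)) B U"
    by (drule_tac bchoice) auto
  define T where "T = {t \<in> Pow ?G \<times> (UNIV :: 'n set set). good (fst t) (snd t)}"
  have "finite T"
    unfolding T_def using fin(3) by simp
  \<comment> \<open>One constant for all of the finitely many good pairs; the sum of the nonnegative
    \<open>R t\<close> bounds each of them.\<close>
  define R0 where "R0 = nat \<lceil>\<Sum>t\<in>T. R t\<rceil>"
  have RR0: "R (B, U) \<le> real R0" if "B \<subseteq> ?G" "good B U" for B U
  proof -
    have "R (B, U) \<le> (\<Sum>t\<in>T. R t)"
    proof (rule member_le_sum)
      show "(B, U) \<in> T"
        using that by (simp add: T_def)
      show "0 \<le> R t" if "t \<in> T - {(B, U)}" for t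
        using R[of "fst t" "snd t"] that unfolding T_def exch_def by auto
    qed (rule \<open>finite T\<close>)
    also have "\<dots> \<le> real R0"
      unfolding R0_def by linarith
    finally show ?thesis .
  qed
  \<comment> \<open>A base point of the affine hull of \<open>B\<close>. If \<open>B\<close> is
    empty, all coefficients are small and the origin serves as base point.\<close>
  define w0 where "w0 B = (if B = {} then 0 else (SOME w. w \<in> B))" for B :: "(real ^ 'n) set"
  have w0: "w0 B \<in> B" if "B \<noteq> {}" for B
    unfolding w0_def using that by (simp add: some_in_eq)
  define S where "S = (\<Sum>w\<in>?G. \<Sum>w'\<in>insert 0 ?G. norm (w - w'))"
  have S: "(\<Sum>w\<in>?G. norm (w - w0 B)) \<le> S" "w \<in> ?G \<Longrightarrow> norm (w - w0 B) \<le> S" if "B \<subseteq> ?G" for B w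
  proof -
    have "w0 B \<in> insert 0 ?G"
      using w0[of B] that by (cases "B = {}") (auto simp: w0_def[of "{}"])
    then show *: "(\<Sum>w\<in>?G. norm (w - w0 B)) \<le> S"
      unfolding S_def using fin(3) by (intro sum_mono member_le_sum[of "w0 B"]) auto
    show "norm (w - w0 B) \<le> S" if "w \<in> ?G"
      using that fin(3) by (intro order_trans[OF member_le_sum *]) auto
  qed
  define SQ where "SQ = (\<Sum>q\<in>?Q. norm q)"
  \<comment> \<open>\<open>S\<close> bounds the part along the face per unit of \<open>b\<close>;
    the other three terms bound, per unit of \<open>a\<close>, the contributions of
    \<open>Q\<close>, of the generators outside \<open>B\<close> and of \<open>u\<close>.\<close>
  define C where "C = nat \<lceil>S + SQ + real R0 * S + real CARD('n) * real R0\<rceil>"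
  have S0: "0 \<le> S" "0 \<le> SQ"
    unfolding S_def SQ_def by (intro sum_nonneg; simp)+
  have C: "S + SQ + real R0 * S + real CARD('n) * real R0 \<le> real C"
    unfolding C_def by linarith
  have "0 \<le> real R0 * S" "0 \<le> real CARD('n) * real R0"
    using S0 by auto
  then have C1: "S \<le> real C" "SQ + real R0 * S + real CARD('n) * real R0 \<le> real C"
    using C S0 by linarith+
  obtain cP where cP: "\<And>j. axis j (cP j) \<in> P"
    using axis(1) by metis
  obtain cG where cG: "\<And>j. axis j (cG j) \<in> G"
    using axis(2) by metis
  define c where "c = (\<Sum>j\<in>UNIV. cP j + cG j)"
  have "cP j + cG j \<le> c" for j
    unfolding c_def by (intro member_le_sum) auto
  then have "axis j (cP j) \<le> axis j c" "axis j (cG j) \<le> axis j c" for j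
    by (auto simp: axis_def less_eq_vec_def intro: order_trans[OF le_add1] order_trans[OF le_add2])
  then have cax: "axis j c \<in> upward P" "axis j c \<in> upward G" for j
    unfolding upward_def using cP cG by blast+
  \<comment> \<open>The translation of \<open>set_powers_rounding\<close>; \<open>E1\<close> below
    collects the missing points that it moves into \<open>A\<close>.\<close>
  define W where "W = card P *s p0 + card G *s g0"
  define D where "D = total_degree W"
  define K where "K = (4 * C + 3) ^ d * (2 * (2 * C + CARD('n) * (2 * C + 1)) + 1) ^ CARD('n)"
  define small where "small = {B \<in> Pow ?G. \<not> int d < aff_dim B}"
  have fin_small: "finite small"
    unfolding small_def using fin(3) by simp
  show ?thesis
  proof (intro exI[of _ "(2 * c + 1) ^ (CARD('n) - 1) * D + card small * K"] allI impI)
    fix m a b :: nat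
    assume m: "1 \<le> m" and a: "1 \<le> a" and b: "b \<le> m * a"
    define A where "A = set_power (upward P) a + set_power (upward G) b"
    define E where "E = (set_power (upward Q) a + set_power (upward G) b) - A"
    have upA: "upward A = A"
      unfolding A_def by (intro ideal_prod_germs_in(2) ideal_pow_germs_in(2) upward_upward)
    have M: "x $ j \<le> c * (a + b)" if "x \<notin> A" for x :: "nat ^ 'n" and j
    proof (rule ccontr)
      assume "\<not> x $ j \<le> c * (a + b)"
      then have "axis j (c * a) + axis j (c * b) \<le> x"
        by (auto simp: axis_def less_eq_vec_def algebra_simps)
      moreover have "axis j (c * a) + axis j (c * b) \<in> A"
        unfolding A_def by (intro set_plus_intro set_power_axis cax)
      ultimately show False
        using that upA unfolding upward_def by blast
    qed
    have finA: "finite (- A)"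
    proof (rule finite_subset)
      show "- A \<subseteq> {x. total_degree x \<le> CARD('n) * (c * (a + b))}"
      proof
        fix x assume "x \<in> - A"
        then have "total_degree x \<le> (\<Sum>j\<in>(UNIV :: 'n set). c * (a + b))"
          unfolding total_degree_def using M by (intro sum_mono) auto
        then show "x \<in> {x. total_degree x \<le> CARD('n) * (c * (a + b))}" by simp
      qed
    qed (rule finite_total_degree_le)
    define E1 where "E1 = {x. x \<notin> A \<and> x + W \<in> A}"
    define V where "V B = span ((\<lambda>w. - w0 B + w) ` B)" for B
    \<comment> \<open>Points within \<open>C * a\<close> of a ball of radius
      \<open>C * m * a\<close> in the affine subspace through \<open>b\<close> times the base point
      of \<open>B\<close>, parallel to its affine hull.\<close>
    define Z where "Z B = {x \<in> E. \<exists>v\<in>V B. norm v \<le> real (C * m * a) \<and> norm (real_vec x - real b *\<^sub>R w0 B - v) \<le> real (C * a)}" for B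
    have finE: "finite E"
      by (rule finite_subset[OF _ finA]) (auto simp: E_def)
    have finE1: "finite E1"
      by (rule finite_subset[OF _ finA]) (auto simp: E1_def)
    have cover: "E \<subseteq> E1 \<union> (\<Union>B\<in>small. Z B)"
    proof
      fix x assume x: "x \<in> E"
      then obtain y z where yz: "x = y + z" "y \<in> set_power (upward Q) a" "z \<in> set_power (upward G) b"
        unfolding E_def by (auto simp: set_plus_def)
      obtain n where n: "sum n Q = a" "(\<Sum>q\<in>Q. n q *s q) \<le> y"
        using yz(2) set_power_upward_iff[OF fin(2)] by blast
      obtain l where l: "sum l G = b" "(\<Sum>w\<in>G. l w *s w) \<le> z"
        using yz(3) set_power_upward_iff[OF fin(3)] by blast
      have "(\<Sum>q\<in>Q. n q *s q) + (\<Sum>w\<in>G. l w *s w) \<le> x"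
        unfolding yz(1) using n(2) l(2) unfolding less_eq_vec_def vector_add_component by (auto intro: add_mono)
      then obtain u where u: "x = (\<Sum>q\<in>Q. n q *s q) + (\<Sum>w\<in>G. l w *s w) + u"
        unfolding nat_vec_le_iff_add by blast
      define n' where "n' q = real (n (iv q))" for q
      define l' where "l' w = real (l (iv w))" for w
      have sums: "sum n' ?Q = real a" "sum l' ?G = real b"
        unfolding sum.reindex[OF inj] n'_def l'_def o_def iv n(1)[symmetric] l(1)[symmetric] by simp_all
      have real_x: "real_vec x = (\<Sum>q\<in>?Q. n' q *\<^sub>R q) + (\<Sum>w\<in>?G. l' w *\<^sub>R w) + real_vec u"
        unfolding sum.reindex[OF inj] n'_def l'_def o_def iv u real_vec_add real_vec_sum real_vec_scale ..
      \<comment> \<open>The sum of \<open>n'\<close> is \<open>a\<close>, so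
        \<open>real R0 * real a\<close> is enough reserve for all exchanges.\<close>
      define B where "B = {w \<in> ?G. real R0 * real a \<le> l' w}"
      define U where "U = {j. real R0 * real a \<le> real_vec u $ j}"
      have BG: "B \<subseteq> ?G"
        by (auto simp: B_def)
      show "x \<in> E1 \<union> (\<Union>B\<in>small. Z B)"
      proof (cases "good B U")
        case True
        have "R (B, U) * sum n' ?Q \<le> real R0 * real a"
          unfolding sums using RR0[OF BG True] by (intro mult_right_mono) auto
        then have "\<forall>w\<in>B. R (B, U) * sum n' ?Q \<le> l' w" "\<forall>j\<in>U. R (B, U) * sum n' ?Q \<le> real_vec u $ j"
          unfolding B_def U_def by auto
        moreover have "\<forall>q\<in>?Q. 0 \<le> n' q" "\<forall>w\<in>?G. 0 \<le> l' w" "\<forall>j. 0 \<le> real_vec u $ j"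
          by (auto simp: n'_def l'_def real_vec_nth)
        ultimately obtain \<pi> k and u' :: "real ^ 'n" where e: "\<forall>p\<in>?P. 0 \<le> \<pi> p" "sum \<pi> ?P = sum n' ?Q" "\<forall>w\<in>?G. 0 \<le> k w"
            "sum k ?G = sum l' ?G" "\<forall>j. 0 \<le> u' $ j"
            "(\<Sum>q\<in>?Q. n' q *\<^sub>R q) + (\<Sum>w\<in>?G. l' w *\<^sub>R w) + real_vec u = (\<Sum>p\<in>?P. \<pi> p *\<^sub>R p) + (\<Sum>w\<in>?G. k w *\<^sub>R w) + u'"
          using R[OF BG True] unfolding exch_def by blast
        have "x + W \<in> A"
          unfolding W_def A_def
        proof (rule set_powers_rounding[OF fin(1) p0 fin(3) g0])
          show "real_vec x = (\<Sum>p\<in>P. (\<pi> \<circ> real_vec) p *\<^sub>R real_vec p) + (\<Sum>w\<in>G. (k \<circ> real_vec) w *\<^sub>R real_vec w) + u'"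
            using e(6) unfolding real_x sum.reindex[OF inj] o_def .
          show "sum (\<pi> \<circ> real_vec) P = real a"
            using trans[OF e(2) sums(1)] unfolding sum.reindex[OF inj] .
          show "sum (k \<circ> real_vec) G = real b"
            using trans[OF e(4) sums(2)] unfolding sum.reindex[OF inj] .
        qed (use e in auto)
        then show ?thesis
          using x unfolding E1_def E_def by blast
      next
        case False
        then have "B \<in> small"
          using BG by (simp add: good_def small_def)
        have U: "real_vec u $ j \<le> real R0 * real a" for j
          using False unfolding good_def U_def by (auto simp: not_le intro: less_imp_le)
        define v where "v = (\<Sum>w\<in>B. l' w *\<^sub>R (- w0 B + w))"
        have "v \<in> V B"
          unfolding v_def V_def by (intro span_sum span_scale span_base) auto
        have l0: "0 \<le> l' w" "0 \<le> n' w" for w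
          by (simp_all add: l'_def n'_def)
        have nv: "norm v \<le> real (C * m * a)"
        proof -
          have "norm v \<le> (\<Sum>w\<in>B. l' w * norm (w - w0 B))"
            unfolding v_def using l0 by (intro order_trans[OF norm_sum] sum_mono) simp
          also have "\<dots> \<le> (\<Sum>w\<in>?G. l' w * norm (w - w0 B))"
            using fin(3) BG l0 by (intro sum_mono2) auto
          also have "\<dots> \<le> (\<Sum>w\<in>?G. l' w * S)"
            using l0 S(2)[OF BG] by (intro sum_mono mult_left_mono) auto
          also have "\<dots> = real b * S"
            using sums(2) by (simp add: sum_distrib_right[symmetric])
          also have "\<dots> \<le> real (m * a) * real C"
            using b C1(1) S0 by (intro mult_mono) (auto simp del: of_nat_mult)
          finally show ?thesis by (simp add: mult_ac)
        qed
        \<comment> \<open>The coefficients sum to \<open>b\<close>, so subtracting \<open>b\<close>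
          copies of the base point replaces each generator by its difference to it. The part over
          \<open>B\<close> is \<open>v\<close>; outside \<open>B\<close> all coefficients are
          small.\<close>
        have "real b *\<^sub>R w0 B = (\<Sum>w\<in>?G. l' w *\<^sub>R w0 B)"
          by (simp add: sums(2) scaleR_sum_left[symmetric])
        moreover have "(\<Sum>w\<in>?G. f w) = (\<Sum>w\<in>B. f w) + (\<Sum>w\<in>?G - B. f w)" for f :: "real ^ 'n \<Rightarrow> real ^ 'n"
          using sum.subset_diff[OF BG, of f] fin(3) by (simp add: add.commute)
        ultimately have rest: "real_vec x - real b *\<^sub>R w0 B - v = (\<Sum>q\<in>?Q. n' q *\<^sub>R q) + (\<Sum>w\<in>?G - B. l' w *\<^sub>R (w - w0 B)) + real_vec u"
          unfolding real_x v_def by (simp add: scaleR_diff_right scaleR_add_right sum.distrib sum_subtractf algebra_simps)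
        have "norm (\<Sum>q\<in>?Q. n' q *\<^sub>R q) \<le> real a * SQ"
        proof -
          have "norm (\<Sum>q\<in>?Q. n' q *\<^sub>R q) \<le> (\<Sum>q\<in>?Q. n' q * norm q)"
            using l0 by (intro order_trans[OF norm_sum] sum_mono) simp
          also have "\<dots> \<le> (\<Sum>q\<in>?Q. n' q * SQ)"
            unfolding SQ_def using l0 fin(2) by (intro sum_mono mult_left_mono member_le_sum) auto
          also have "\<dots> = real a * SQ"
            using sums(1) by (simp add: sum_distrib_right[symmetric])
          finally show ?thesis .
        qed
        moreover have "norm (\<Sum>w\<in>?G - B. l' w *\<^sub>R (w - w0 B)) \<le> real R0 * real a * S"
        proof -
          have "norm (\<Sum>w\<in>?G - B. l' w *\<^sub>R (w - w0 B)) \<le> (\<Sum>w\<in>?G - B. (real R0 * real a) * norm (w - w0 B))"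
          proof (intro order_trans[OF norm_sum] sum_mono)
            fix w assume "w \<in> ?G - B"
            then have "l' w \<le> real R0 * real a"
              by (simp add: B_def not_le less_imp_le)
            then show "norm (l' w *\<^sub>R (w - w0 B)) \<le> (real R0 * real a) * norm (w - w0 B)"
              using l0(1)[of w] by (simp add: mult_right_mono)
          qed
          also have "\<dots> \<le> (\<Sum>w\<in>?G. (real R0 * real a) * norm (w - w0 B))"
            using fin(3) by (intro sum_mono2) auto
          also have "\<dots> \<le> (real R0 * real a) * S"
            unfolding sum_distrib_left[symmetric] using S(1)[OF BG] by (intro mult_left_mono) auto
          finally show ?thesis .
        qed
        moreover have "norm (real_vec u) \<le> real CARD('n) * (real R0 * real a)"
        proof -
          have "norm (real_vec u) \<le> (\<Sum>j\<in>UNIV. \<bar>real_vec u $ j\<bar>)"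
            by (rule norm_le_l1_cart)
          also have "\<dots> \<le> (\<Sum>j\<in>(UNIV :: 'n set). real R0 * real a)"
            using U by (intro sum_mono) (simp add: real_vec_nth)
          finally show ?thesis by simp
        qed
        ultimately have "norm (real_vec x - real b *\<^sub>R w0 B - v) \<le> real a * SQ + real R0 * real a * S + real CARD('n) * (real R0 * real a)"
          unfolding rest by (intro order_trans[OF norm_triangle_ineq] add_mono) auto
        also have "\<dots> = (SQ + real R0 * S + real CARD('n) * real R0) * real a"
          by (simp add: algebra_simps)
        also have "\<dots> \<le> real (C * a)"
          using C1(2) by (simp add: mult_right_mono)
        finally have "x \<in> Z B"
          unfolding Z_def using x \<open>v \<in> V B\<close> nv by blast
        then show ?thesis
          using \<open>B \<in> small\<close> by blast
      qed
    qed
    have cardZ: "card (Z B) \<le> K * (m ^ d * a ^ CARD('n))" if B: "B \<in> small" for B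
    proof -
      have "dim (V B) \<le> d"
      proof (cases "B = {}")
        case True
        then show ?thesis by (simp add: V_def)
      next
        case False
        have "w0 B \<in> affine hull B"
          using w0[OF False] by (rule hull_inc)
        then have "aff_dim B = int (dim ((\<lambda>w. - w0 B + w) ` B))"
          by (rule aff_dim_eq_dim)
        then show ?thesis
          using B by (simp add: V_def small_def)
      qed
      moreover have "finite (Z B)"
        by (rule finite_subset[OF _ finE]) (auto simp: Z_def)
      ultimately have "card (Z B) \<le> ((4 * C + 3) * m) ^ d * ((2 * (2 * C + CARD('n) * (2 * C + 1)) + 1) * a) ^ CARD('n)"
        using m a by (intro card_near_subspace[of "V B" d "Z B" m a C "real b *\<^sub>R w0 B"]) (auto simp: V_def Z_def)
      then show ?thesis
        unfolding K_def power_mult_distrib by (simp only: mult_ac)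
    qed
    have "card E1 \<le> (2 * (c * (a + b)) + 1) ^ (CARD('n) - 1) * D"
      unfolding E1_def D_def by (intro card_boundary_layer upA M total_degree_ge)
    also have "\<dots> \<le> ((2 * c + 1) * (a + b)) ^ (CARD('n) - 1) * D"
      using a by (intro mult_right_mono power_mono) (auto simp: algebra_simps)
    finally have cardE1: "card E1 \<le> (2 * c + 1) ^ (CARD('n) - 1) * D * (a + b) ^ (CARD('n) - 1)"
      unfolding power_mult_distrib by (simp only: mult_ac)
    have "card E \<le> card (E1 \<union> (\<Union>B\<in>small. Z B))"
      using finE finE1 fin_small by (intro card_mono[OF _ cover]) (auto simp: Z_def)
    also have "\<dots> \<le> card E1 + (\<Sum>B\<in>small. card (Z B))"
      by (intro order_trans[OF card_Un_le] add_mono card_UN_le fin_small order_refl)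
    also have "\<dots> \<le> (2 * c + 1) ^ (CARD('n) - 1) * D * (a + b) ^ (CARD('n) - 1) + card small * (K * (m ^ d * a ^ CARD('n)))"
      using sum_bounded_above[of small "\<lambda>B. card (Z B)" "K * (m ^ d * a ^ CARD('n))"] cardZ cardE1
      by (intro add_mono) auto
    also have "\<dots> \<le> ((2 * c + 1) ^ (CARD('n) - 1) * D + card small * K) * (m ^ d * a ^ CARD('n) + (a + b) ^ (CARD('n) - 1))"
      by (simp add: distrib_left distrib_right)
    finally show "card ((set_power (upward Q) a + set_power (upward G) b) - (set_power (upward P) a + set_power (upward G) b)) \<le>
      ((2 * c + 1) ^ (CARD('n) - 1) * D + card small * K) * (m ^ d * a ^ CARD('n) + (a + b) ^ (CARD('n) - 1))"
      unfolding E_def A_def .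
  qed
qed

section \<open>Newton polyhedra of monomial ideals\<close>

text \<open>The combinatorial content of a proper monomial ideal of finite colength: finitely many
  generators, no constant, and a pure power of each variable.\<close>

locale newton_gens =
  fixes G :: "(nat ^ 'n::finite) set"
  assumes finG: "finite G" and zero: "0 \<notin> G" and axis: "\<And>j. \<exists>c. axis j c \<in> G"
begin

abbreviation W :: "(real ^ 'n) set" where "W \<equiv> real_vec ` G"

definition K :: "(real ^ 'n) set" where
  "K = {x + u | x u. x \<in> convex hull W \<and> u \<in> nonneg_vecs}"

definition h :: "real ^ 'n \<Rightarrow> real" where
  "h v = Min ((\<lambda>w. v \<bullet> w) ` W)"

definition face :: "real ^ 'n \<Rightarrow> (real ^ 'n) set" where
  "face v = {w \<in> W. \<forall>w'\<in>W. v \<bullet> w \<le> v \<bullet> w'}"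

lemma finW: "finite W" and W_nonempty: "W \<noteq> {}"
  using finG axis by auto

lemma W_nonneg: "w \<in> W \<Longrightarrow> 0 \<le> w $ j"
  by (auto simp: real_vec_nth)

lemma axis_in_W: "\<exists>c>0. axis j (real c) \<in> W"
proof -
  obtain c where c: "axis j c \<in> G"
    using axis by blast
  have z0: "axis j 0 = (0 :: nat ^ 'n)"
    by (simp add: axis_def vec_eq_iff)
  then have "0 < c"
    using c zero z0 by (cases c) auto
  moreover have "real_vec (axis j c) = axis j (real c)"
    by (simp add: real_vec_def axis_def vec_eq_iff)
  ultimately show ?thesis
    using c by (metis imageI)
qed

lemma W_inner_pos:
  assumes v: "\<And>j. 0 < v $ j" and w: "w \<in> W"
  shows "0 < v \<bullet> w"
proof -
  obtain g where g: "g \<in> G" "w = real_vec g"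
    using w by blast
  then have "g \<noteq> 0"
    using zero by blast
  then obtain j where "g $ j \<noteq> 0"
    by (auto simp: vec_eq_iff)
  then have "0 < v $ j * w $ j"
    using v g by (simp add: real_vec_nth)
  also have "\<dots> \<le> (\<Sum>j\<in>UNIV. v $ j * w $ j)"
    using less_imp_le[OF v] W_nonneg[OF w] by (intro member_le_sum) auto
  finally show ?thesis
    by (simp add: inner_vec_def)
qed

lemma h_le: "w \<in> W \<Longrightarrow> h v \<le> v \<bullet> w"
  unfolding h_def using finW by (intro Min_le) auto

lemma h_attained: "\<exists>w\<in>W. h v = v \<bullet> w"
proof -
  have "h v \<in> (\<lambda>w. v \<bullet> w) ` W"
    unfolding h_def using finW W_nonempty by (intro Min_in) auto
  then show ?thesis by blast
qed

lemma face_eq: "face v = {w \<in> W. v \<bullet> w = h v}"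
proof -
  obtain w0 where w0: "w0 \<in> W" "h v = v \<bullet> w0"
    using h_attained by blast
  have "(\<forall>w'\<in>W. v \<bullet> w \<le> v \<bullet> w') \<longleftrightarrow> v \<bullet> w = h v" if "w \<in> W" for w
  proof
    assume "\<forall>w'\<in>W. v \<bullet> w \<le> v \<bullet> w'"
    then show "v \<bullet> w = h v"
      using w0 h_le[OF that, of v] by (metis antisym)
  qed (use h_le in metis)
  then show ?thesis
    unfolding face_def by blast
qed

lemma h_pos: "(\<And>j. 0 < v $ j) \<Longrightarrow> 0 < h v"
  using h_attained[of v] W_inner_pos[of v] by metis

lemma nonneg_inner: "v \<in> nonneg_vecs \<Longrightarrow> u \<in> nonneg_vecs \<Longrightarrow> 0 \<le> v \<bullet> (u :: real ^ 'n)"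
  unfolding inner_vec_def nonneg_vecs_def by (intro sum_nonneg) auto

lemma h_le_hull: "x \<in> convex hull W \<Longrightarrow> h v \<le> v \<bullet> x"
proof -
  assume x: "x \<in> convex hull W"
  have "convex hull W \<subseteq> {x. h v \<le> v \<bullet> x}"
    using h_le by (intro hull_minimal convex_halfspace_ge) auto
  then show ?thesis
    using x by blast
qed

lemma h_le_K: "v \<in> nonneg_vecs \<Longrightarrow> x \<in> K \<Longrightarrow> h v \<le> v \<bullet> x"
proof -
  assume v: "v \<in> nonneg_vecs" and "x \<in> K"
  then obtain y u where x: "x = y + u" "y \<in> convex hull W" "u \<in> nonneg_vecs"
    unfolding K_def by blast
  show ?thesis
    using h_le_hull[OF x(2), of v] nonneg_inner[OF v x(3)] unfolding x(1) inner_add_right by linarith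
qed

lemma hull_subset_K: "convex hull W \<subseteq> K"
proof
  fix x assume "x \<in> convex hull W"
  then show "x \<in> K"
    unfolding K_def mem_Collect_eq by (intro exI[of _ x] exI[of _ 0]) (auto simp: nonneg_vecs_def)
qed

lemma W_subset_K: "W \<subseteq> K"
  using order_trans[OF hull_subset hull_subset_K] .

lemma K_add: "x \<in> K \<Longrightarrow> u \<in> nonneg_vecs \<Longrightarrow> x + u \<in> K"
  unfolding K_def mem_Collect_eq
proof (elim exE conjE)
  fix y w assume "x = y + w" "y \<in> convex hull W" "w \<in> nonneg_vecs" "u \<in> nonneg_vecs"
  then show "\<exists>y' w'. x + u = y' + w' \<and> y' \<in> convex hull W \<and> w' \<in> nonneg_vecs"
    by (intro exI[of _ y] exI[of _ "w + u"]) (auto simp: nonneg_vecs_def)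
qed

lemma K_nonneg: "x \<in> K \<Longrightarrow> 0 \<le> x $ j"
proof -
  assume "x \<in> K"
  then obtain y u where x: "x = y + u" "y \<in> convex hull W" "u \<in> nonneg_vecs"
    unfolding K_def by blast
  have "h (axis j 1) \<le> axis j 1 \<bullet> y"
    using h_le_hull x(2) by blast
  moreover have "0 \<le> h (axis j 1)"
    using h_attained[of "axis j 1"] W_nonneg by (auto simp: inner_axis')
  ultimately show ?thesis
    using x by (simp add: inner_axis' nonneg_vecs_def)
qed

lemma convex_K: "convex K"
proof -
  have "convex (nonneg_vecs :: (real ^ 'n) set)"
    by (intro convexI) (auto simp: nonneg_vecs_def)
  moreover have "K = (\<Union>x\<in>convex hull W. \<Union>u\<in>nonneg_vecs. {x + u})"
    unfolding K_def by blast
  ultimately show ?thesis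
    using convex_sums[OF convex_convex_hull] by metis
qed

lemma supp_min_K: "v \<in> nonneg_vecs \<Longrightarrow> supp_min v K = h v"
proof -
  assume v: "v \<in> nonneg_vecs"
  obtain w where w: "w \<in> W" "h v = v \<bullet> w"
    using h_attained by blast
  show ?thesis
    unfolding supp_min_def
  proof (rule cInf_eq_minimum)
    show "h v \<in> (\<lambda>k. v \<bullet> k) ` K"
      using w W_subset_K by blast
  qed (use h_le_K[OF v] in auto)
qed

text \<open>For positive \<open>v\<close>, a minimising point has no component from the orthant, and
  its convex weights sit on generators of minimal value.\<close>

lemma newton_face_K:
  assumes v: "\<And>j. 0 < v $ j"
  shows "newton_face v K = convex hull face v"
proof -
  have v0: "v \<in> nonneg_vecs"
    using v by (auto simp: nonneg_vecs_def less_imp_le)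
  show ?thesis
    unfolding newton_face_def supp_min_K[OF v0]
  proof
    show "convex hull face v \<subseteq> {k \<in> K. v \<bullet> k = h v}"
    proof (rule hull_minimal)
      show "face v \<subseteq> {k \<in> K. v \<bullet> k = h v}"
        unfolding face_eq using W_subset_K by blast
      have "{k \<in> K. v \<bullet> k = h v} = K \<inter> {k. v \<bullet> k = h v}"
        by blast
      then show "convex {k \<in> K. v \<bullet> k = h v}"
        using convex_K convex_hyperplane convex_Int by metis
    qed
    show "{k \<in> K. v \<bullet> k = h v} \<subseteq> convex hull face v"
    proof clarify
      fix k assume k: "k \<in> K" "v \<bullet> k = h v"
      then obtain y u where yu: "k = y + u" "y \<in> convex hull W" "u \<in> nonneg_vecs"
        unfolding K_def by blast
      obtain \<mu> where l: "\<forall>w\<in>W. 0 \<le> \<mu> w" "sum \<mu> W = 1" "(\<Sum>w\<in>W. \<mu> w *\<^sub>R w) = y"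
        using yu(2) unfolding convex_hull_finite[OF finW] by blast
      have "v \<bullet> y = h v" "v \<bullet> u = 0"
        using k(2) h_le_hull[OF yu(2), of v] nonneg_inner[OF v0 yu(3)] unfolding yu(1) inner_add_right by linarith+
      have "v $ j * u $ j = 0" for j
        using \<open>v \<bullet> u = 0\<close> yu(3) v0 unfolding inner_vec_def
        by (subst (asm) sum_nonneg_eq_0_iff) (auto simp: nonneg_vecs_def)
      then have "u = 0"
        using v by (auto simp: vec_eq_iff) (metis less_irrefl)
      have "(\<Sum>w\<in>W. \<mu> w * (v \<bullet> w - h v)) = (\<Sum>w\<in>W. \<mu> w * (v \<bullet> w)) - sum \<mu> W * h v"
        by (simp add: right_diff_distrib sum_subtractf sum_distrib_right)
      also have "(\<Sum>w\<in>W. \<mu> w * (v \<bullet> w)) = v \<bullet> y"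
        unfolding l(3)[symmetric] by (simp add: inner_sum_right)
      finally have "(\<Sum>w\<in>W. \<mu> w * (v \<bullet> w - h v)) = 0"
        using l(2) \<open>v \<bullet> y = h v\<close> by simp
      then have zero': "\<mu> w * (v \<bullet> w - h v) = 0" if "w \<in> W" for w
        using that l(1) h_le[of _ v] finW by (subst (asm) sum_nonneg_eq_0_iff) auto
      have fin: "finite (face v)" and sub: "face v \<subseteq> W"
        using finW by (auto simp: face_def)
      have out: "\<mu> w = 0" if "w \<in> W - face v" for w
        using zero'[of w] that unfolding face_eq by auto
      have "sum \<mu> (face v) = 1"
        using sum.mono_neutral_left[OF finW sub, of \<mu>] out l(2) by simp
      moreover have "(\<Sum>w\<in>face v. \<mu> w *\<^sub>R w) = y"
        using sum.mono_neutral_left[OF finW sub, of "\<lambda>w. \<mu> w *\<^sub>R w"] out l(3) by simp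
      ultimately show "k \<in> convex hull face v"
        unfolding convex_hull_finite[OF fin] yu(1) \<open>u = 0\<close> using l(1) sub by (auto intro!: exI[of _ \<mu>])
    qed
  qed
qed

lemma aff_dim_newton_face: "(\<And>j. 0 < v $ j) \<Longrightarrow> aff_dim (newton_face v K) = aff_dim (face v)"
  by (simp add: newton_face_K aff_dim_convex_hull)

lemma compact_newton_face: "(\<And>j. 0 < v $ j) \<Longrightarrow> compact (newton_face v K)"
  using finW by (simp add: newton_face_K face_def finite_imp_compact_convex_hull)

text \<open>If \<open>v $ j = 0\<close>, the face contains a ray in direction \<open>j\<close> from
  each of its points and is unbounded.\<close>

lemma positive_of_compact_face:
  assumes v: "v \<in> nonneg_vecs" and "compact (newton_face v K)" and "newton_face v K \<noteq> {}"
  shows "0 < v $ j"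
proof (rule ccontr)
  assume "\<not> 0 < v $ j"
  then have vj: "v $ j = 0"
    using v unfolding nonneg_vecs_def by (simp add: less_le)
  obtain x where x: "x \<in> newton_face v K"
    using assms(3) by blast
  obtain B where B: "\<And>y. y \<in> newton_face v K \<Longrightarrow> norm y \<le> B"
    using compact_imp_bounded[OF assms(2)] unfolding bounded_iff by blast
  define y where "y = x + axis j (\<bar>B\<bar> + 1)"
  have "axis j (\<bar>B\<bar> + 1) \<in> (nonneg_vecs :: (real ^ 'n) set)"
    by (auto simp: nonneg_vecs_def axis_def)
  then have "y \<in> newton_face v K"
    using x vj K_add[of x "axis j (\<bar>B\<bar> + 1)"] unfolding newton_face_def y_def
    by (auto simp: inner_add_right inner_axis)
  then have "norm y \<le> B"
    using B by blast
  moreover have "\<bar>B\<bar> + 1 \<le> y $ j"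
    using x K_nonneg[of x j] by (simp add: y_def newton_face_def)
  ultimately show False
    using component_le_norm_cart[of y j] by linarith
qed

lemma h_pos_imp_positive:
  assumes v: "v \<in> nonneg_vecs" and "0 < h v"
  shows "0 < v $ j"
proof -
  obtain c where "0 < c" "axis j (real c) \<in> W"
    using axis_in_W by blast
  then have "0 < v $ j * real c"
    using h_le[of "axis j (real c)" v] assms(2) by (simp add: inner_axis)
  then show ?thesis
    using \<open>0 < c\<close> by (simp add: zero_less_mult_iff)
qed

text \<open>Moving \<open>v\<close> slightly towards a functional that is minimal on a facet of its face.\<close>

lemma ex_subface:
  assumes v: "\<And>j. 0 < v $ j" and e: "0 \<le> e" "e \<le> aff_dim (face v)"
  shows "\<exists>v'. (\<forall>j. 0 < v' $ j) \<and> face v' \<subseteq> face v \<and> aff_dim (face v') = e"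
  using v e(2)
proof (induction "nat (aff_dim (face v) - e)" arbitrary: v rule: less_induct)
  case less
  show ?case
  proof (cases "aff_dim (face v) = e")
    case True
    then show ?thesis using less.prems by blast
  next
    case False
    then have gt: "e < aff_dim (face v)"
      using less.prems by simp
    let ?F = "convex hull face v"
    have finF: "finite (face v)" and subF: "face v \<subseteq> W"
      using finW by (auto simp: face_def)
    have poly: "polytope ?F"
      using finF by (rule polytope_convex_hull)
    obtain F1 where F1: "F1 facet_of ?F"
      using polytope_facet_exists[OF poly] gt e(1) by (auto simp: aff_dim_convex_hull)
    have F1face: "F1 face_of ?F" "F1 \<noteq> {}" "aff_dim F1 = aff_dim (face v) - 1"
      using F1 by (auto simp: facet_of_def aff_dim_convex_hull)
    then have "F1 exposed_face_of ?F"
      using exposed_face_of_polyhedron[OF polytope_imp_polyhedron[OF poly]] by blast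
    then obtain a b where ab: "?F \<subseteq> {x. a \<bullet> x \<le> b}" "F1 = ?F \<inter> {x. a \<bullet> x = b}"
      unfolding exposed_face_of_def by blast
    obtain S where S: "S \<subseteq> face v" "F1 = convex hull S"
      using face_of_convex_hull_subset[OF finite_imp_compact[OF finF] F1face(1)] by blast
    \<comment> \<open>\<open>F1\<close> is the hull of some of the generators, so \<open>F2\<close>
      has the same affine dimension as \<open>F1\<close>.\<close>
    define F2 where "F2 = face v \<inter> F1"
    have "S \<subseteq> F2"
      unfolding F2_def using S hull_subset[of S convex] by blast
    then have dimF2: "aff_dim F2 = aff_dim (face v) - 1"
      using aff_dim_subset[of S F2] aff_dim_subset[of F2 F1] F1face(3) S(2)
      by (simp add: F2_def aff_dim_convex_hull)
    have "F2 \<noteq> {}"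
      using \<open>S \<subseteq> F2\<close> S(2) F1face(2) by auto
    then obtain w0 where w0: "w0 \<in> face v" "a \<bullet> w0 = b"
      unfolding F2_def ab(2) by blast
    have ev1: "\<forall>\<^sub>F \<epsilon> in at_right 0. 0 < v $ j - \<epsilon> * a $ j" for j
    proof -
      have "((\<lambda>\<epsilon>. v $ j - \<epsilon> * a $ j) \<longlongrightarrow> v $ j - 0 * a $ j) (at_right 0)"
        by (intro tendsto_intros)
      then have lim: "((\<lambda>\<epsilon>. v $ j - \<epsilon> * a $ j) \<longlongrightarrow> v $ j) (at_right 0)"
        by simp
      show ?thesis
        by (rule order_tendstoD(1)[OF lim less.prems(1)])
    qed
    have ev2: "\<forall>\<^sub>F \<epsilon> in at_right 0. \<forall>w\<in>W - face v. 0 < (v \<bullet> w - v \<bullet> w0) - \<epsilon> * (a \<bullet> w - a \<bullet> w0)"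
    proof (rule eventually_ball_finite)
      show "finite (W - face v)"
        using finW by simp
      show "\<forall>w\<in>W - face v. \<forall>\<^sub>F \<epsilon> in at_right 0. 0 < (v \<bullet> w - v \<bullet> w0) - \<epsilon> * (a \<bullet> w - a \<bullet> w0)"
      proof
        fix w assume w: "w \<in> W - face v"
        have "h v \<le> v \<bullet> w" "v \<bullet> w \<noteq> h v" "v \<bullet> w0 = h v"
          using w w0(1) h_le[of w v] unfolding face_eq by auto
        then have gap: "0 < v \<bullet> w - v \<bullet> w0"
          by linarith
        have "((\<lambda>\<epsilon>. (v \<bullet> w - v \<bullet> w0) - \<epsilon> * (a \<bullet> w - a \<bullet> w0)) \<longlongrightarrow> (v \<bullet> w - v \<bullet> w0) - 0 * (a \<bullet> w - a \<bullet> w0)) (at_right 0)"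
          by (intro tendsto_intros)
        then have lim: "((\<lambda>\<epsilon>. (v \<bullet> w - v \<bullet> w0) - \<epsilon> * (a \<bullet> w - a \<bullet> w0)) \<longlongrightarrow> v \<bullet> w - v \<bullet> w0) (at_right 0)"
          by simp
        show "\<forall>\<^sub>F \<epsilon> in at_right 0. 0 < (v \<bullet> w - v \<bullet> w0) - \<epsilon> * (a \<bullet> w - a \<bullet> w0)"
          by (rule order_tendstoD(1)[OF lim gap])
      qed
    qed
    have "\<forall>\<^sub>F \<epsilon> in at_right (0::real). (\<forall>j. 0 < v $ j - \<epsilon> * a $ j) \<and>
        (\<forall>w\<in>W - face v. 0 < (v \<bullet> w - v \<bullet> w0) - \<epsilon> * (a \<bullet> w - a \<bullet> w0)) \<and> 0 < \<epsilon>"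
      using eventually_all_finite[of "\<lambda>\<epsilon> j. 0 < v $ j - \<epsilon> * a $ j"] ev1 ev2 eventually_at_right_less[of "0::real"]
      by (simp add: eventually_conj_iff)
    then obtain \<epsilon> where \<epsilon>: "\<And>j. 0 < v $ j - \<epsilon> * a $ j" "\<And>w. w \<in> W - face v \<Longrightarrow> 0 < (v \<bullet> w - v \<bullet> w0) - \<epsilon> * (a \<bullet> w - a \<bullet> w0)" "0 < \<epsilon>"
      using eventually_happens'[OF trivial_limit_at_right_real] by blast
    \<comment> \<open>On \<open>face v\<close> the functional \<open>a\<close> is largest on
      \<open>F1\<close>, so subtracting a multiple of it makes exactly the generators in
      \<open>F1\<close> minimal there. For small \<open>\<epsilon>\<close> the other generators stay
      strictly above, and \<open>v'\<close> stays positive.\<close>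
    define v' where "v' = v - \<epsilon> *\<^sub>R a"
    have v'pos: "0 < v' $ j" for j
      using \<epsilon>(1)[of j] by (simp add: v'_def)
    have w0W: "w0 \<in> W"
      using w0 subF by blast
    have in_face: "v' \<bullet> w - v' \<bullet> w0 = \<epsilon> * (b - a \<bullet> w)" if "w \<in> face v" for w
      using that w0 unfolding face_eq v'_def by (simp add: inner_diff_left algebra_simps)
    have le: "a \<bullet> w \<le> b" if "w \<in> face v" for w
      using ab(1) hull_inc[OF that, of convex] by blast
    have out_face: "v' \<bullet> w0 < v' \<bullet> w" if "w \<in> W - face v" for w
      using \<epsilon>(2)[OF that] unfolding v'_def by (simp add: inner_diff_left algebra_simps)
    have min: "v' \<bullet> w0 \<le> v' \<bullet> w" if "w \<in> W" for w
    proof (cases "w \<in> face v")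
      case True
      have "0 \<le> \<epsilon> * (b - a \<bullet> w)"
        using \<epsilon>(3) le[OF True] by simp
      then show ?thesis using in_face[OF True] by linarith
    next
      case False
      then show ?thesis using out_face[of w] that by simp
    qed
    have "face v' = {w \<in> W. v' \<bullet> w = v' \<bullet> w0}"
      unfolding face_def using min w0W by (auto intro: antisym)
    also have "\<dots> = F2"
    proof (intro equalityI subsetI)
      fix w assume w: "w \<in> {w \<in> W. v' \<bullet> w = v' \<bullet> w0}"
      then have wf: "w \<in> face v"
        using out_face[of w] by (metis (mono_tags, lifting) DiffI less_irrefl mem_Collect_eq)
      then have "a \<bullet> w = b"
        using in_face[OF wf] w \<epsilon>(3) by simp
      then show "w \<in> F2"
        unfolding F2_def ab(2) using wf hull_inc[OF wf, of convex] by simp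
    next
      fix w assume "w \<in> F2"
      then have "w \<in> face v" "a \<bullet> w = b"
        unfolding F2_def ab(2) by auto
      then show "w \<in> {w \<in> W. v' \<bullet> w = v' \<bullet> w0}"
        using in_face[of w] subF by auto
    qed
    finally have fv': "face v' = F2" .
    have "\<exists>v''. (\<forall>j. 0 < v'' $ j) \<and> face v'' \<subseteq> face v' \<and> aff_dim (face v'') = e"
      using gt by (intro less.hyps v'pos) (auto simp: fv' dimF2)
    then show ?thesis
      unfolding fv' F2_def by blast
  qed
qed

section \<open>Facet normals: finiteness and existence\<close>

definition facets :: "(nat ^ 'n) set" where
  "facets = {v. Gcd (range (vec_nth v)) = 1 \<and>
     aff_dim (newton_face (real_vec v) K) = int CARD('n) - 1 \<and> supp_min (real_vec v) K > 0}"

lemma real_vec_nonneg: "real_vec v \<in> nonneg_vecs"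
  by (simp add: nonneg_vecs_def real_vec_nth)

lemma inner_real_vec: "real_vec a \<bullet> real_vec b = real (\<Sum>j\<in>UNIV. a $ j * b $ j)"
  by (simp add: inner_vec_def real_vec_nth)

lemma h_real_vec: "\<exists>k. h (real_vec v) = real k"
proof -
  obtain g where "h (real_vec v) = real_vec v \<bullet> real_vec g"
    using h_attained by blast
  then show ?thesis
    unfolding inner_real_vec by blast
qed

lemma facetsD:
  assumes "v \<in> facets"
  shows "0 < h (real_vec v)" "0 < real_vec v $ j" "aff_dim (face (real_vec v)) = int CARD('n) - 1"
proof -
  show pos: "0 < h (real_vec v)"
    using assms supp_min_K[OF real_vec_nonneg] by (simp add: facets_def)
  show "0 < real_vec v $ j" for j
    by (rule h_pos_imp_positive[OF real_vec_nonneg pos])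
  then show "aff_dim (face (real_vec v)) = int CARD('n) - 1"
    using assms aff_dim_newton_face[of "real_vec v"] by (simp add: facets_def)
qed

text \<open>The origin is off the affine hull of \<open>B\<close>, so adding it gives full
  dimension; \<open>u - v\<close> vanishes on the enlarged set.\<close>

lemma facet_functional_unique:
  fixes u v :: "real ^ 'n"
  assumes dim: "aff_dim B = int CARD('n) - 1" and u: "\<And>w. w \<in> B \<Longrightarrow> u \<bullet> w = 1" and v: "\<And>w. w \<in> B \<Longrightarrow> v \<bullet> w = 1"
  shows "u = v"
proof (rule ccontr)
  assume "u \<noteq> v"
  have "affine hull B \<subseteq> {x. u \<bullet> x = 1}"
    using u by (intro hull_minimal affine_hyperplane) auto
  then have "0 \<notin> affine hull B"
    by auto
  then have "aff_dim (insert 0 B) = int CARD('n)"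
    using dim by (simp add: aff_dim_insert)
  moreover have "aff_dim (insert 0 B) \<le> aff_dim {x. (u - v) \<bullet> x = 0}"
    using u v by (intro aff_dim_subset) (auto simp: inner_diff_left)
  moreover have "aff_dim {x. (u - v) \<bullet> x = 0} = int CARD('n) - 1"
    using aff_dim_hyperplane[of "u - v" 0] \<open>u \<noteq> v\<close> by (simp add: of_nat_diff)
  ultimately show False by simp
qed

text \<open>A facet determines its primitive normal: divided by its minimum, the functional is 1 on
  the facet and so unique, and the gcd condition fixes the scale. Faces are spanned by subsets of
  the finite set \<open>W\<close>.\<close>

lemma finite_facets: "finite facets"
proof (rule inj_on_finite)
  show "inj_on (\<lambda>v. face (real_vec v)) facets"
  proof (rule inj_onI)
    fix v v' assume v: "v \<in> facets" "v' \<in> facets" "face (real_vec v) = face (real_vec v')"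
    obtain k k' where k: "h (real_vec v) = real k" "h (real_vec v') = real k'"
      using h_real_vec by metis
    then have pos: "0 < k" "0 < k'"
      using facetsD(1)[OF v(1)] facetsD(1)[OF v(2)] by simp_all
    have "(1 / real k) *\<^sub>R real_vec v = (1 / real k') *\<^sub>R real_vec v'"
    proof (rule facet_functional_unique[OF facetsD(3)[OF v(1)]])
      fix w assume w: "w \<in> face (real_vec v)"
      then show "(1 / real k) *\<^sub>R real_vec v \<bullet> w = 1"
        using k(1) pos by (simp add: face_eq)
      show "(1 / real k') *\<^sub>R real_vec v' \<bullet> w = 1"
        using w k(2) pos unfolding v(3) by (simp add: face_eq)
    qed
    then have "real (v $ j) / real k = real (v' $ j) / real k'" for j
      by (simp add: vec_eq_iff real_vec_nth)
    then have "real (k' * v $ j) = real (k * v' $ j)" for j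
      using pos by (simp add: field_simps)
    then have eq: "k' * v $ j = k * v' $ j" for j
      by (simp only: of_nat_eq_iff)
    have "Gcd ((*) k' ` range (vec_nth v)) = k'" "Gcd ((*) k ` range (vec_nth v')) = k"
      using v(1,2) by (simp_all add: Gcd_mult facets_def del: image_image)
    moreover have "(*) k' ` range (vec_nth v) = (*) k ` range (vec_nth v')"
      by (simp add: image_image eq)
    ultimately have "k' = k" by simp
    then show "v = v'"
      using eq pos by (simp add: vec_eq_iff)
  qed
  show "(\<lambda>v. face (real_vec v)) ` facets \<subseteq> Pow W"
    by (auto simp: face_def)
qed (use finW in simp)

text \<open>A functional that is at least \<open>1\<close> on the generators and equal to \<open>1\<close> on as many of them as
  possible.\<close>

lemma ex_spanning_functional:
  "\<exists>v. (\<forall>w\<in>W. 1 \<le> v \<bullet> w) \<and> span {w \<in> W. v \<bullet> w = 1} = UNIV"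
proof -
  define A where "A v = {w \<in> W. v \<bullet> w = 1}" for v
  define V where "V = {v. \<forall>w\<in>W. 1 \<le> v \<bullet> w}"
  define one :: "real ^ 'n" where "one = (\<chi> j. 1)"
  have "one \<in> V"
    unfolding V_def
  proof clarify
    fix g assume "g \<in> G"
    then have "0 < one \<bullet> real_vec g"
      by (intro W_inner_pos) (auto simp: one_def)
    moreover have "one \<bullet> real_vec g = real (\<Sum>j\<in>UNIV. g $ j)"
      by (simp add: inner_vec_def real_vec_nth one_def)
    ultimately show "1 \<le> one \<bullet> real_vec g"
      by (simp del: of_nat_sum)
  qed
  then have "\<exists>v. v \<in> V \<and> (\<forall>v'. v' \<in> V \<longrightarrow> card (A v') \<le> card (A v))"
    using finW by (intro ex_has_greatest_nat[of "\<lambda>v. v \<in> V" _ "\<lambda>v. card (A v)" "Suc (card W)"])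
      (auto simp: A_def less_Suc_eq_le intro!: card_mono)
  then obtain v where v: "v \<in> V" "\<And>v'. v' \<in> V \<Longrightarrow> card (A v') \<le> card (A v)"
    by blast
  have "span (A v) = UNIV"
  proof (rule ccontr)
    assume "span (A v) \<noteq> UNIV"
    then obtain a where a: "a \<noteq> 0" "\<And>x. x \<in> span (A v) \<Longrightarrow> a \<bullet> x = 0"
      using span_not_univ_subset_hyperplane[of "A v"] by blast
    \<comment> \<open>Moving along \<open>u\<close> keeps the tight constraints, while the negative
      coordinate lowers the value at a pure power; so a further constraint must become
      tight.\<close>
    have "\<exists>u. (\<forall>x\<in>A v. u \<bullet> x = 0) \<and> (\<exists>j. u $ j < 0)"
    proof (cases "\<exists>j. a $ j < 0")
      case True
      then show ?thesis using a(2) span_base by blast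
    next
      case False
      then have "0 \<le> a $ j" for j
        by (simp add: not_less)
      moreover obtain j where "a $ j \<noteq> 0"
        using a(1) by (auto simp: vec_eq_iff)
      ultimately have "(- a) $ j < 0"
        by (metis less_le neg_less_0_iff_less vector_uminus_component)
      moreover have "\<forall>x\<in>A v. (- a) \<bullet> x = 0"
        using a(2) span_base by auto
      ultimately show ?thesis by blast
    qed
    then obtain u j where u: "\<And>x. x \<in> A v \<Longrightarrow> u \<bullet> x = 0" "u $ j < 0"
      by blast
    define T where "T = {w \<in> W. u \<bullet> w < 0}"
    obtain c where "0 < c" "axis j (real c) \<in> W"
      using axis_in_W by blast
    then have "axis j (real c) \<in> T"
      using u(2) by (simp add: T_def inner_axis mult_neg_pos)
    then have T: "finite T" "T \<noteq> {}"
      using finW by (auto simp: T_def)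
    \<comment> \<open>\<open>q w\<close> is the step at which the constraint at \<open>w\<close>
      becomes tight, and \<open>\<tau>\<close> is the first such step.\<close>
    define q where "q w = (v \<bullet> w - 1) / (- (u \<bullet> w))" for w
    define \<tau> where "\<tau> = Min (q ` T)"
    have "\<tau> \<in> q ` T"
      unfolding \<tau>_def using T by (intro Min_in) auto
    then obtain w1 where w1: "w1 \<in> T" "\<tau> = q w1"
      by blast
    have \<tau>le: "\<tau> \<le> q w" if "w \<in> T" for w
      unfolding \<tau>_def using T that by (intro Min_le) auto
    have ge1: "1 \<le> v \<bullet> w" if "w \<in> W" for w
      using v(1) that unfolding V_def by blast
    have \<tau>0: "0 \<le> \<tau>"
      unfolding w1(2) q_def using w1(1) ge1[of w1] by (intro divide_nonneg_pos) (auto simp: T_def)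
    define v' where "v' = v + \<tau> *\<^sub>R u"
    have v'w: "v' \<bullet> w = v \<bullet> w + \<tau> * (u \<bullet> w)" for w
      by (simp add: v'_def inner_add_left)
    have "v' \<in> V"
      unfolding V_def
    proof (rule CollectI, rule ballI)
      fix w assume w: "w \<in> W"
      show "1 \<le> v' \<bullet> w"
      proof (cases "w \<in> T")
        case True
        then have neg: "u \<bullet> w < 0"
          by (simp add: T_def)
        have "q w * (u \<bullet> w) \<le> \<tau> * (u \<bullet> w)"
          using \<tau>le[OF True] neg by (intro mult_right_mono_neg) auto
        moreover have "q w * (u \<bullet> w) = 1 - v \<bullet> w"
          unfolding q_def using neg by (simp add: field_simps)
        ultimately show ?thesis
          unfolding v'w by linarith
      next
        case False
        then have "0 \<le> \<tau> * (u \<bullet> w)"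
          using w \<tau>0 by (simp add: T_def)
        then show ?thesis
          unfolding v'w using ge1[OF w] by linarith
      qed
    qed
    then have "card (A v') \<le> card (A v)"
      by (rule v(2))
    moreover have "insert w1 (A v) \<subseteq> A v'"
    proof -
      have "q w1 * (u \<bullet> w1) = 1 - v \<bullet> w1"
        unfolding q_def using w1(1) by (simp add: T_def field_simps)
      then have "v' \<bullet> w1 = 1"
        unfolding v'w w1(2) by linarith
      then have "w1 \<in> A v'"
        using w1(1) by (simp add: A_def T_def)
      moreover have "A v \<subseteq> A v'"
        using u(1) by (auto simp: A_def v'w)
      ultimately show ?thesis by blast
    qed
    then have "card (insert w1 (A v)) \<le> card (A v')"
      using finW by (intro card_mono) (auto simp: A_def)
    moreover have "w1 \<notin> A v"
      using u(1)[of w1] w1(1) by (auto simp: T_def)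
    moreover have "finite (A v)"
      using finW by (simp add: A_def)
    ultimately show False by simp
  qed
  then show ?thesis
    using v(1) unfolding V_def A_def by blast
qed

lemma det_in_Ints:
  fixes M :: "real ^ 'm ^ 'm"
  assumes "\<And>i j. M $ i $ j \<in> \<int>"
  shows "det M \<in> \<int>"
  unfolding det_def using assms by (intro Ints_sum Ints_mult Ints_prod Ints_of_int) auto

text \<open>The functional of \<open>ex_spanning_functional\<close> is minimal with value 1 on
  generators that span the space, so its face is a facet. By Cramer's rule it is rational, and a
  positive multiple is a primitive lattice vector. This keeps the \<open>Min\<close> in
  \<open>newton_filtration\<close> from being taken over the empty set.\<close>

lemma facets_nonempty: "facets \<noteq> {}"
proof -
  obtain v where v: "\<And>w. w \<in> W \<Longrightarrow> 1 \<le> v \<bullet> w" "span {w \<in> W. v \<bullet> w = 1} = UNIV"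
    using ex_spanning_functional by blast
  define A where "A = {w \<in> W. v \<bullet> w = 1}"
  obtain B where B: "B \<subseteq> A" "independent B" "A \<subseteq> span B" "card B = dim A"
    using basis_exists by metis
  have spanB: "span B = UNIV"
    using span_mono[OF B(3)] v(2) unfolding A_def[symmetric] span_span by blast
  then have cardB: "card B = CARD('n)"
    using B(2) dim_eq_card_independent[OF B(2)] dim_span[of B] by simp
  have finB: "finite B"
    using B(2) independent_imp_finite by blast
  obtain f :: "'n \<Rightarrow> real ^ 'n" where f: "bij_betw f UNIV B"
    using finite_same_card_bij[of "UNIV :: 'n set" B] finB cardB by auto
  then have fB: "f i \<in> B" for i
    by (auto simp: bij_betw_def)
  have fint: "f i $ j \<in> \<int>" for i j
    using fB[of i] B(1) by (auto simp: A_def real_vec_nth)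
  define M :: "real ^ 'n ^ 'n" where "M = (\<chi> i. f i)"
  have Mx: "(M *v x) $ i = x \<bullet> f i" for x i
    by (simp add: M_def matrix_vector_mult_def inner_vec_def mult.commute)
  have "x = 0" if "M *v x = 0" for x
  proof -
    have "x \<bullet> f i = 0" for i
      using that Mx[of x i] by simp
    moreover have "range f = B"
      using f by (rule bij_betw_imp_surj_on)
    ultimately have "B \<subseteq> {y. x \<bullet> y = 0}"
      by blast
    then have "span B \<subseteq> {y. x \<bullet> y = 0}"
      by (rule span_minimal[OF _ subspace_hyperplane])
    then have "x \<bullet> x = 0"
      unfolding spanB by blast
    then show ?thesis
      by simp
  qed
  then have "invertible M"
    using matrix_left_invertible_ker[of M] invertible_left_inverse by blast
  then have det: "det M \<noteq> 0"
    using invertible_det_nz by blast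
  \<comment> \<open>Cramer's numerators. The rows of \<open>M\<close> are integral, so
    \<open>D k\<close> and \<open>det M\<close> are integers and \<open>\<bar>det M\<bar>\<close>
    clears the denominators of \<open>v\<close>.\<close>
  define D where "D k = det (\<chi> i j. if j = k then (1::real) else M $ i $ j)" for k
  have "M *v v = (\<chi> i. 1)"
  proof -
    have "v \<bullet> f i = 1" for i
      using fB[of i] B(1) by (auto simp: A_def)
    then show ?thesis
      by (simp add: vec_eq_iff Mx)
  qed
  then have v_eq: "v = (\<chi> k. D k / det M)"
    unfolding cramer[OF det] D_def by (simp cong: if_cong)
  have ints: "D k \<in> \<int>" "det M \<in> \<int>" for k
    unfolding D_def by (intro det_in_Ints; simp add: M_def fint)+
  define t where "t = \<bar>det M\<bar>"
  have t: "0 < t"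
    using det by (simp add: t_def)
  have vpos: "0 < v $ j" for j
  proof -
    obtain c where "0 < c" "axis j (real c) \<in> W"
      using axis_in_W by blast
    then have "0 < v $ j * real c"
      using v(1)[of "axis j (real c)"] by (simp add: inner_axis)
    then show ?thesis
      using \<open>0 < c\<close> by (simp add: zero_less_mult_iff)
  qed
  have "\<exists>z::nat. t * v $ j = real z" for j
  proof -
    have "t * v $ j = sgn (det M) * D j"
      using det by (simp add: v_eq t_def abs_sgn)
    then have "t * v $ j \<in> \<int>"
      using ints det by (auto simp: sgn_if)
    moreover have "0 \<le> t * v $ j"
      using t vpos[of j] by simp
    ultimately show ?thesis
      by (metis Ints_cases of_int_0_le_iff of_int_of_nat_eq zero_le_imp_eq_int)
  qed
  then obtain z where z: "\<And>j. t * v $ j = real (z j)"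
    by metis
  define g where "g = Gcd (range z)"
  have zpos: "0 < z j" for j
    using z[of j] t vpos[of j] by (metis mult_pos_pos of_nat_0_less_iff)
  have gdvd: "g dvd z j" for j
    unfolding g_def by (rule Gcd_dvd) simp
  then have gpos: "0 < g"
    using zpos[of undefined] by (metis dvd_0_left gr0I less_irrefl)
  define y :: "nat ^ 'n" where "y = (\<chi> j. z j div g)"
  have yz: "z j = g * y $ j" for j
    using gdvd[of j] by (simp add: y_def)
  have "range z = (*) g ` range (vec_nth y)"
    unfolding image_image by (rule image_cong[OF refl yz])
  then have "Gcd (range z) = g * Gcd (range (vec_nth y))"
    using Gcd_mult[of g "range (vec_nth y)"] by (simp only: normalize_nat_def id_apply)
  from this[folded g_def] have "g * Gcd (range (vec_nth y)) = g * 1"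
    unfolding mult_1_right by (rule sym)
  then have "g = 0 \<or> Gcd (range (vec_nth y)) = 1"
    by (simp only: mult_cancel1) blast
  then have gcd1: "Gcd (range (vec_nth y)) = 1"
    using gpos by blast
  define s where "s = t / real g"
  have s: "0 < s"
    using t gpos by (simp add: s_def)
  have ys: "real_vec y = s *\<^sub>R v"
  proof -
    have "real (y $ j) = s * v $ j" for j
      using z[of j] yz[of j] gpos by (simp add: s_def field_simps)
    then show ?thesis
      by (simp add: vec_eq_iff real_vec_nth)
  qed
  have inner: "real_vec y \<bullet> w = s * (v \<bullet> w)" for w
    by (simp add: ys)
  have "B \<noteq> {}"
    using cardB by auto
  then obtain w1 where w1: "w1 \<in> A"
    using B(1) by blast
  have face: "face (real_vec y) = A"
  proof -
    have "real_vec y \<bullet> w \<le> real_vec y \<bullet> w' \<longleftrightarrow> v \<bullet> w \<le> v \<bullet> w'" for w w'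
      unfolding inner using s by simp
    then have "face (real_vec y) = {w \<in> W. \<forall>w'\<in>W. v \<bullet> w \<le> v \<bullet> w'}"
      by (simp add: face_def)
    also have "\<dots> = A"
    proof (intro equalityI subsetI)
      fix w assume w: "w \<in> {w \<in> W. \<forall>w'\<in>W. v \<bullet> w \<le> v \<bullet> w'}"
      then have "v \<bullet> w \<le> v \<bullet> w1"
        using w1 unfolding A_def by blast
      then show "w \<in> A"
        using w w1 v(1)[of w] unfolding A_def by simp
    next
      fix w assume "w \<in> A"
      then show "w \<in> {w \<in> W. \<forall>w'\<in>W. v \<bullet> w \<le> v \<bullet> w'}"
        using v(1) unfolding A_def by simp
    qed
    finally show ?thesis .
  qed
  have "0 < h (real_vec y)"
  proof -
    obtain w where w: "w \<in> W" "h (real_vec y) = real_vec y \<bullet> w"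
      using h_attained by blast
    have "0 < v \<bullet> w"
      using v(1)[OF w(1)] by linarith
    then show ?thesis
      unfolding w(2) inner using s by simp
  qed
  have ypos: "0 < real_vec y $ j" for j
    using s vpos[of j] by (simp add: ys)
  have "aff_dim A = int CARD('n) - 1"
  proof -
    have "span (insert 0 B) = UNIV"
      using span_mono[of B "insert 0 B"] spanB by blast
    then have "dim (insert 0 B) = CARD('n)"
      using dim_span[of "insert 0 B"] by simp
    then have "int CARD('n) = aff_dim (insert 0 B)"
      using aff_dim_zero[of "insert 0 B"] by (simp add: hull_inc)
    also have "\<dots> \<le> aff_dim B + 1"
      by (simp add: aff_dim_insert)
    also have "\<dots> \<le> aff_dim A + 1"
      using aff_dim_subset[OF B(1)] by simp
    finally have "int CARD('n) - 1 \<le> aff_dim A" by simp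
    moreover have "aff_dim A \<le> aff_dim {x. v \<bullet> x = 1}"
      by (intro aff_dim_subset) (auto simp: A_def)
    moreover have "v \<noteq> 0"
      using vpos[of undefined] by auto
    then have "aff_dim {x. v \<bullet> x = 1} = int CARD('n) - 1"
      by (simp add: of_nat_diff)
    ultimately show ?thesis by simp
  qed
  then have "y \<in> facets"
    using gcd1 \<open>0 < h (real_vec y)\<close> aff_dim_newton_face[of "real_vec y"] ypos
      supp_min_K[OF real_vec_nonneg, of y]
    by (simp add: facets_def face)
  then show ?thesis by blast
qed

end

section \<open>The bound on the Lojasiewicz exponent\<close>

lemma plus_UNIV_upward:
  fixes A :: "(nat ^ 'n::finite) set"
  assumes "upward A = A"
  shows "A + UNIV = A"
proof
  show "A + UNIV \<subseteq> A"
  proof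
    fix x assume "x \<in> A + UNIV"
    then obtain a m where "a \<in> A" "x = a + m"
      by (auto simp: set_plus_def)
    then show "x \<in> A"
      using assms unfolding upward_def nat_vec_le_iff_add by blast
  qed
  show "A \<subseteq> A + UNIV"
    using set_plus_intro[of _ A 0 UNIV] by auto
qed

lemma upward_set_power: "upward A = A \<Longrightarrow> upward (set_power A r) = set_power A r"
  by (rule ideal_pow_germs_in(2))

lemma set_power_add:
  "upward A = A \<Longrightarrow> set_power A (a + b) = set_power A a + set_power A b"
  by (induction b) (simp_all add: plus_UNIV_upward upward_set_power add.assoc)

lemma set_power_mult:
  "upward A = A \<Longrightarrow> set_power (set_power A s) b = set_power A (s * b)"
  by (induction b) (simp_all add: set_power_add add.commute[of s])

lemma set_power_antimono:
  assumes "upward A = A" "s \<le> r"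
  shows "set_power A r \<subseteq> set_power A s"
proof -
  have "set_power A r = set_power A s + set_power A (r - s)"
    using set_power_add[OF assms(1), of s "r - s"] assms(2) by simp
  also have "\<dots> \<subseteq> set_power A s + UNIV"
    by (intro set_plus_mono2) auto
  also have "\<dots> = set_power A s"
    using assms(1) by (intro plus_UNIV_upward upward_set_power)
  finally show ?thesis .
qed

lemma zero_notin_plus:
  fixes A B :: "(nat ^ 'n) set"
  assumes "0 \<notin> B"
  shows "0 \<notin> A + B"
proof
  assume "0 \<in> A + B"
  then obtain y z where yz: "z \<in> B" "y + z = 0"
    unfolding set_plus_def by force
  then have "y $ j + z $ j = 0" for j
    by (metis vector_add_component zero_index)
  then have "z = 0"
    by (simp add: vec_eq_iff)
  then show False
    using yz assms by simp
qed

lemma zero_notin_set_power: "0 \<notin> A \<Longrightarrow> 1 \<le> r \<Longrightarrow> 0 \<notin> set_power A r"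
  by (cases r) (simp_all add: zero_notin_plus)

lemma zero_notin_set_power_prod:
  "0 \<notin> A p \<Longrightarrow> 1 \<le> r p \<Longrightarrow> 0 \<notin> set_power_prod A r (Suc p)"
  by (simp add: zero_notin_plus zero_notin_set_power del: set_power.simps)

text \<open>With only two different ideals, the product depends on the two block sums of
  \<open>r\<close> alone; these become \<open>a\<close> and \<open>b\<close> in
  \<open>card_exchange_defect\<close>.\<close>

lemma set_power_prod_two:
  fixes Y Z :: "(nat ^ 'n::finite) set"
  assumes up: "upward Y = Y" "upward Z = Z" and "i \<le> p"
  shows "set_power_prod (\<lambda>j. if j < i then Y else Z) r p =
    set_power Y (\<Sum>j<i. r j) + set_power Z (\<Sum>j=i..<p. r j)"
  using assms(3)
proof (induction p rule: dec_induct)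
  case base
  have "set_power_prod (\<lambda>j. if j < i then Y else Z) r q = set_power Y (\<Sum>j<q. r j)" if "q \<le> i" for q
    using that
  proof (induction q)
    case (Suc q)
    then show ?case
      using set_power_add[OF up(1)] by simp
  qed simp
  then show ?case
    using plus_UNIV_upward[OF upward_set_power[OF up(1)]] by simp
next
  case (step p)
  then show ?case
    using set_power_add[OF up(2), of "\<Sum>j=i..<p. r j" "r p"] by (simp add: add.assoc)
qed

lemma upward_contains_axis:
  assumes "axis j m \<in> upward P"
  shows "\<exists>c. axis j c \<in> P"
proof -
  obtain g where g: "g \<in> P" "g \<le> axis j m"
    using assms unfolding upward_def by blast
  have "g $ i = 0" if "i \<noteq> j" for i
  proof -
    have "g $ i \<le> axis j m $ i"
      using g(2) by (simp add: less_eq_vec_def)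
    then show ?thesis
      using that by (simp add: axis_def)
  qed
  then have "g = axis j (g $ j)"
    by (simp add: vec_eq_iff axis_def)
  then show ?thesis
    using g(1) by metis
qed

lemma cofinite_contains_axis:
  fixes A :: "(nat ^ 'n::finite) set"
  assumes "finite (- A)"
  shows "\<exists>m. axis j m \<in> A"
  using cofinite_upward_axis[of "\<lambda>_. A" 1] assms by auto

lemma cofinite_set_power:
  fixes A :: "(nat ^ 'n::finite) set"
  assumes up: "upward A = A" and fin: "finite (- A)"
  shows "finite (- set_power A r)"
proof -
  have "set_power_prod (\<lambda>_. A) (\<lambda>_. r) 1 = UNIV + set_power A r"
    by simp
  also have "\<dots> = set_power A r"
    using plus_UNIV_upward[OF upward_set_power[OF up]] by (simp add: add.commute)
  finally show ?thesis
    using finite_compl_set_power_prod[of "\<lambda>_. A" 1 "\<lambda>_. r"] up fin by simp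
qed

section \<open>From monomial ideals to generators and Newton polyhedra\<close>

lemma monomial_ideal_generators:
  fixes J :: "'n::finite germ set"
  assumes "monomial_ideal J" "finite_colength J"
  shows "\<exists>G. J = germs_in (upward G) \<and> finite (- upward G) \<and> newton_gens G"
proof -
  obtain S where S: "J = germs_in (upward S)" "J \<noteq> UNIV"
    using assms(1) unfolding monomial_ideal_def genideal_monomials by blast
  obtain G where G: "finite G" "G \<subseteq> S" "upward G = upward S"
    using dickson_vec by blast
  have zero: "0 \<notin> upward G"
  proof
    assume "0 \<in> upward G"
    have "k \<in> upward G" for k
    proof -
      have "0 \<le> k"
        by (simp add: less_eq_vec_def)
      then have "k \<in> upward (upward G)"
        unfolding upward_def[of "upward G"] using \<open>0 \<in> upward G\<close> by blast
      then show ?thesis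
        unfolding upward_upward .
    qed
    then show False
      using S G(3) by (auto simp: germs_in_def)
  qed
  interpret monomial_quotient "upward G"
    by unfold_locales (simp_all add: upward_upward zero)
  have fin: "finite (- upward G)"
    using finite_colength_imp assms(2) S(1) G(3) by simp
  have "newton_gens G"
  proof
    show "finite G" by (rule G)
    show "0 \<notin> G"
      using zero subset_upward by blast
    show "\<exists>c. axis j c \<in> G" for j
      using cofinite_contains_axis[OF fin] upward_contains_axis by blast
  qed
  then show ?thesis
    using S(1) G(3) fin by metis
qed

lemma germ_supp_germs_in: "germ_supp (germs_in A) = A"
  unfolding germ_supp_def using monom_in_germs_in[of _ A]
  by (auto simp: germs_in_def) (metis taylor_coeff_monom zero_neq_one)

lemma (in newton_gens) newton_poly_eq: "newton_poly (germs_in (upward G)) = K"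
proof
  have "real_vec k + v \<in> K" if k: "k \<in> upward G" "v \<in> nonneg_vecs" for k v
  proof -
    obtain g m where g: "g \<in> G" "k = g + m"
      using k(1) unfolding upward_def nat_vec_le_iff_add by blast
    have "real_vec g \<in> K"
      using W_subset_K g(1) by blast
    then show ?thesis
      unfolding g(2) real_vec_add by (intro K_add real_vec_nonneg k(2))
  qed
  then show "newton_poly (germs_in (upward G)) \<subseteq> K"
    unfolding newton_poly_def germ_supp_germs_in by (intro hull_minimal convex_K) blast
  show "K \<subseteq> newton_poly (germs_in (upward G))"
  proof
    fix z assume "z \<in> K"
    then obtain x u where z: "z = x + u" "x \<in> convex hull W" "u \<in> nonneg_vecs"
      unfolding K_def by blast
    have "z \<in> (\<lambda>y. u + y) ` (convex hull W)"
      using z(1,2) by (auto simp: add.commute)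
    also have "\<dots> = convex hull ((\<lambda>y. u + y) ` W)"
      by (rule convex_hull_translation[symmetric])
    also have "\<dots> \<subseteq> newton_poly (germs_in (upward G))"
      unfolding newton_poly_def germ_supp_germs_in
    proof (rule hull_mono, rule subsetI)
      fix y assume "y \<in> (\<lambda>y. u + y) ` W"
      then obtain g where "g \<in> G" "y = real_vec g + u"
        by (auto simp: add.commute)
      then show "y \<in> {real_vec k + v | k v. k \<in> upward G \<and> v \<in> nonneg_vecs}"
        using z(3) subset_upward[of G] by blast
    qed
    finally show "z \<in> newton_poly (germs_in (upward G))" .
  qed
qed

lemma germ_pow: "x [^]\<^bsub>\<O>\<^esub> (m::nat) = x ^ m"
  by (induction m) (simp_all add: germ_ring_simps power_commutes)

lemma germ_finsum: "finite A \<Longrightarrow> (\<Oplus>\<^bsub>\<O>\<^esub>j\<in>A. f j) = (\<Sum>j\<in>A. f j :: 'n::finite germ)"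
proof (induction A rule: finite_induct)
  case empty
  interpret cring "\<O> :: 'n germ ring" by (rule cring_germ)
  show ?case by (simp add: germ_ring_simps)
next
  case (insert x A)
  interpret cring "\<O> :: 'n germ ring" by (rule cring_germ)
  show ?case
    using insert by (subst finsum_insert) (auto simp: germ_ring_simps)
qed

lemma monom_germ_power: "monom_germ k ^ m = monom_germ (m *s k)"
proof (induction m)
  case 0
  have "(0::nat) *s k = 0"
    by (simp add: vec_eq_iff)
  then show ?case
    by (simp add: monom_germ_0)
next
  case (Suc m)
  have "Suc m *s k = k + m *s k"
    by (simp add: vec_eq_iff)
  then show ?case
    using Suc by (simp add: monom_germ_add)
qed

text \<open>Compare the coefficients of \<open>x\<^sup>m\<^sup>k\<close> in an equation of integral dependence of \<open>x\<^sup>k\<close>.\<close>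

lemma (in newton_gens) integral_closure_monomial:
  assumes "monom_germ k \<in> integral_closure \<O> (germs_in (upward G))"
  shows "real_vec k \<in> K"
proof -
  obtain m a where m: "1 \<le> m" "\<forall>j\<in>{1..m}. a j \<in> ideal_pow (germs_in (upward G)) j"
      "monom_germ k [^]\<^bsub>\<O>\<^esub> m \<oplus>\<^bsub>\<O>\<^esub> (\<Oplus>\<^bsub>\<O>\<^esub>j\<in>{1..m}. a j \<otimes>\<^bsub>\<O>\<^esub> monom_germ k [^]\<^bsub>\<O>\<^esub> (m - j)) = \<zero>\<^bsub>\<O>\<^esub>"
    using assms unfolding integral_closure_def by blast
  have eq: "monom_germ (m *s k) + (\<Sum>j\<in>{1..m}. a j * monom_germ ((m - j) *s k)) = 0"
    using m(3) unfolding germ_pow germ_ring_simps germ_finsum[OF finite_atLeastAtMost] monom_germ_power .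
  have "taylor_coeff (\<Sum>j\<in>{1..m}. a j * monom_germ ((m - j) *s k)) (m *s k) = - 1"
    using arg_cong[OF eq, of "\<lambda>x. taylor_coeff x (m *s k)"]
    by (simp add: taylor_coeff_add taylor_coeff_monom taylor_coeff_zero add_eq_0_iff)
  \<comment> \<open>Some summand must cancel the leading monomial; its coefficient comes from
    \<open>a j\<close>, in the \<open>j\<close>-th power of the ideal, at the exponent
    \<open>j *s k\<close>. Dividing that exponent by \<open>j\<close> gives a point of
    \<open>K\<close>.\<close>
  then obtain j where j: "j \<in> {1..m}" "taylor_coeff (a j * monom_germ ((m - j) *s k)) (m *s k) \<noteq> 0"
    unfolding taylor_coeff_sum by (metis (no_types, lifting) neg_equal_0_iff_equal sum.neutral zero_neq_one)
  have "m *s k - (m - j) *s k = j *s k"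
    using j(1) by (auto simp: vec_eq_iff diff_mult_distrib[symmetric])
  then have "taylor_coeff (a j) (j *s k) \<noteq> 0"
    using j(2) by (auto simp: taylor_coeff_mult_monom split: if_splits)
  then have "j *s k \<in> set_power (upward G) j"
    using m(2) j(1) unfolding ideal_pow_germs_in(1)[OF upward_upward] by (auto simp: germs_in_def)
  then obtain l where l: "sum l G = j" "(\<Sum>g\<in>G. l g *s g) \<le> j *s k"
    using set_power_upward_iff[OF finG] by blast
  then obtain u where u: "j *s k = (\<Sum>g\<in>G. l g *s g) + u"
    unfolding nat_vec_le_iff_add by blast
  have jpos: "0 < real j"
    using j(1) by simp
  define x where "x = (\<Sum>g\<in>G. (real (l g) / real j) *\<^sub>R real_vec g)"
  have "x \<in> convex hull W"
  proof -
    have "sum (\<lambda>g. real (l g) / real j) G = 1"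
      using l(1) jpos by (simp add: sum_divide_distrib[symmetric] of_nat_sum[symmetric] del: of_nat_sum)
    then show ?thesis
      unfolding x_def using finG by (intro convex_sum convex_convex_hull) (auto intro: hull_inc)
  qed
  moreover have "real j *\<^sub>R real_vec k = real j *\<^sub>R (x + (1 / real j) *\<^sub>R real_vec u)"
    using arg_cong[OF u, of real_vec] jpos
    by (simp add: real_vec_add real_vec_sum real_vec_scale x_def scaleR_right_distrib scaleR_sum_right)
  then have "real_vec k = x + (1 / real j) *\<^sub>R real_vec u"
    using jpos by simp
  moreover have "(1 / real j) *\<^sub>R real_vec u \<in> nonneg_vecs"
    by (simp add: nonneg_vecs_def real_vec_nth)
  ultimately show ?thesis
    unfolding K_def by blast
qed

context newton_gens
begin

abbreviation J :: "'n germ set" where "J \<equiv> germs_in (upward G)"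

lemma facet_normals_eq: "facet_normals J = facets"
  by (simp add: facet_normals_def facets_def newton_poly_eq)

lemma newton_lcm_pos: "0 < newton_lcm J"
proof -
  let ?l = "\<lambda>v. nat \<lfloor>supp_min (real_vec v) K\<rfloor>"
  have nz: "?l v \<noteq> 0" if v: "v \<in> facets" for v
  proof -
    obtain k where "h (real_vec v) = real k"
      using h_real_vec by blast
    then show ?thesis
      using facetsD(1)[OF v] by (simp add: supp_min_K[OF real_vec_nonneg])
  qed
  have "0 \<notin> ?l ` facets"
  proof
    assume "0 \<in> ?l ` facets"
    then obtain v where v: "0 = ?l v" "v \<in> facets"
      by (rule imageE)
    show False
      using nz[OF v(2)] v(1)[symmetric] by (rule notE)
  qed
  then have "newton_lcm J \<noteq> 0"
    using finite_facets by (simp add: newton_lcm_def facet_normals_eq newton_poly_eq Lcm_0_iff)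
  then show ?thesis by simp
qed

text \<open>Each facet functional is at least its minimum on \<open>K\<close>, so after
  normalisation at least \<open>newton_lcm J\<close>. Hence a small filtration value at
  \<open>t *\<^sub>R x\<close> forces \<open>t\<close> to be small.\<close>

lemma newton_filtration_ge:
  assumes "0 \<le> t" "x \<in> K"
  shows "t * real (newton_lcm J) \<le> newton_filtration J (t *\<^sub>R x)"
  unfolding newton_filtration_def facet_normals_eq newton_poly_eq
proof (subst Min_ge_iff)
  show "\<forall>a\<in>(\<lambda>v. real (newton_lcm J) / supp_min (real_vec v) K * (t *\<^sub>R x \<bullet> real_vec v)) ` facets. t * real (newton_lcm J) \<le> a"
  proof clarify
    fix v assume v: "v \<in> facets"
    let ?l = "h (real_vec v)"
    have "?l \<le> x \<bullet> real_vec v"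
      using h_le_K[OF real_vec_nonneg assms(2), of v] by (simp add: inner_commute)
    then have "t * ?l \<le> t *\<^sub>R x \<bullet> real_vec v"
      using assms(1) by (simp add: mult_left_mono)
    then have "real (newton_lcm J) / ?l * (t * ?l) \<le> real (newton_lcm J) / ?l * (t *\<^sub>R x \<bullet> real_vec v)"
      using facetsD(1)[OF v] by (intro mult_left_mono) auto
    then show "t * real (newton_lcm J) \<le> real (newton_lcm J) / supp_min (real_vec v) K * (t *\<^sub>R x \<bullet> real_vec v)"
      using facetsD(1)[OF v] by (simp add: supp_min_K[OF real_vec_nonneg] mult.commute)
  qed
qed (use finite_facets facets_nonempty in auto)

text \<open>Justifies the \<open>Max\<close> in \<open>face_order\<close>. The condition
  \<open>0 \<le> d\<close> excludes the empty face, so that \<open>positive_of_compact_face\<close>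
  applies.\<close>

lemma finite_compact_faces:
  assumes "0 \<le> d"
  shows "finite (compact_faces J d)"
proof (rule finite_subset)
  show "compact_faces J d \<subseteq> (\<lambda>B. convex hull B) ` Pow W"
  proof
    fix D assume "D \<in> compact_faces J d"
    then obtain v where v: "v \<in> nonneg_vecs" "D = newton_face v K" "compact D" "aff_dim D = d"
      unfolding compact_faces_def newton_poly_eq by blast
    have "D \<noteq> {}"
      using v(4) assms by auto
    then have "0 < v $ j" for j
      using positive_of_compact_face[OF v(1)] v(2,3) by blast
    then have "D = convex hull face v"
      unfolding v(2) by (rule newton_face_K)
    then show "D \<in> (\<lambda>B. convex hull B) ` Pow W"
      by (auto simp: face_def)
  qed
qed (use finW in simp)

text \<open>Inside the face of \<open>v\<close> there is a compact face of dimension exactly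
  \<open>n - i\<close>, and \<open>face_order\<close> controls the filtration over that one. A point
  of the polyhedron of \<open>GI\<close> on a ray through it, with filtration value below
  \<open>b\<close> times the lcm, gives \<open>t\<close> and \<open>x\<close>.\<close>

lemma ex_point_on_half_lines:
  assumes I: "newton_gens GI" and d: "1 \<le> i" "i < CARD('n)"
    and a: "face_order i J (germs_in (upward GI)) < b * real (newton_lcm J)"
    and v: "\<And>j. 0 < v $ j" "int CARD('n) - int i \<le> aff_dim (face v)"
  shows "\<exists>t x. 0 \<le> t \<and> t < b \<and> x \<in> K \<and> v \<bullet> x = h v \<and> t *\<^sub>R x \<in> newton_gens.K GI"
proof -
  interpret I: newton_gens GI by (rule I)
  obtain v' where v': "\<And>j. 0 < v' $ j" "face v' \<subseteq> face v" "aff_dim (face v') = int CARD('n) - int i"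
    using ex_subface[OF v(1) _ v(2)] d by auto
  define D where "D = newton_face v' K"
  have D: "D = convex hull face v'"
    unfolding D_def using v'(1) by (rule newton_face_K)
  have "v' \<in> nonneg_vecs"
    using v'(1) by (auto simp: nonneg_vecs_def less_imp_le)
  then have "D \<in> compact_faces J (int CARD('n) - int i)"
    unfolding compact_faces_def newton_poly_eq D_def
    using compact_newton_face[OF v'(1)] aff_dim_newton_face[OF v'(1)] v'(3) by auto
  then have "filtration_min J (I.K \<inter> half_lines D) \<le> face_order i J I.J"
    unfolding face_order_def I.newton_poly_eq using finite_compact_faces d by (intro Max_ge) auto
  then have less: "(INF k\<in>I.K \<inter> half_lines D. newton_filtration J k) < b * real (newton_lcm J)"
    using a unfolding filtration_min_def by linarith
  \<comment> \<open>The pure powers in \<open>GI\<close> put a multiple of any generator of the face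
    into \<open>I.K\<close>; an infimum over an empty set would give no point.\<close>
  have "I.K \<inter> half_lines D \<noteq> {}"
  proof -
    have "face v' \<noteq> {}"
      using v'(3) d by auto
    then obtain g where g: "g \<in> G" "real_vec g \<in> face v'"
      unfolding face_def by blast
    then have "g \<noteq> 0"
      using zero by blast
    then obtain j where "g $ j \<noteq> 0"
      by (auto simp: vec_eq_iff)
    then have j: "1 \<le> g $ j"
      by simp
    obtain c where c: "0 < c" "axis j (real c) \<in> I.W"
      using I.axis_in_W by blast
    have "real c * 1 \<le> real c * real (g $ j)"
      using j by (intro mult_left_mono) auto
    then have "real c *\<^sub>R real_vec g - axis j (real c) \<in> nonneg_vecs"
      by (auto simp: nonneg_vecs_def axis_def real_vec_nth)
    then have "axis j (real c) + (real c *\<^sub>R real_vec g - axis j (real c)) \<in> I.K"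
      using I.W_subset_K c(2) by (intro I.K_add) auto
    then have "real c *\<^sub>R real_vec g \<in> I.K"
      by simp
    moreover have "real c *\<^sub>R real_vec g \<in> half_lines D"
      unfolding half_lines_def D using hull_inc[OF g(2), of convex] by force
    ultimately show ?thesis by blast
  qed
  from cInf_lessD[OF _ less] this obtain k where k: "k \<in> I.K" "k \<in> half_lines D" "newton_filtration J k < b * real (newton_lcm J)"
    by auto
  obtain t x where tx: "k = t *\<^sub>R x" "0 \<le> t" "x \<in> D"
    using k(2) unfolding half_lines_def by blast
  have xK: "x \<in> K"
    using tx(3) unfolding D_def newton_face_def by blast
  have "t * real (newton_lcm J) < b * real (newton_lcm J)"
    using newton_filtration_ge[OF tx(2) xK] k(3) unfolding tx(1) by linarith
  then have "t < b"
    using newton_lcm_pos by simp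
  have "face v' \<subseteq> {x. v \<bullet> x = h v}"
    using v'(2) unfolding face_eq by blast
  then have "convex hull face v' \<subseteq> {x. v \<bullet> x = h v}"
    by (intro hull_minimal convex_hyperplane)
  then have "v \<bullet> x = h v"
    using tx(3) unfolding D by blast
  then show ?thesis
    using tx(1,2) \<open>t < b\<close> xK k(1) by blast
qed

end

section \<open>Hilbert polynomials and mixed multiplicities in terms of lattice points\<close>

definition has_hilbert_coeffs :: "(nat \<Rightarrow> (nat ^ 'n::finite) set) \<Rightarrow> ((nat \<Rightarrow> nat) \<Rightarrow> real) \<Rightarrow> bool" where
  "has_hilbert_coeffs A c \<longleftrightarrow> (\<exists>N. \<forall>r. (\<forall>j<CARD('n). N \<le> r j) \<longrightarrow>
     real (card (- set_power_prod A r CARD('n))) =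
     (\<Sum>k\<in>poly_exponents CARD('n). c k * (\<Prod>j<CARD('n). real (r j) ^ k j)))"

text \<open>Exponents of at least 1 keep the product a proper ideal, as
  \<open>monomial_quotient\<close> requires; this is why the thresholds are raised to
  \<open>max 1 N\<close>.\<close>

lemma hilbert_polynomial_iff:
  fixes A :: "nat \<Rightarrow> (nat ^ 'n::finite) set"
  assumes A: "\<And>j. upward (A j) = A j" "\<And>j. finite (- A j)" "\<And>j. 0 \<notin> A j"
  shows "hilbert_polynomial (\<lambda>j. germs_in (A j)) c \<longleftrightarrow> has_hilbert_coeffs A c"
proof -
  have eq: "colength (\<Otimes>\<^bsub>ideals_set \<O>\<^esub>j\<in>{..<CARD('n)}. ideal_pow (germs_in (A j)) (r j)) =
      card (- set_power_prod A r CARD('n))" if "\<forall>j<CARD('n). 1 \<le> r j" for r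
  proof -
    obtain p where p: "CARD('n) = Suc p"
      using not0_implies_Suc[of "CARD('n)"] by auto
    have "0 \<notin> set_power_prod A r CARD('n)"
      unfolding p using that p by (intro zero_notin_set_power_prod A(3)) auto
    then interpret monomial_quotient "set_power_prod A r CARD('n)"
      by unfold_locales (intro finprod_germs_in(2)[of A] A(1))
    show ?thesis
      unfolding finprod_germs_in(1)[of A, OF A(1)]
      by (intro colength_eq finite_compl_set_power_prod A)
  qed
  show ?thesis
  proof
    assume "hilbert_polynomial (\<lambda>j. germs_in (A j)) c"
    then obtain N where N: "\<And>r. (\<forall>j<CARD('n). N \<le> r j) \<Longrightarrow>
       real (colength (\<Otimes>\<^bsub>ideals_set \<O>\<^esub>j\<in>{..<CARD('n)}. ideal_pow (germs_in (A j)) (r j))) =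
       (\<Sum>k\<in>poly_exponents CARD('n). c k * (\<Prod>j<CARD('n). real (r j) ^ k j))"
      unfolding hilbert_polynomial_def by blast
    show "has_hilbert_coeffs A c"
      unfolding has_hilbert_coeffs_def
    proof (intro exI[of _ "max 1 N"] allI impI)
      fix r :: "nat \<Rightarrow> nat" assume r: "\<forall>j<CARD('n). max 1 N \<le> r j"
      show "real (card (- set_power_prod A r CARD('n))) =
        (\<Sum>k\<in>poly_exponents CARD('n). c k * (\<Prod>j<CARD('n). real (r j) ^ k j))"
        using N[of r] eq[of r] r by simp
    qed
  next
    assume "has_hilbert_coeffs A c"
    then obtain N where N: "\<And>r. (\<forall>j<CARD('n). N \<le> r j) \<Longrightarrow>
       real (card (- set_power_prod A r CARD('n))) =
       (\<Sum>k\<in>poly_exponents CARD('n). c k * (\<Prod>j<CARD('n). real (r j) ^ k j))"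
      unfolding has_hilbert_coeffs_def by blast
    show "hilbert_polynomial (\<lambda>j. germs_in (A j)) c"
      unfolding hilbert_polynomial_def
    proof (intro exI[of _ "max 1 N"] allI impI)
      fix r :: "nat \<Rightarrow> nat" assume r: "\<forall>j<CARD('n). max 1 N \<le> r j"
      show "real (colength (\<Otimes>\<^bsub>ideals_set \<O>\<^esub>j\<in>{..<CARD('n)}. ideal_pow (germs_in (A j)) (r j))) =
        (\<Sum>k\<in>poly_exponents CARD('n). c k * (\<Prod>j<CARD('n). real (r j) ^ k j))"
        using N[of r] eq[of r] r by simp
    qed
  qed
qed

lemma finite_poly_exponents: "finite (poly_exponents n)"
  unfolding poly_exponents_def by (rule finite_bounded_exponents)

lemma ones_in_poly_exponents: "(\<lambda>j. if j < n then 1 else 0) \<in> poly_exponents n"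
  by (simp add: poly_exponents_def)

lemma mixed_multiplicity_eqI:
  fixes A :: "nat \<Rightarrow> (nat ^ 'n::finite) set"
  assumes A: "\<And>j. upward (A j) = A j" "\<And>j. finite (- A j)" "\<And>j. 0 \<notin> A j"
    and c: "has_hilbert_coeffs A c"
  shows "mixed_multiplicity (\<lambda>j. germs_in (A j)) = c (\<lambda>j. if j < CARD('n) then 1 else 0)"
  unfolding mixed_multiplicity_def
proof (rule the_equality)
  show "\<exists>d. hilbert_polynomial (\<lambda>j. germs_in (A j)) d \<and>
      c (\<lambda>j. if j < CARD('n) then 1 else 0) = d (\<lambda>j. if j < CARD('n) then 1 else 0)"
    using c hilbert_polynomial_iff[of A, OF A] by blast
  fix e assume "\<exists>d. hilbert_polynomial (\<lambda>j. germs_in (A j)) d \<and> e = d (\<lambda>j. if j < CARD('n) then 1 else 0)"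
  then obtain d where d: "has_hilbert_coeffs A d" "e = d (\<lambda>j. if j < CARD('n) then 1 else 0)"
    using hilbert_polynomial_iff[of A, OF A] by blast
  obtain N where N: "\<And>r. (\<forall>j<CARD('n). N \<le> r j) \<Longrightarrow>
       real (card (- set_power_prod A r CARD('n))) =
       (\<Sum>k\<in>poly_exponents CARD('n). c k * (\<Prod>j<CARD('n). real (r j) ^ k j))"
    using c unfolding has_hilbert_coeffs_def by blast
  obtain M where M: "\<And>r. (\<forall>j<CARD('n). M \<le> r j) \<Longrightarrow>
       real (card (- set_power_prod A r CARD('n))) =
       (\<Sum>k\<in>poly_exponents CARD('n). d k * (\<Prod>j<CARD('n). real (r j) ^ k j))"
    using d(1) unfolding has_hilbert_coeffs_def by blast
  have "c (\<lambda>j. if j < CARD('n) then 1 else 0) = d (\<lambda>j. if j < CARD('n) then 1 else 0)"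
    by (rule eventually_poly_coeff_unique[OF finite_poly_exponents _ N M ones_in_poly_exponents])
      (auto simp: poly_exponents_def)
  then show "e = c (\<lambda>j. if j < CARD('n) then 1 else 0)"
    using d(2) by simp
qed

lemma ex_hilbert_coeffs:
  fixes A :: "nat \<Rightarrow> (nat ^ 'n::finite) set"
  assumes "\<And>j. upward (A j) = A j" "\<And>j. finite (- A j)"
  shows "\<exists>c. has_hilbert_coeffs A c"
  unfolding has_hilbert_coeffs_def poly_exponents_def
  by (rule hilbert_function_polynomial[of A "CARD('n)", OF assms])

lemma set_plus_mono_left: "A \<subseteq> B \<Longrightarrow> A + C \<subseteq> B + (C :: 'a::plus set)"
  by (intro set_plus_mono2) auto

lemma set_power_mono: "A \<subseteq> B \<Longrightarrow> set_power A r \<subseteq> set_power B r"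
proof (induction r)
  case (Suc r)
  then show ?case
    unfolding set_power.simps by (intro set_plus_mono2)
qed simp

text \<open>The two Hilbert functions count complements of nested sets, so their difference is
  nonnegative and counts the points treated by \<open>card_exchange_defect\<close>.
  \<open>multilinear_coeff_vanishes\<close> then applies to the difference of the
  coefficients.\<close>

theorem mixed_multiplicity_eq:
  fixes GI GJ :: "(nat ^ 'n::finite) set"
  assumes gens: "newton_gens GI" "newton_gens GJ"
    and fin: "finite (- upward GI)" "finite (- upward GJ)"
    and i: "1 \<le> i" "i < CARD('n)" and rs: "1 \<le> s" "s \<le> r"
    and H: "\<And>v :: real ^ 'n. (\<And>j. 0 < v $ j) \<Longrightarrow> int CARD('n) - int i \<le> aff_dim (newton_gens.face GJ v) \<Longrightarrow>
      real s * newton_gens.h GI v \<le> real r * newton_gens.h GJ v"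
  defines "I \<equiv> germs_in (upward GI)" and "J \<equiv> germs_in (upward GJ)"
  shows "mixed_multiplicity (\<lambda>j. ideal_pow (if j < i then I else J) s) =
    mixed_multiplicity (\<lambda>j. ideal_pow (if j < i then I else J) s <+>\<^bsub>\<O>\<^esub> ideal_pow J r)"
proof -
  interpret I: newton_gens GI by (rule gens)
  interpret J: newton_gens GJ by (rule gens)
  let ?n = "CARD('n)"
  define UI where "UI = upward GI"
  define UJ where "UJ = upward GJ"
  have up: "upward UI = UI" "upward UJ = UJ"
    by (simp_all add: UI_def UJ_def upward_upward)
  have zero: "0 \<notin> UI" "0 \<notin> UJ"
  proof -
    have "(0 :: nat ^ 'n) \<notin> upward S" if "0 \<notin> S" for S
    proof
      assume "(0 :: nat ^ 'n) \<in> upward S"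
      then obtain s where "s \<in> S" "s \<le> 0"
        unfolding upward_def by blast
      then have "s = 0"
        by (simp add: less_eq_vec_def vec_eq_iff)
      then show False
        using \<open>s \<in> S\<close> that by simp
    qed
    then show "0 \<notin> UI" "0 \<notin> UJ"
      unfolding UI_def UJ_def using I.zero J.zero by blast+
  qed
  define P where "P = set_power UI s"
  define Q where "Q = P \<union> set_power UJ r"
  define S where "S = set_power UJ s"
  have r1: "1 \<le> r"
    using rs by simp
  have upP: "upward P = P" and upS: "upward S = S" and upR: "upward (set_power UJ r) = set_power UJ r"
    unfolding P_def S_def by (intro upward_set_power up)+
  have upQ: "upward Q = Q"
    using upP upR unfolding Q_def upward_def by blast
  have finP: "finite (- P)" and finS: "finite (- S)"
    unfolding P_def S_def using cofinite_set_power up fin by (auto simp: UI_def UJ_def)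
  have finQ: "finite (- Q)"
    by (rule finite_subset[OF _ finP]) (auto simp: Q_def)
  have zeroP: "0 \<notin> P" and zeroS: "0 \<notin> S" and zeroQ: "0 \<notin> Q"
    unfolding P_def S_def Q_def using zero_notin_set_power zero rs r1 by blast+
  define A where "A j = (if j < i then P else S)" for j :: nat
  define A' where "A' j = (if j < i then Q else S)" for j :: nat
  have A: "upward (A j) = A j" "finite (- A j)" "0 \<notin> A j" for j
    by (auto simp: A_def upP upS finP finS zeroP zeroS)
  have A': "upward (A' j) = A' j" "finite (- A' j)" "0 \<notin> A' j" for j
    by (auto simp: A'_def upQ upS finQ finS zeroQ zeroS)
  have I_eq: "ideal_pow (if j < i then I else J) s = germs_in (A j)" for j
    unfolding I_def J_def A_def P_def S_def UI_def UJ_def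
    using ideal_pow_germs_in(1)[OF upward_upward] by auto
  have I'_eq: "ideal_pow (if j < i then I else J) s <+>\<^bsub>\<O>\<^esub> ideal_pow J r = germs_in (A' j)" for j
  proof -
    have "ideal_pow J r = germs_in (set_power UJ r)"
      unfolding J_def UJ_def by (rule ideal_pow_germs_in(1)[OF upward_upward])
    then have "ideal_pow (if j < i then I else J) s <+>\<^bsub>\<O>\<^esub> ideal_pow J r = germs_in (A j \<union> set_power UJ r)"
      unfolding I_eq by (simp add: set_add_germs_in A upR)
    \<comment> \<open>For \<open>j \<ge> i\<close> the summand \<open>J^r\<close> is absorbed, since
      \<open>s \<le> r\<close> puts it inside \<open>J^s\<close>.\<close>
    also have "A j \<union> set_power UJ r = A' j"
      using set_power_antimono[OF up(2) rs(2)] unfolding A_def A'_def Q_def S_def by auto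
    finally show ?thesis .
  qed
  obtain c where c: "has_hilbert_coeffs A c"
    using ex_hilbert_coeffs[of A, OF A(1,2)] by blast
  obtain c' where c': "has_hilbert_coeffs A' c'"
    using ex_hilbert_coeffs[of A', OF A'(1,2)] by blast
  obtain N where N: "\<And>r. (\<forall>j<?n. N \<le> r j) \<Longrightarrow> real (card (- set_power_prod A r ?n)) =
       (\<Sum>k\<in>poly_exponents ?n. c k * (\<Prod>j<?n. real (r j) ^ k j))"
    using c unfolding has_hilbert_coeffs_def by blast
  obtain N' where N': "\<And>r. (\<forall>j<?n. N' \<le> r j) \<Longrightarrow> real (card (- set_power_prod A' r ?n)) =
       (\<Sum>k\<in>poly_exponents ?n. c' k * (\<Prod>j<?n. real (r j) ^ k j))"
    using c' unfolding has_hilbert_coeffs_def by blast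
  have prodA: "set_power_prod A q ?n = set_power P (\<Sum>j<i. q j) + set_power UJ (s * (\<Sum>j=i..<?n. q j))" for q
    unfolding A_def using set_power_prod_two[OF upP upS, of i ?n q] i set_power_mult[OF up(2)] by (simp add: S_def)
  have prodA': "set_power_prod A' q ?n = set_power Q (\<Sum>j<i. q j) + set_power UJ (s * (\<Sum>j=i..<?n. q j))" for q
    unfolding A'_def using set_power_prod_two[OF upQ upS, of i ?n q] i set_power_mult[OF up(2)] by (simp add: S_def)
  have sub: "set_power_prod A q ?n \<subseteq> set_power_prod A' q ?n" for q
    unfolding prodA prodA' by (intro set_plus_mono_left set_power_mono) (simp add: Q_def)
  have card_diff: "real (card (- set_power_prod A q ?n)) - real (card (- set_power_prod A' q ?n)) =
      real (card (set_power_prod A' q ?n - set_power_prod A q ?n))" for q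
  proof -
    have fin1: "finite (- set_power_prod A q ?n)"
      by (intro finite_compl_set_power_prod A)
    have "set_power_prod A' q ?n - set_power_prod A q ?n = - set_power_prod A q ?n - - set_power_prod A' q ?n"
      by blast
    moreover have sub': "- set_power_prod A' q ?n \<subseteq> - set_power_prod A q ?n"
      using sub[of q] by blast
    ultimately have "card (set_power_prod A' q ?n - set_power_prod A q ?n) =
        card (- set_power_prod A q ?n) - card (- set_power_prod A' q ?n)"
      using card_Diff_subset[OF finite_subset[OF sub' fin1] sub'] by (simp only:)
    moreover have "card (- set_power_prod A' q ?n) \<le> card (- set_power_prod A q ?n)"
      using sub[of q] by (intro card_mono fin1) blast
    ultimately show ?thesis
      by (simp add: of_nat_diff)
  qed
  obtain GP where GP: "finite GP" "GP \<subseteq> P" "upward GP = P"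
    using dickson_vec[of P] upP by auto
  obtain GQ where GQ: "finite GQ" "GQ \<subseteq> Q" "upward GQ = Q"
    using dickson_vec[of Q] upQ by auto
  \<comment> \<open>With this \<open>d\<close>, \<open>int d < aff_dim\<close> says that the
    dimension is at least \<open>n - i\<close>, where \<open>H\<close> applies.\<close>
  define d where "d = ?n - i - 1"
  have "\<exists>C. \<forall>m a b. 1 \<le> m \<longrightarrow> 1 \<le> a \<longrightarrow> b \<le> m * a \<longrightarrow>
    card ((set_power (upward GQ) a + set_power (upward GJ) b) - (set_power (upward GP) a + set_power (upward GJ) b)) \<le>
      C * (m ^ d * a ^ ?n + (a + b) ^ (?n - 1))"
  proof (rule card_exchange_defect[OF GP(1) GQ(1) J.finG])
    show "\<exists>c. axis j c \<in> GP" for j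
      using cofinite_contains_axis[OF finP, of j] upward_contains_axis GP(3) by metis
    show "\<exists>c. axis j c \<in> GJ" for j
      by (rule J.axis)
    fix v :: "real ^ 'n" and q
    assume v: "\<And>j. 0 < v $ j" and dim: "int d < aff_dim {w \<in> J.W. \<forall>w'\<in>J.W. v \<bullet> w \<le> v \<bullet> w'}" and q: "q \<in> GQ"
    have v0: "v \<in> nonneg_vecs"
      using v by (auto simp: nonneg_vecs_def less_imp_le)
    have mono: "v \<bullet> real_vec x \<le> v \<bullet> real_vec y" if xy: "x \<le> y" for x y
    proof -
      obtain m where "y = x + m"
        using xy unfolding nat_vec_le_iff_add by blast
      moreover have "0 \<le> v \<bullet> real_vec m"
        by (rule J.nonneg_inner[OF v0 J.real_vec_nonneg])
      ultimately show ?thesis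
        by (simp add: real_vec_add inner_add_right)
    qed
    have ex: "\<exists>p\<in>GP. v \<bullet> real_vec p \<le> v \<bullet> real_vec x" if x: "x \<in> P" for x
    proof -
      obtain p where "p \<in> GP" "p \<le> x"
        using x unfolding GP(3)[symmetric] upward_def by blast
      then show ?thesis using mono by blast
    qed
    show "\<exists>p\<in>GP. v \<bullet> real_vec p \<le> v \<bullet> real_vec q"
    proof (cases "q \<in> P")
      case True
      then show ?thesis by (rule ex)
    next
      case False
      then have "q \<in> set_power (upward GJ) r"
        using q GQ(2) unfolding Q_def UJ_def by blast
      then obtain f where f: "sum f GJ = r" "(\<Sum>g\<in>GJ. f g *s g) \<le> q"
        using set_power_upward_iff[OF J.finG] by blast
      have "real r * J.h v = (\<Sum>g\<in>GJ. real (f g) * J.h v)"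
        using f(1) by (simp add: sum_distrib_right[symmetric] of_nat_sum[symmetric] del: of_nat_sum)
      also have "\<dots> \<le> (\<Sum>g\<in>GJ. real (f g) * (v \<bullet> real_vec g))"
        using J.h_le by (intro sum_mono mult_left_mono) auto
      also have "\<dots> = v \<bullet> real_vec (\<Sum>g\<in>GJ. f g *s g)"
        by (simp add: real_vec_sum real_vec_scale inner_sum_right)
      also have "\<dots> \<le> v \<bullet> real_vec q"
        by (rule mono[OF f(2)])
      finally have rq: "real r * J.h v \<le> v \<bullet> real_vec q" .
      obtain g where g: "g \<in> GI" "I.h v = v \<bullet> real_vec g"
        using I.h_attained[of v] by blast
      \<comment> \<open>\<open>s\<close> copies of a minimiser \<open>g\<close> of \<open>v\<close>
        on \<open>GI\<close> give a point of \<open>P\<close> of value \<open>s * I.h v\<close>; by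
        \<open>H\<close> this is at most \<open>r * J.h v\<close>, hence at most the value of
        \<open>q\<close>.\<close>
      have "(\<Sum>x\<in>GI. (if x = g then s else 0) *s x) \<le> s *s g"
      proof -
        have "(\<Sum>x\<in>GI. (if x = g then s else 0) *s x) = (\<Sum>x\<in>GI. if x = g then s *s g else 0)"
          by (intro sum.cong) (auto simp: vec_eq_iff)
        also have "\<dots> = s *s g"
          using g(1) I.finG by simp
        finally show ?thesis by simp
      qed
      moreover have "(\<Sum>x\<in>GI. if x = g then s else 0) = s"
        using g(1) I.finG by simp
      ultimately have "s *s g \<in> P"
        unfolding P_def UI_def set_power_upward_iff[OF I.finG] by (intro exI[of _ "\<lambda>x. if x = g then s else 0"]) simp
      then obtain p where p: "p \<in> GP" "v \<bullet> real_vec p \<le> v \<bullet> real_vec (s *s g)"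
        using ex by blast
      have "v \<bullet> real_vec (s *s g) = real s * I.h v"
        by (simp add: real_vec_scale g(2))
      also have "\<dots> \<le> real r * J.h v"
      proof (rule H[OF v])
        have "int ?n - int i = int d + 1"
          unfolding d_def using i by simp
        then show "int ?n - int i \<le> aff_dim (J.face v)"
          using dim unfolding J.face_def by simp
      qed
      finally show ?thesis
        using p rq by (intro bexI[of _ p]) auto
    qed
  qed
  then obtain C where C: "\<And>m a b. 1 \<le> m \<Longrightarrow> 1 \<le> a \<Longrightarrow> b \<le> m * a \<Longrightarrow>
    card ((set_power Q a + set_power UJ b) - (set_power P a + set_power UJ b)) \<le> C * (m ^ d * a ^ ?n + (a + b) ^ (?n - 1))"
    unfolding GP(3) GQ(3) UJ_def[symmetric] by blast
  \<comment> \<open>\<open>C\<close> is used with \<open>s * ?b\<close> as its \<open>b\<close>,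
    since the last factors are \<open>s\<close>-th powers of \<open>UJ\<close>. The ratio becomes
    \<open>s * m\<close>, and the powers of \<open>s\<close> move into the constant.\<close>
  have bound: "real (card (set_power_prod A' q ?n - set_power_prod A q ?n)) \<le>
      real (C * (s ^ d + s ^ (?n - 1))) * (real m ^ d * real (\<Sum>j<i. q j) ^ ?n + real (\<Sum>j<?n. q j) ^ (?n - 1))"
    if q: "\<forall>j<?n. 1 \<le> q j" "1 \<le> m" "(\<Sum>j=i..<?n. q j) \<le> m * (\<Sum>j<i. q j)" for m q
  proof -
    let ?a = "\<Sum>j<i. q j" and ?b = "\<Sum>j=i..<?n. q j"
    have "q 0 \<le> ?a"
      using i by (intro member_le_sum) auto
    then have a: "1 \<le> ?a"
      using q(1) i by (metis le_trans less_trans zero_less_one_class.zero_less_one zero_less_card_finite)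
    have sb: "s * ?b \<le> s * m * ?a"
      using q(3) by (metis mult.assoc mult_le_mono2)
    have split: "{..<?n} = {..<i} \<union> {i..<?n}"
      using i by auto
    have ab: "(\<Sum>j<?n. q j) = ?a + ?b"
      unfolding split by (rule sum.union_disjoint) auto
    have "?a + s * ?b \<le> s * (?a + ?b)"
      using rs(1) by (simp add: distrib_left)
    then have "(?a + s * ?b) ^ (?n - 1) \<le> s ^ (?n - 1) * (\<Sum>j<?n. q j) ^ (?n - 1)"
      unfolding ab power_mult_distrib[symmetric] by (rule power_mono) simp
    moreover have "(s * m) ^ d = s ^ d * m ^ d"
      by (rule power_mult_distrib)
    ultimately have "(s * m) ^ d * ?a ^ ?n + (?a + s * ?b) ^ (?n - 1) \<le>
        (s ^ d + s ^ (?n - 1)) * (m ^ d * ?a ^ ?n + (\<Sum>j<?n. q j) ^ (?n - 1))"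
      by (simp add: distrib_left distrib_right mult.assoc)
    then have "C * ((s * m) ^ d * ?a ^ ?n + (?a + s * ?b) ^ (?n - 1)) \<le>
        C * ((s ^ d + s ^ (?n - 1)) * (m ^ d * ?a ^ ?n + (\<Sum>j<?n. q j) ^ (?n - 1)))"
      by (rule mult_le_mono2)
    moreover have "card (set_power_prod A' q ?n - set_power_prod A q ?n) \<le>
        C * ((s * m) ^ d * ?a ^ ?n + (?a + s * ?b) ^ (?n - 1))"
      unfolding prodA prodA' using rs(1) q(2) a sb by (intro C) auto
    ultimately have "card (set_power_prod A' q ?n - set_power_prod A q ?n) \<le>
        C * ((s ^ d + s ^ (?n - 1)) * (m ^ d * ?a ^ ?n + (\<Sum>j<?n. q j) ^ (?n - 1)))"
      by linarith
    then have "real (card (set_power_prod A' q ?n - set_power_prod A q ?n)) \<le>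
        real (C * ((s ^ d + s ^ (?n - 1)) * (m ^ d * ?a ^ ?n + (\<Sum>j<?n. q j) ^ (?n - 1))))"
      by (simp only: of_nat_le_iff)
    then show ?thesis
      by (simp only: of_nat_mult of_nat_add of_nat_power mult.assoc)
  qed
  define M where "M = max 1 (max N N')"
  have diff: "(\<Sum>k | (\<forall>j\<ge>?n. k j = 0) \<and> (\<Sum>j<?n. k j) \<le> ?n. (c k - c' k) * (\<Prod>j<?n. real (q j) ^ k j)) =
      real (card (set_power_prod A' q ?n - set_power_prod A q ?n))" if "\<forall>j<?n. M \<le> q j" for q
    using that N[of q] N'[of q] card_diff[of q] unfolding poly_exponents_def M_def
    by (simp add: left_diff_distrib sum_subtractf)
  have "c (\<lambda>j. if j < ?n then 1 else 0) - c' (\<lambda>j. if j < ?n then 1 else 0) = 0"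
  proof (rule multilinear_coeff_vanishes[where c = "\<lambda>k. c k - c' k" and n = ?n and i = i and d = d and N = M
        and C = "real (C * (s ^ d + s ^ (?n - 1)))"])
    show "d + i < ?n"
      unfolding d_def using i by simp
    fix q :: "nat \<Rightarrow> nat" assume q: "\<forall>j<?n. M \<le> q j"
    show "0 \<le> (\<Sum>k | (\<forall>j\<ge>?n. k j = 0) \<and> (\<Sum>j<?n. k j) \<le> ?n. (c k - c' k) * (\<Prod>j<?n. real (q j) ^ k j))"
      unfolding diff[OF q] by simp
    fix m :: nat assume m: "1 \<le> m" "(\<Sum>j=i..<?n. q j) \<le> m * (\<Sum>j<i. q j)"
    show "(\<Sum>k | (\<forall>j\<ge>?n. k j = 0) \<and> (\<Sum>j<?n. k j) \<le> ?n. (c k - c' k) * (\<Prod>j<?n. real (q j) ^ k j)) \<le>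
      real (C * (s ^ d + s ^ (?n - 1))) * (real m ^ d * real (\<Sum>j<i. q j) ^ ?n + real (\<Sum>j<?n. q j) ^ (?n - 1))"
      unfolding diff[OF q] using q m by (intro bound) (auto simp: M_def)
  qed (use i in auto)
  then show ?thesis
    unfolding I'_eq unfolding I_eq mixed_multiplicity_eqI[of A, OF A c] mixed_multiplicity_eqI[of A', OF A' c'] by simp
qed

theorem corollary6p4:
  fixes I J :: "'n::finite germ set" and i :: nat
  assumes "monomial_ideal I" and "monomial_ideal J"
    and "finite_colength I" and "finite_colength J"
    and "I \<subseteq> integral_closure \<O> J"
    and "1 \<le> i" and "i \<le> CARD('n) - 1"
  shows "lojasiewicz_rel i J I \<le> ereal (face_order i J I / real (newton_lcm J))"
proof -
  obtain GI where GI: "I = germs_in (upward GI)" "finite (- upward GI)" "newton_gens GI"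
    using monomial_ideal_generators[OF assms(1,3)] by blast
  obtain GJ where GJ: "J = germs_in (upward GJ)" "finite (- upward GJ)" "newton_gens GJ"
    using monomial_ideal_generators[OF assms(2,4)] by blast
  interpret I: newton_gens GI by (rule GI)
  interpret J: newton_gens GJ by (rule GJ)
  define \<beta> where "\<beta> = face_order i J I / real (newton_lcm J)"
  have i: "1 \<le> i" "i < CARD('n)"
    using assms(6,7) by auto
  have M: "0 < real (newton_lcm J)"
    using J.newton_lcm_pos unfolding GJ(1) by simp
  have KIJ: "I.K \<subseteq> J.K"
  proof -
    have "I.W \<subseteq> J.K"
    proof clarify
      fix g assume "g \<in> GI"
      then have "monom_germ g \<in> I"
        unfolding GI(1) monom_in_germs_in using subset_upward by blast
      then show "real_vec g \<in> J.K"
        using assms(5) unfolding GJ(1) by (intro J.integral_closure_monomial) blast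
    qed
    then have "convex hull I.W \<subseteq> J.K"
      by (rule hull_minimal) (rule J.convex_K)
    then show ?thesis
      unfolding I.K_def using J.K_add by blast
  qed
  have point: "\<exists>t x. 0 \<le> t \<and> t < real r / real s \<and> x \<in> J.K \<and> v \<bullet> x = J.h v \<and> t *\<^sub>R x \<in> I.K"
    if "\<beta> < real r / real s" "\<And>j. 0 < v $ j" "int CARD('n) - int i \<le> aff_dim (J.face v)" for r s v
  proof (rule J.ex_point_on_half_lines[OF GI(3) i _ that(2,3)])
    show "face_order i J.J I.J < real r / real s * real (newton_lcm J.J)"
      using that(1) M unfolding \<beta>_def GI(1) GJ(1) by (simp add: divide_less_eq)
  qed
  \<comment> \<open>Tested at a facet normal of \<open>J\<close>: the point
    \<open>t *\<^sub>R x\<close> lies in \<open>I.K\<close>, hence in \<open>J.K\<close>, so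
    \<open>t\<close> times the positive minimum is at least that minimum. Therefore
    \<open>1 \<le> t < r / s\<close>.\<close>
  have sr: "s < r" if \<beta>: "\<beta> < real r / real s" "1 \<le> s" for r s
  proof -
    obtain u where u: "u \<in> J.facets"
      using J.facets_nonempty by blast
    let ?v = "real_vec u"
    obtain t x where tx: "0 \<le> t" "t < real r / real s" "?v \<bullet> x = J.h ?v" "t *\<^sub>R x \<in> I.K"
      using point[OF \<beta>(1) J.facetsD(2)[OF u]] J.facetsD(3)[OF u] i by auto
    have "J.h ?v \<le> ?v \<bullet> (t *\<^sub>R x)"
      using KIJ tx(4) by (intro J.h_le_K[OF J.real_vec_nonneg]) blast
    then have "1 * J.h ?v \<le> t * J.h ?v"
      using tx(3) by simp
    then have "1 \<le> t"
      using J.facetsD(1)[OF u] by (simp add: mult_le_cancel_right)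
    then have "1 < real r / real s"
      using tx(2) by linarith
    then show ?thesis
      using \<beta>(2) by (simp add: less_divide_eq)
  qed
  have main: "lojasiewicz_rel i J I \<le> ereal (real r / real s)" if \<beta>: "\<beta> < real r / real s" "1 \<le> s" for r s
  proof -
    have "s \<le> r"
      using sr[OF \<beta>] by simp
    moreover have "real s * I.h v \<le> real r * J.h v"
      if v: "\<And>j. 0 < v $ j" "int CARD('n) - int i \<le> aff_dim (J.face v)" for v
    proof -
      have v0: "v \<in> nonneg_vecs"
        using v by (auto simp: nonneg_vecs_def less_imp_le)
      obtain t x where tx: "t < real r / real s" "v \<bullet> x = J.h v" "t *\<^sub>R x \<in> I.K"
        using point[OF \<beta>(1) v] by blast
      have "I.h v \<le> t * J.h v"
        using I.h_le_K[OF v0 tx(3)] tx(2) by simp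
      also have "\<dots> \<le> real r / real s * J.h v"
        using tx(1) J.h_pos[OF v(1)] by (intro mult_right_mono) auto
      finally show ?thesis
        using \<beta>(2) by (simp add: field_simps)
    qed
    ultimately have "mixed_multiplicity (\<lambda>j. ideal_pow (if j < i then I else J) s) =
        mixed_multiplicity (\<lambda>j. ideal_pow (if j < i then I else J) s <+>\<^bsub>\<O>\<^esub> ideal_pow J r)"
      unfolding GI(1) GJ(1) using mixed_multiplicity_eq[OF GI(3) GJ(3) GI(2) GJ(2) i \<beta>(2)] by blast
    then show ?thesis
      unfolding lojasiewicz_rel_def lojasiewicz_def using \<beta>(2) \<open>s \<le> r\<close>
      by (intro Inf_lower CollectI exI[of _ r] exI[of _ s]) auto
  qed
  have "lojasiewicz_rel i J I \<le> ereal \<beta> + ereal e" if e: "0 < e" for e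
  proof -
    have rat: "\<exists>r s. real r / real s < y \<and> x < real r / real s \<and> 1 \<le> s" if xy: "x < y" "0 < y" for x y :: real
    proof -
      obtain q where q: "q \<in> \<rat>" "max x 0 < q" "q < y"
        using Rats_dense_in_real[of "max x 0" y] xy by auto
      obtain r s :: nat where rs: "s \<noteq> 0" "\<bar>q\<bar> = real r / real s"
        by (rule Rats_abs_nat_div_natE[OF q(1)])
      then show ?thesis
        using q rs by (intro exI[of _ r] exI[of _ s]) auto
    qed
    \<comment> \<open>A fraction between \<open>\<beta>\<close> and 1 would contradict
      \<open>sr\<close>. The bound makes \<open>\<beta> + e\<close> positive, as \<open>rat\<close>
      demands of its upper end because its fractions are nonnegative.\<close>
    have "1 \<le> \<beta>"
    proof (rule ccontr)
      assume "\<not> 1 \<le> \<beta>"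
      then obtain r s where "real r / real s < 1" "\<beta> < real r / real s" "1 \<le> s"
        using rat[of \<beta> 1] by auto
      then show False
        using sr[of r s] by (simp add: divide_less_eq)
    qed
    then obtain r s where rs: "real r / real s < \<beta> + e" "\<beta> < real r / real s" "1 \<le> s"
      using rat[of \<beta> "\<beta> + e"] e by auto
    have "lojasiewicz_rel i J I \<le> ereal (real r / real s)"
      by (rule main[OF rs(2,3)])
    also have "\<dots> \<le> ereal \<beta> + ereal e"
      using rs(1) by simp
    finally show ?thesis .
  qed
  then show ?thesis
    unfolding \<beta>_def by (rule ereal_le_epsilon2)
qed

end
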